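(* Let $\mathfrak{g}$ be a finite dimensional simple Lie algebra over $\mathbb{C}$, and let $A=\wedge(\mathfrak{g}\oplus\mathfrak{g})/I$ be the bigraded algebra defined in the context, with subalgebra of invariants $A^{\mathfrak{g}}$. Then any nonzero (bi)homogeneous element of $A^{\mathfrak{g}}$ has bidegree $(d,d)$ for some $d\geq 0$. Therefore, the algebra $A^{\mathfrak{g}}$ is purely even, and the natural action of $\mathfrak{sl}(2)$ on $A^{\mathfrak{g}}$ is trivial.
   Context: Fix a nondegenerate invariant symmetric bilinear form on $\mathfrak{g}$, used to identify $\mathfrak{g}$ with $\mathfrak{g}^*$. Let $\{x_i\}$ be an orthonormal basis of $\mathfrak{g}$ and let $f_{ijk}$ be the structure constants, $[x_i,x_j]=\sum_k f_{ijk}x_k$. Let $R=\wedge(\mathfrak{g}\oplus\mathfrak{g})$ be the exterior algebra. It is bigraded by $\mathbb{Z}_{\geq 0}^2$, with the first copy of $\mathfrak{g}$ in degree $(1,0)$ and the second in degree $(0,1)$. For $x\in\mathfrak{g}$ write $x^{(1)}$, $x^{(2)}$ for the corresponding elements of the first and second copy. The components of $R$ of degrees $(2,0)$, $(1,1)$, $(0,2)$ are $\wedge^2\mathfrak{g}$, $\mathfrak{g}\otimes\mathfrak{g}$, $\wedge^2\mathfrak{g}$, and each contains a canonical copy of $\mathfrak{g}$ (the dual of the Lie bracket), spanned respectively by the elements $\sum_{i,j}f_{ijk}x_i^{(1)}x_j^{(1)}$, $\sum_{i,j}f_{ijk}x_i^{(1)}x_j^{(2)}$, $\sum_{i,j}f_{ijk}x_i^{(2)}x_j^{(2)}$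 for $k=1,\dots,\dim\mathfrak{g}$. Let $I$ be the two-sided ideal of $R$ generated by these three copies of $\mathfrak{g}$, and let $A=R/I$. The algebra $A$ inherits the bigrading and an action of $\mathfrak{g}$ by derivations induced by the adjoint action; $A^{\mathfrak{g}}$ denotes the invariants. The parity of an element of bidegree $(d_1,d_2)$ is $d_1+d_2$ mod $2$. The natural action of $\mathfrak{sl}(2)$ on $A$ is the one by linear transformations of the two variables: identify $\mathfrak{g}\oplus\mathfrak{g}=\mathfrak{g}\otimes\mathbb{C}^2$, let $\mathfrak{sl}(2)$ act on the factor $\mathbb{C}^2$ by the standard representation, and extend to $R$ by derivations; this action preserves $I$ and commutes with $\mathfrak{g}$, hence induces actions on $A$ and $A^{\mathfrak{g}}$. *)

theory Defs
  imports
    "HOL-Analysis.Analysis"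
    "HOL-Algebra.QuotRing"
    "HOL-Library.Poly_Mapping"
begin

section \<open>Complex vector spaces and Lie algebras\<close>

class complex_vector = ab_group_add +
  fixes scaleC :: "complex \<Rightarrow> 'a \<Rightarrow> 'a"  (infixr \<open>*\<^sub>C\<close> 75)
  assumes scaleC_add_right: "a *\<^sub>C (x + y) = a *\<^sub>C x + a *\<^sub>C y"
    and scaleC_add_left: "(a + b) *\<^sub>C x = a *\<^sub>C x + b *\<^sub>C x"
    and scaleC_scaleC: "a *\<^sub>C b *\<^sub>C x = (a * b) *\<^sub>C x"
    and scaleC_one: "1 *\<^sub>C x = x"

global_interpretation complex_vector: vector_space "scaleC :: complex \<Rightarrow> 'a \<Rightarrow> 'a::complex_vector"
  by unfold_locales (simp_all add: scaleC_add_right scaleC_add_left scaleC_scaleC scaleC_one)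

abbreviation complex_linear :: "('a::complex_vector \<Rightarrow> 'b::complex_vector) \<Rightarrow> bool"
  where "complex_linear \<equiv> Vector_Spaces.linear scaleC scaleC"

abbreviation complex_functional :: "('a::complex_vector \<Rightarrow> complex) \<Rightarrow> bool"
  where "complex_functional \<equiv> Vector_Spaces.linear scaleC (*)"

lemma complex_linear_iff:
  "complex_linear f \<longleftrightarrow> (\<forall>x y. f (x + y) = f x + f y) \<and> (\<forall>c x. f (c *\<^sub>C x) = c *\<^sub>C f x)"
  by (auto simp: Vector_Spaces.linear_def module_hom_def module_hom_axioms_def
      complex_vector.vector_space_axioms complex_vector.module_axioms)

instantiation prod :: (complex_vector, complex_vector) complex_vector
begin

definition "c *\<^sub>C p = (c *\<^sub>C fst p, c *\<^sub>C snd p)"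

instance
  by standard
    (simp_all add: scaleC_prod_def scaleC_add_right scaleC_add_left scaleC_scaleC scaleC_one)

end

class complex_lie_algebra = complex_vector +
  fixes lie_bracket :: "'a \<Rightarrow> 'a \<Rightarrow> 'a"
  assumes lie_add_left: "lie_bracket (x + y) z = lie_bracket x z + lie_bracket y z"
    and lie_scale_left: "lie_bracket (c *\<^sub>C x) z = c *\<^sub>C lie_bracket x z"
    and lie_add_right: "lie_bracket z (x + y) = lie_bracket z x + lie_bracket z y"
    and lie_scale_right: "lie_bracket z (c *\<^sub>C x) = c *\<^sub>C lie_bracket z x"
    and lie_self: "lie_bracket x x = 0"
    and lie_jacobi: "lie_bracket x (lie_bracket y z) + lie_bracket y (lie_bracket z x)
                       + lie_bracket z (lie_bracket x y) = 0"

definition finite_dimensional :: "'a::complex_vector itself \<Rightarrow> bool"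
  where "finite_dimensional _ \<longleftrightarrow> (\<exists>B::'a set. finite B \<and> complex_vector.span B = UNIV)"

definition lie_ideal :: "'g::complex_lie_algebra set \<Rightarrow> bool"
  where "lie_ideal J \<longleftrightarrow> complex_vector.subspace J \<and> (\<forall>x. \<forall>y\<in>J. lie_bracket x y \<in> J)"

definition simple_lie_algebra :: "'g::complex_lie_algebra itself \<Rightarrow> bool"
  where "simple_lie_algebra _ \<longleftrightarrow>
    (\<exists>x y::'g. lie_bracket x y \<noteq> 0) \<and> (\<forall>J::'g set. lie_ideal J \<longrightarrow> J = {0} \<or> J = UNIV)"

definition invariant_form :: "('g::complex_lie_algebra \<Rightarrow> 'g \<Rightarrow> complex) \<Rightarrow> bool"
  where "invariant_form \<beta> \<longleftrightarrow>
    (\<forall>x. complex_functional (\<beta> x)) \<and> (\<forall>y. complex_functional (\<lambda>x. \<beta> x y)) \<and>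
    (\<forall>x y. \<beta> x y = \<beta> y x) \<and>
    (\<forall>x y z. \<beta> (lie_bracket x y) z = \<beta> x (lie_bracket y z))"

definition nondegenerate_form :: "('g::complex_lie_algebra \<Rightarrow> 'g \<Rightarrow> complex) \<Rightarrow> bool"
  where "nondegenerate_form \<beta> \<longleftrightarrow> (\<forall>x. (\<forall>y. \<beta> x y = 0) \<longrightarrow> x = 0)"

definition orthonormal_basis ::
    "('g::complex_lie_algebra \<Rightarrow> 'g \<Rightarrow> complex) \<Rightarrow> nat \<Rightarrow> (nat \<Rightarrow> 'g) \<Rightarrow> bool"
  where "orthonormal_basis \<beta> n x \<longleftrightarrow>
    inj_on x {..<n} \<and> complex_vector.independent (x ` {..<n}) \<and>
    complex_vector.span (x ` {..<n}) = UNIV \<and>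
    (\<forall>i<n. \<forall>j<n. \<beta> (x i) (x j) = (if i = j then 1 else 0))"

definition structure_constants ::
    "nat \<Rightarrow> (nat \<Rightarrow> 'g::complex_lie_algebra) \<Rightarrow> (nat \<Rightarrow> nat \<Rightarrow> nat \<Rightarrow> complex) \<Rightarrow> bool"
  where "structure_constants n x f \<longleftrightarrow>
    (\<forall>i<n. \<forall>j<n. lie_bracket (x i) (x j) = (\<Sum>k<n. f i j k *\<^sub>C x k))"


section \<open>Rings on a whole type, seen as structures\<close>

text \<open>The type-class ring \<open>'a\<close> as a record, so that two-sided ideals (\<^const>\<open>ideal\<close>,
  \<^const>\<open>genideal\<close>) and quotients (\<^const>\<open>FactRing\<close>) of it are available.\<close>

definition univ_ring :: "'a::ring_1 ring"
  where "univ_ring = \<lparr>carrier = UNIV, mult = (*), one = 1, zero = 0, add = (+)\<rparr>"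

lemma univ_ring_simps [simp]:
  "carrier univ_ring = UNIV" "mult univ_ring = (*)" "one univ_ring = 1"
  "zero univ_ring = 0" "add univ_ring = (+)"
  by (simp_all add: univ_ring_def)

lemma ring_univ_ring: "ring (univ_ring :: 'a::ring_1 ring)"
proof (rule ringI)
  show "abelian_group (univ_ring :: 'a ring)"
  proof (rule abelian_groupI)
    fix x :: 'a
    show "\<exists>y\<in>carrier univ_ring. y \<oplus>\<^bsub>univ_ring\<^esub> x = \<zero>\<^bsub>univ_ring\<^esub>"
      by (rule bexI [of _ "- x"]) auto
  qed (auto simp: algebra_simps)
  show "Group.monoid (univ_ring :: 'a ring)"
    by (rule Group.monoidI) (auto simp: algebra_simps)
qed (auto simp: algebra_simps)

lemma ideal_univ_ring_iff:
  fixes I :: "'a::ring_1 set"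
  shows "ideal I univ_ring \<longleftrightarrow>
    0 \<in> I \<and> (\<forall>a\<in>I. \<forall>b\<in>I. a + b \<in> I) \<and> (\<forall>a\<in>I. \<forall>r. r * a \<in> I \<and> a * r \<in> I)"
    (is "?L \<longleftrightarrow> ?R")
proof
  assume ?L
  then interpret ideal I univ_ring .
  have "\<zero>\<^bsub>univ_ring\<^esub> \<in> I"
    using additive_subgroup.zero_closed [OF is_additive_subgroup] .
  moreover have "a \<oplus>\<^bsub>univ_ring\<^esub> b \<in> I" if "a \<in> I" "b \<in> I" for a b
    using additive_subgroup.a_closed [OF is_additive_subgroup that] .
  ultimately show ?R using I_l_closed I_r_closed by auto
next
  assume R: ?R
  interpret ring "univ_ring :: 'a ring" by (rule ring_univ_ring)
  have inv: "inv\<^bsub>add_monoid univ_ring\<^esub> a = - a" for a :: 'a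
    by (rule group.inv_equality [OF a_group]) auto
  show ?L
  proof (rule idealI)
    show "subgroup I (add_monoid univ_ring)"
    proof
      fix a assume "a \<in> I"
      moreover have "- a = (- 1) * a" by simp
      ultimately show "inv\<^bsub>add_monoid univ_ring\<^esub> a \<in> I" using R inv by metis
    qed (use R in auto)
  qed (use R ring_univ_ring in auto)
qed

section \<open>The exterior algebra of a complex vector space\<close>

datatype 'v free_monoid = Word "'v list"

instantiation free_monoid :: (type) monoid_add
begin

definition "0 = Word []"

fun plus_free_monoid where "Word us + Word vs = Word (us @ vs)"

instance
proof
  fix a b c :: "'a free_monoid"
  show "a + b + c = a + (b + c)" by (cases a; cases b; cases c) simp
  show "0 + a = a" "a + 0 = a" by (cases a; simp add: zero_free_monoid_def)+
qed

end

text \<open>The free associative unital algebra on the set \<open>'v\<close>.\<close>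

type_synonym 'v free_algebra = "'v free_monoid \<Rightarrow>\<^sub>0 complex"

definition free_scalar :: "complex \<Rightarrow> 'v free_algebra"
  where "free_scalar c = Poly_Mapping.single 0 c"

definition free_gen :: "'v \<Rightarrow> 'v free_algebra"
  where "free_gen v = Poly_Mapping.single (Word [v]) 1"

text \<open>The first two families of relations turn the free algebra into the tensor algebra
  \<open>T(V)\<close>; with the third the quotient is \<open>T(V)/(v \<otimes> v)\<close>.\<close>

definition exterior_relations :: "'v::complex_vector free_algebra set"
  where "exterior_relations =
    {free_gen (v + w) - free_gen v - free_gen w | v w. True} \<union>
    {free_gen (c *\<^sub>C v) - free_scalar c * free_gen v | c v. True} \<union>
    {free_gen v * free_gen v | v. True}"

definition exterior_rel :: "'v::complex_vector free_algebra \<Rightarrow> 'v free_algebra \<Rightarrow> bool"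
  where "exterior_rel a b \<longleftrightarrow> a - b \<in> genideal univ_ring exterior_relations"

lemma univ_genideal:
  fixes S :: "'a::ring_1 set"
  shows univ_genideal_zero: "0 \<in> genideal univ_ring S"
    and univ_genideal_add: "a \<in> genideal univ_ring S \<Longrightarrow> b \<in> genideal univ_ring S \<Longrightarrow>
          a + b \<in> genideal univ_ring S"
    and univ_genideal_l: "a \<in> genideal univ_ring S \<Longrightarrow> r * a \<in> genideal univ_ring S"
    and univ_genideal_r: "a \<in> genideal univ_ring S \<Longrightarrow> a * r \<in> genideal univ_ring S"
    and univ_genideal_uminus: "a \<in> genideal univ_ring S \<Longrightarrow> - a \<in> genideal univ_ring S"
    and univ_genideal_diff: "a \<in> genideal univ_ring S \<Longrightarrow> b \<in> genideal univ_ring S \<Longrightarrow>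
          a - b \<in> genideal univ_ring S"
    and univ_genideal_incl: "a \<in> S \<Longrightarrow> a \<in> genideal univ_ring S"
proof -
  interpret ring "univ_ring :: 'a ring" by (rule ring_univ_ring)
  have I: "ideal (genideal univ_ring S) univ_ring"
    by (rule genideal_ideal) simp
  then show "0 \<in> genideal univ_ring S"
    "a \<in> genideal univ_ring S \<Longrightarrow> b \<in> genideal univ_ring S \<Longrightarrow> a + b \<in> genideal univ_ring S"
    "a \<in> genideal univ_ring S \<Longrightarrow> r * a \<in> genideal univ_ring S"
    "a \<in> genideal univ_ring S \<Longrightarrow> a * r \<in> genideal univ_ring S" for a b r
    by (auto simp: ideal_univ_ring_iff)
  then show u: "a \<in> genideal univ_ring S \<Longrightarrow> - a \<in> genideal univ_ring S" for a
    by (metis mult_minus1)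
  then show "a \<in> genideal univ_ring S \<Longrightarrow> b \<in> genideal univ_ring S \<Longrightarrow> a - b \<in> genideal univ_ring S"
    for a b
    using I by (metis diff_conv_add_uminus ideal_univ_ring_iff)
  show "a \<in> S \<Longrightarrow> a \<in> genideal univ_ring S" for a
    using genideal_self [of S] by auto
qed

lemma univ_genideal_minimal:
  assumes "ideal I univ_ring" "S \<subseteq> I" "a \<in> genideal univ_ring S"
  shows "a \<in> I"
  using assms unfolding genideal_def by auto

lemma free_algebra_sum: "a = (\<Sum>w\<in>Poly_Mapping.keys a. Poly_Mapping.single w (Poly_Mapping.lookup a w))"
  by (rule poly_mapping_eqI)
    (auto simp: lookup_sum lookup_single when_def in_keys_iff sum.delta' cong: if_cong)

lemma free_scalar_commute: "free_scalar c * a = a * free_scalar c"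
  by (subst (1 2) free_algebra_sum [of a])
    (simp add: sum_distrib_left sum_distrib_right free_scalar_def mult_single mult.commute)

lemma one_notin_exterior_ideal: "1 \<notin> genideal univ_ring (exterior_relations :: 'v::complex_vector free_algebra set)"
proof
  define Z where "Z = {a :: 'v free_algebra. Poly_Mapping.lookup a 0 = 0}"
  have plus0: "0 = u + w \<longleftrightarrow> u = 0 \<and> w = 0" for u w :: "'v free_monoid"
    by (cases u; cases w) (auto simp: zero_free_monoid_def)
  have mult0: "Poly_Mapping.lookup (a * b) 0 = Poly_Mapping.lookup a 0 * Poly_Mapping.lookup b 0"
    for a b :: "'v free_algebra"
  proof -
    have "(\<Sum>q. Poly_Mapping.lookup b q when 0 = l + q) = (Poly_Mapping.lookup b 0 when l = 0)" for l
      by (cases "l = 0") (simp_all add: plus0)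
    then show ?thesis by (simp add: lookup_mult mult_when)
  qed
  have "ideal Z univ_ring"
    by (auto simp: ideal_univ_ring_iff Z_def mult0 lookup_add)
  moreover have "Poly_Mapping.lookup (free_gen v) 0 = 0" for v :: 'v
    by (simp add: free_gen_def lookup_single zero_free_monoid_def)
  then have "exterior_relations \<subseteq> Z"
    by (auto simp: exterior_relations_def Z_def mult0 lookup_minus)
  moreover assume "1 \<in> genideal univ_ring (exterior_relations :: 'v free_algebra set)"
  ultimately have "(1 :: 'v free_algebra) \<in> Z" by (rule univ_genideal_minimal)
  then show False by (simp add: Z_def)
qed

quotient_type (overloaded) 'v exterior = "('v::complex_vector) free_algebra" / exterior_rel
proof (rule equivpI)
  show "reflp (exterior_rel :: 'v free_algebra \<Rightarrow> _)"
    by (rule reflpI) (simp add: exterior_rel_def univ_genideal_zero)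
  show "symp (exterior_rel :: 'v free_algebra \<Rightarrow> _)"
    by (rule sympI) (metis exterior_rel_def minus_diff_eq univ_genideal_uminus)
  show "transp (exterior_rel :: 'v free_algebra \<Rightarrow> _)"
  proof (rule transpI)
    fix a b c :: "'v free_algebra"
    assume "exterior_rel a b" "exterior_rel b c"
    then have "(a - b) + (b - c) \<in> genideal univ_ring exterior_relations"
      unfolding exterior_rel_def by (rule univ_genideal_add)
    then show "exterior_rel a c" by (simp add: exterior_rel_def)
  qed
qed

instantiation exterior :: (complex_vector) "{ring_1, complex_vector}"
begin

lift_definition zero_exterior :: "'a exterior" is 0 .

lift_definition one_exterior :: "'a exterior" is 1 .

lift_definition plus_exterior :: "'a exterior \<Rightarrow> 'a exterior \<Rightarrow> 'a exterior" is "(+)"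
proof -
  fix a a' b b' :: "'a free_algebra"
  assume "exterior_rel a a'" "exterior_rel b b'"
  then have "(a - a') + (b - b') \<in> genideal univ_ring exterior_relations"
    unfolding exterior_rel_def by (rule univ_genideal_add)
  then show "exterior_rel (a + b) (a' + b')"
    by (simp add: exterior_rel_def algebra_simps)
qed

lift_definition uminus_exterior :: "'a exterior \<Rightarrow> 'a exterior" is uminus
proof -
  fix a a' :: "'a free_algebra"
  assume "exterior_rel a a'"
  then have "- (a - a') \<in> genideal univ_ring exterior_relations"
    unfolding exterior_rel_def by (rule univ_genideal_uminus)
  then show "exterior_rel (- a) (- a')"
    by (simp add: exterior_rel_def algebra_simps)
qed

lift_definition minus_exterior :: "'a exterior \<Rightarrow> 'a exterior \<Rightarrow> 'a exterior" is "(-)"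
proof -
  fix a a' b b' :: "'a free_algebra"
  assume "exterior_rel a a'" "exterior_rel b b'"
  then have "(a - a') - (b - b') \<in> genideal univ_ring exterior_relations"
    unfolding exterior_rel_def by (rule univ_genideal_diff)
  then show "exterior_rel (a - b) (a' - b')"
    by (simp add: exterior_rel_def algebra_simps)
qed

lift_definition times_exterior :: "'a exterior \<Rightarrow> 'a exterior \<Rightarrow> 'a exterior" is "(*)"
proof -
  fix a a' b b' :: "'a free_algebra"
  assume "exterior_rel a a'" "exterior_rel b b'"
  then have "(a - a') * b + a' * (b - b') \<in> genideal univ_ring exterior_relations"
    unfolding exterior_rel_def by (intro univ_genideal_add univ_genideal_l univ_genideal_r)
  then show "exterior_rel (a * b) (a' * b')"
    by (simp add: exterior_rel_def algebra_simps)
qed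

lift_definition scaleC_exterior :: "complex \<Rightarrow> 'a exterior \<Rightarrow> 'a exterior"
  is "\<lambda>c a. free_scalar c * a"
  by (simp add: exterior_rel_def univ_genideal_l flip: right_diff_distrib)

instance
proof
  fix a b c :: "'a exterior" and r s :: complex
  show "a + b + c = a + (b + c)" "a * b * c = a * (b * c)" "a + b = b + a" "0 + a = a"
    "- a + a = 0" "a - b = a + - b" "1 * a = a" "a * 1 = a"
    "(a + b) * c = a * c + b * c" "a * (b + c) = a * b + a * c"
    by (transfer; simp add: exterior_rel_def univ_genideal_zero algebra_simps)+
  show "(0 :: 'a exterior) \<noteq> 1"
    by transfer (metis exterior_rel_def one_notin_exterior_ideal
        cancel_comm_monoid_add_class.diff_zero diff_0 minus_minus univ_genideal_uminus)
  show "r *\<^sub>C (a + b) = r *\<^sub>C a + r *\<^sub>C b"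
    by (transfer; simp add: exterior_rel_def univ_genideal_zero algebra_simps)
  show "(r + s) *\<^sub>C a = r *\<^sub>C a + s *\<^sub>C a"
    by (transfer; simp add: exterior_rel_def univ_genideal_zero algebra_simps
        free_scalar_def single_add)
  show "r *\<^sub>C s *\<^sub>C a = (r * s) *\<^sub>C a"
    by (transfer; simp add: exterior_rel_def univ_genideal_zero
        free_scalar_def mult_single flip: mult.assoc)
  show "1 *\<^sub>C a = a"
    by (transfer; simp add: exterior_rel_def univ_genideal_zero free_scalar_def)
qed

end

lift_definition ext_gen :: "'v::complex_vector \<Rightarrow> 'v exterior" is free_gen .

lemma scaleC_mult_left: "(c *\<^sub>C a) * b = c *\<^sub>C (a * b)" for a b :: "'v::complex_vector exterior"
  by (transfer; simp add: exterior_rel_def univ_genideal_zero mult.assoc)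

lemma scaleC_mult_right: "a * (c *\<^sub>C b) = c *\<^sub>C (a * b)" for a b :: "'v::complex_vector exterior"
  by (transfer; simp add: exterior_rel_def univ_genideal_zero free_scalar_commute mult.assoc)

lemma complex_linear_ext_gen: "complex_linear ext_gen"
  unfolding complex_linear_iff
proof safe
  fix v w :: 'a and c
  have "free_gen (v + w) - free_gen v - free_gen w \<in> genideal univ_ring exterior_relations"
    by (rule univ_genideal_incl) (auto simp: exterior_relations_def)
  then show "ext_gen (v + w) = ext_gen v + ext_gen w"
    by transfer (simp add: exterior_rel_def diff_diff_eq)
  have "free_gen (c *\<^sub>C v) - free_scalar c * free_gen v \<in> genideal univ_ring exterior_relations"
    by (rule univ_genideal_incl) (auto simp: exterior_relations_def)
  then show "ext_gen (c *\<^sub>C v) = c *\<^sub>C ext_gen v"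
    by transfer (simp add: exterior_rel_def)
qed

lemma ext_gen_add: "ext_gen (v + w) = ext_gen v + ext_gen w"
  and ext_gen_scale: "ext_gen (c *\<^sub>C v) = c *\<^sub>C ext_gen v"
  using complex_linear_ext_gen unfolding complex_linear_iff by blast+

lemma ext_gen_square: "ext_gen v * ext_gen v = 0"
proof -
  have "free_gen v * free_gen v \<in> genideal univ_ring exterior_relations"
    by (rule univ_genideal_incl) (auto simp: exterior_relations_def)
  then show ?thesis by transfer (simp add: exterior_rel_def)
qed

lemma exterior_induct [case_names add scale one gen]:
  fixes a :: "'v::complex_vector exterior"
  assumes add: "\<And>a b. P a \<Longrightarrow> P b \<Longrightarrow> P (a + b)" and scale: "\<And>c a. P a \<Longrightarrow> P (c *\<^sub>C a)"
    and one: "P 1" and gen: "\<And>v a. P a \<Longrightarrow> P (ext_gen v * a)"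
  shows "P a"
proof -
  have P0: "P 0" using scale [OF one, of 0] by simp
  have W: "P (abs_exterior (Poly_Mapping.single (Word vs) 1))" for vs
  proof (induction vs)
    case Nil
    then show ?case
      using one by (simp add: one_exterior_def flip: zero_free_monoid_def)
  next
    case (Cons v vs)
    have "abs_exterior (Poly_Mapping.single (Word (v # vs)) 1)
        = ext_gen v * abs_exterior (Poly_Mapping.single (Word vs) 1)"
      by (simp add: ext_gen.abs_eq times_exterior.abs_eq free_gen_def mult_single)
    then show ?case using gen Cons by simp
  qed
  have S: "P (abs_exterior (Poly_Mapping.single w c))" for w c
  proof -
    obtain vs where w: "w = Word vs" by (cases w)
    have "abs_exterior (Poly_Mapping.single w c) = c *\<^sub>C abs_exterior (Poly_Mapping.single w 1)"
      by (simp add: scaleC_exterior.abs_eq free_scalar_def mult_single)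
    then show ?thesis using scale W w by simp
  qed
  have "P (abs_exterior (\<Sum>w\<in>K. Poly_Mapping.single w (g w)))" if "finite K" for K g
    using that by induction (simp_all add: P0 S add flip: zero_exterior_def plus_exterior.abs_eq)
  then have "P (abs_exterior b)" for b
    by (subst free_algebra_sum) simp
  then show ?thesis by (induction a rule: exterior.abs_induct)
qed


section \<open>Derivations\<close>

definition derivation :: "('a::{ring_1, complex_vector} \<Rightarrow> 'a) \<Rightarrow> bool"
  where "derivation D \<longleftrightarrow> complex_linear D \<and> (\<forall>a b. D (a * b) = D a * b + a * D b)"

text \<open>The extension of \<open>\<phi>\<close> by derivations; it exists and is unique for linear \<open>\<phi>\<close>,
  see \<open>ex1_ext_deriv\<close> below. These are plain derivations, without signs: a Lie algebra
  acts by even derivations.\<close>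

definition ext_deriv :: "('v::complex_vector \<Rightarrow> 'v) \<Rightarrow> 'v exterior \<Rightarrow> 'v exterior"
  where "ext_deriv \<phi> = (THE D. derivation D \<and> (\<forall>v. D (ext_gen v) = ext_gen (\<phi> v)))"

lemma derivation_one:
  assumes "derivation D"
  shows "D 1 = 0"
proof -
  have "D (1 * 1) = D 1 * 1 + 1 * D 1"
    using assms unfolding derivation_def by blast
  then show ?thesis by simp
qed

lemma derivation_unique:
  fixes D D' :: "'v::complex_vector exterior \<Rightarrow> 'v exterior"
  assumes "derivation D" "derivation D'" "\<And>v. D (ext_gen v) = D' (ext_gen v)"
  shows "D = D'"
proof
  fix a
  show "D a = D' a"
    using assms
    by (induction a rule: exterior_induct)
      (auto simp: derivation_one, auto simp: derivation_def complex_linear_iff)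
qed

fun word_deriv :: "('v \<Rightarrow> 'v) \<Rightarrow> 'v list \<Rightarrow> 'v free_algebra"
  where
    "word_deriv \<phi> [] = 0"
  | "word_deriv \<phi> (v # vs) = free_gen (\<phi> v) * Poly_Mapping.single (Word vs) 1 + free_gen v * word_deriv \<phi> vs"

definition free_deriv :: "('v \<Rightarrow> 'v) \<Rightarrow> 'v free_algebra \<Rightarrow> 'v free_algebra"
  where "free_deriv \<phi> a =
    (\<Sum>w\<in>Poly_Mapping.keys a. free_scalar (Poly_Mapping.lookup a w) * (case w of Word vs \<Rightarrow> word_deriv \<phi> vs))"

lemma free_scalar_simps:
  "free_scalar 0 = 0" "free_scalar 1 = 1" "free_scalar (c + d) = free_scalar c + free_scalar d"
  "free_scalar (c * d) = free_scalar c * free_scalar d"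
  by (simp_all add: free_scalar_def single_add mult_single)

lemma free_deriv_superset:
  assumes "finite K" "Poly_Mapping.keys a \<subseteq> K"
  shows "free_deriv \<phi> a =
    (\<Sum>w\<in>K. free_scalar (Poly_Mapping.lookup a w) * (case w of Word vs \<Rightarrow> word_deriv \<phi> vs))"
  unfolding free_deriv_def
  by (rule sum.mono_neutral_left) (use assms in \<open>auto simp: in_keys_iff free_scalar_simps\<close>)

lemma free_deriv_add: "free_deriv \<phi> (a + b) = free_deriv \<phi> a + free_deriv \<phi> b"
proof -
  let ?K = "Poly_Mapping.keys a \<union> Poly_Mapping.keys b"
  have "Poly_Mapping.keys (a + b) \<subseteq> ?K" by (rule keys_add)
  then show ?thesis
    by (simp add: free_deriv_superset [of ?K] lookup_add free_scalar_simps distrib_right sum.distrib)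
qed

lemma free_deriv_zero: "free_deriv \<phi> 0 = 0"
  by (simp add: free_deriv_def)

lemma free_deriv_sum: "free_deriv \<phi> (\<Sum>i\<in>K. g i) = (\<Sum>i\<in>K. free_deriv \<phi> (g i))"
  by (induction K rule: infinite_finite_induct) (simp_all add: free_deriv_zero free_deriv_add)

lemma free_deriv_uminus: "free_deriv \<phi> (- a) = - free_deriv \<phi> a"
  using free_deriv_add [of \<phi> "- a" a] by (simp add: free_deriv_zero eq_neg_iff_add_eq_0)

lemma free_deriv_diff: "free_deriv \<phi> (a - b) = free_deriv \<phi> a - free_deriv \<phi> b"
  using free_deriv_add [of \<phi> a "- b"] by (simp add: free_deriv_uminus)

lemma free_deriv_single:
  "free_deriv \<phi> (Poly_Mapping.single (Word vs) c) = free_scalar c * word_deriv \<phi> vs"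
  by (subst free_deriv_superset [of "{Word vs}"]) (auto simp: lookup_single)

lemma word_deriv_append:
  "word_deriv \<phi> (us @ vs) = word_deriv \<phi> us * Poly_Mapping.single (Word vs) 1
     + Poly_Mapping.single (Word us) 1 * word_deriv \<phi> vs"
proof (induction us)
  case Nil
  then show ?case by (simp flip: zero_free_monoid_def)
next
  case (Cons u us)
  have "Poly_Mapping.single (Word (u # us)) 1 = free_gen u * Poly_Mapping.single (Word us) 1"
    by (simp add: free_gen_def mult_single)
  moreover have "Poly_Mapping.single (Word (us @ vs)) 1
      = Poly_Mapping.single (Word us) (1::complex) * Poly_Mapping.single (Word vs) 1"
    by (simp add: mult_single)
  ultimately show ?case using Cons by (simp add: algebra_simps)
qed

lemma free_deriv_mult_single:
  "free_deriv \<phi> (Poly_Mapping.single u c * Poly_Mapping.single w d)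
   = free_deriv \<phi> (Poly_Mapping.single u c) * Poly_Mapping.single w d
     + Poly_Mapping.single u c * free_deriv \<phi> (Poly_Mapping.single w d)"
proof -
  obtain us vs where uw: "u = Word us" "w = Word vs" by (cases u; cases w)
  have s: "Poly_Mapping.single z e = free_scalar e * Poly_Mapping.single z 1"
    for z :: "'a free_monoid" and e :: complex
    by (simp add: free_scalar_def mult_single)
  have "free_deriv \<phi> (Poly_Mapping.single u c * Poly_Mapping.single w d)
      = free_scalar (c * d) * (word_deriv \<phi> us * Poly_Mapping.single w 1 + Poly_Mapping.single u 1 * word_deriv \<phi> vs)"
    by (simp add: uw mult_single free_deriv_single word_deriv_append)
  also have "\<dots> = (free_scalar c * word_deriv \<phi> us) * (free_scalar d * Poly_Mapping.single w 1)
      + (free_scalar c * Poly_Mapping.single u 1) * (free_scalar d * word_deriv \<phi> vs)"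
    by (simp add: free_scalar_simps distrib_left mult.assoc)
      (simp add: free_scalar_commute [of d] mult.assoc)
  also have "\<dots> = free_deriv \<phi> (Poly_Mapping.single u c) * Poly_Mapping.single w d
     + Poly_Mapping.single u c * free_deriv \<phi> (Poly_Mapping.single w d)"
    by (simp only: uw free_deriv_single flip: s)
  finally show ?thesis .
qed

lemma free_deriv_mult: "free_deriv \<phi> (a * b) = free_deriv \<phi> a * b + a * free_deriv \<phi> b"
proof -
  let ?a = "\<lambda>w. Poly_Mapping.single w (Poly_Mapping.lookup a w)"
  let ?b = "\<lambda>w. Poly_Mapping.single w (Poly_Mapping.lookup b w)"
  let ?A = "Poly_Mapping.keys a" and ?B = "Poly_Mapping.keys b"
  have "free_deriv \<phi> ((\<Sum>u\<in>?A. ?a u) * (\<Sum>w\<in>?B. ?b w))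
      = free_deriv \<phi> (\<Sum>u\<in>?A. ?a u) * (\<Sum>w\<in>?B. ?b w)
        + (\<Sum>u\<in>?A. ?a u) * free_deriv \<phi> (\<Sum>w\<in>?B. ?b w)"
    by (simp only: sum_product free_deriv_sum free_deriv_mult_single sum.distrib)
  then show ?thesis by (simp flip: free_algebra_sum)
qed

lemma free_deriv_gen: "free_deriv \<phi> (free_gen v) = free_gen (\<phi> v)"
  unfolding free_gen_def
  by (subst free_deriv_single) (simp add: free_scalar_simps free_gen_def mult_single)

lemma free_deriv_scalar: "free_deriv \<phi> (free_scalar c) = 0"
  unfolding free_scalar_def zero_free_monoid_def by (simp add: free_deriv_single)

lemma exterior_gen_add:
  "free_gen (v + w) - free_gen v - free_gen w \<in> genideal univ_ring exterior_relations"
  and exterior_gen_scale: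
  "free_gen (c *\<^sub>C v) - free_scalar c * free_gen v \<in> genideal univ_ring exterior_relations"
  and exterior_gen_square:
  "free_gen v * free_gen v \<in> genideal univ_ring exterior_relations"
  by (rule univ_genideal_incl; auto simp: exterior_relations_def)+

lemma free_deriv_exterior_ideal:
  assumes \<phi>: "complex_linear \<phi>" and a: "a \<in> genideal univ_ring exterior_relations"
  shows "free_deriv \<phi> a \<in> genideal univ_ring exterior_relations"
proof -
  let ?I = "genideal univ_ring (exterior_relations :: 'a free_algebra set)"
  define Z where "Z = {a \<in> ?I. free_deriv \<phi> a \<in> ?I}"
  have "ideal Z univ_ring"
    by (auto simp: ideal_univ_ring_iff Z_def free_deriv_zero free_deriv_add free_deriv_mult
        intro!: univ_genideal_zero univ_genideal_add intro: univ_genideal_l univ_genideal_r)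
  moreover have "exterior_relations \<subseteq> Z"
  proof
    fix r assume r: "r \<in> (exterior_relations :: 'a free_algebra set)"
    have "free_deriv \<phi> r \<in> ?I"
      using r [unfolded exterior_relations_def]
    proof (elim UnE CollectE exE conjE)
      fix v w assume "r = free_gen (v + w) - free_gen v - free_gen w"
      then show "free_deriv \<phi> r \<in> ?I"
        using \<phi> exterior_gen_add
        by (simp add: free_deriv_diff free_deriv_gen complex_linear_iff)
    next
      fix c v assume "r = free_gen (c *\<^sub>C v) - free_scalar c * free_gen v"
      then show "free_deriv \<phi> r \<in> ?I"
        using \<phi> exterior_gen_scale
        by (simp add: free_deriv_diff free_deriv_mult free_deriv_scalar free_deriv_gen complex_linear_iff)
    next
      fix v assume r: "r = free_gen v * free_gen v"
      let ?d = "free_gen (\<phi> v + v) - free_gen (\<phi> v) - free_gen v"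
      let ?g = "free_gen (\<phi> v) + free_gen v"
      have eq: "free_deriv \<phi> r = free_gen (\<phi> v + v) * free_gen (\<phi> v + v)
          - (?d * free_gen (\<phi> v + v) + ?g * ?d)
          - free_gen (\<phi> v) * free_gen (\<phi> v) - free_gen v * free_gen v"
        by (simp add: r free_deriv_mult free_deriv_gen algebra_simps)
      show "free_deriv \<phi> r \<in> ?I"
        unfolding eq
        by (intro univ_genideal_diff univ_genideal_add exterior_gen_square
            univ_genideal_l [OF exterior_gen_add] univ_genideal_r [OF exterior_gen_add])
    qed
    then show "r \<in> Z" using r by (simp add: Z_def univ_genideal_incl)
  qed
  ultimately have "a \<in> Z" using a by (rule univ_genideal_minimal)
  then show ?thesis by (simp add: Z_def)
qed

lemma ex1_ext_deriv:
  fixes \<phi> :: "'v::complex_vector \<Rightarrow> 'v"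
  assumes \<phi>: "complex_linear \<phi>"
  shows "\<exists>!D. derivation D \<and> (\<forall>v. D (ext_gen v) = ext_gen (\<phi> v))"
proof -
  define D where "D a = abs_exterior (free_deriv \<phi> (rep_exterior a))" for a :: "'v exterior"
  have abs_eq: "abs_exterior a = abs_exterior b \<longleftrightarrow> a - b \<in> genideal univ_ring exterior_relations"
    for a b :: "'v free_algebra"
    by (simp add: exterior.abs_eq_iff exterior_rel_def)
  have D: "D (abs_exterior a) = abs_exterior (free_deriv \<phi> a)" for a
  proof -
    have "rep_exterior (abs_exterior a) - a \<in> genideal univ_ring exterior_relations"
      by (metis Quotient3_abs_rep [OF Quotient3_exterior] abs_eq)
    from free_deriv_exterior_ideal [OF \<phi> this] show ?thesis
      by (simp add: D_def abs_eq free_deriv_diff)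
  qed
  have "D (a + b) = D a + D b" for a b
    by (induction a rule: exterior.abs_induct, induction b rule: exterior.abs_induct)
      (simp add: D plus_exterior.abs_eq free_deriv_add)
  moreover have "D (c *\<^sub>C a) = c *\<^sub>C D a" for c a
    by (induction a rule: exterior.abs_induct)
      (simp add: D scaleC_exterior.abs_eq free_deriv_mult free_deriv_scalar)
  moreover have "D (a * b) = D a * b + a * D b" for a b
    by (induction a rule: exterior.abs_induct, induction b rule: exterior.abs_induct)
      (simp add: D plus_exterior.abs_eq times_exterior.abs_eq free_deriv_mult)
  moreover have "D (ext_gen v) = ext_gen (\<phi> v)" for v
    by (simp add: D ext_gen.abs_eq free_deriv_gen)
  ultimately have "derivation D \<and> (\<forall>v. D (ext_gen v) = ext_gen (\<phi> v))"
    by (simp add: derivation_def complex_linear_iff)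
  moreover have "D' = D'' " if "derivation D' \<and> (\<forall>v. D' (ext_gen v) = ext_gen (\<phi> v))"
    "derivation D'' \<and> (\<forall>v. D'' (ext_gen v) = ext_gen (\<phi> v))" for D' D''
    by (rule derivation_unique) (use that in auto)
  ultimately show ?thesis by blast
qed

lemma
  assumes "complex_linear \<phi>"
  shows derivation_ext_deriv: "derivation (ext_deriv \<phi>)"
    and ext_deriv_gen: "ext_deriv \<phi> (ext_gen v) = ext_gen (\<phi> v)"
  using theI' [OF ex1_ext_deriv [OF assms]] by (auto simp: ext_deriv_def)

section \<open>The bigraded algebra \<open>A = R / I\<close>\<close>

text \<open>\<open>R\<close> is the exterior algebra of \<open>\<gg> \<oplus> \<gg>\<close>, the latter being the product type.\<close>

abbreviation copy1 :: "'g::complex_vector \<Rightarrow> ('g \<times> 'g) exterior"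
  where "copy1 u \<equiv> ext_gen (u, 0)"

abbreviation copy2 :: "'g::complex_vector \<Rightarrow> ('g \<times> 'g) exterior"
  where "copy2 u \<equiv> ext_gen (0, u)"

text \<open>\<open>R\<^bsub>p,q\<^esub>\<close> as \<open>\<Lambda>\<^sup>p \<gg> \<otimes> \<Lambda>\<^sup>q \<gg>\<close>: generators anticommute, so factors from
  the first copy may be moved to the front.\<close>

definition R_component :: "nat \<Rightarrow> nat \<Rightarrow> ('g::complex_vector \<times> 'g) exterior set"
  where "R_component p q = complex_vector.span
    {prod_list (map copy1 us) * prod_list (map copy2 vs) | us vs. length us = p \<and> length vs = q}"

text \<open>The three copies of \<open>\<gg>\<close> in bidegrees \<open>(2,0)\<close>, \<open>(1,1)\<close>, \<open>(0,2)\<close>; \<open>n\<close> is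
  \<open>dim \<gg>\<close>, \<open>x\<close> an orthonormal basis indexed by \<open>{..<n}\<close> and \<open>f\<close> its structure constants.\<close>

definition A_relations ::
    "nat \<Rightarrow> (nat \<Rightarrow> 'g::complex_vector) \<Rightarrow> (nat \<Rightarrow> nat \<Rightarrow> nat \<Rightarrow> complex) \<Rightarrow> ('g \<times> 'g) exterior set"
  where "A_relations n x f =
    {\<Sum>i<n. \<Sum>j<n. f i j k *\<^sub>C (copy1 (x i) * copy1 (x j)) | k. k < n} \<union>
    {\<Sum>i<n. \<Sum>j<n. f i j k *\<^sub>C (copy1 (x i) * copy2 (x j)) | k. k < n} \<union>
    {\<Sum>i<n. \<Sum>j<n. f i j k *\<^sub>C (copy2 (x i) * copy2 (x j)) | k. k < n}"

definition A_ideal ::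
    "nat \<Rightarrow> (nat \<Rightarrow> 'g::complex_vector) \<Rightarrow> (nat \<Rightarrow> nat \<Rightarrow> nat \<Rightarrow> complex) \<Rightarrow> ('g \<times> 'g) exterior set"
  where "A_ideal n x f = genideal univ_ring (A_relations n x f)"

definition A_algebra ::
    "nat \<Rightarrow> (nat \<Rightarrow> 'g::complex_vector) \<Rightarrow> (nat \<Rightarrow> nat \<Rightarrow> nat \<Rightarrow> complex) \<Rightarrow> ('g \<times> 'g) exterior set ring"
  where "A_algebra n x f = univ_ring Quot A_ideal n x f"

definition A_proj ::
    "nat \<Rightarrow> (nat \<Rightarrow> 'g::complex_vector) \<Rightarrow> (nat \<Rightarrow> nat \<Rightarrow> nat \<Rightarrow> complex) \<Rightarrow>
      ('g \<times> 'g) exterior \<Rightarrow> ('g \<times> 'g) exterior set"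
  where "A_proj n x f r = A_ideal n x f +>\<^bsub>univ_ring\<^esub> r"

definition A_component ::
    "nat \<Rightarrow> (nat \<Rightarrow> 'g::complex_vector) \<Rightarrow> (nat \<Rightarrow> nat \<Rightarrow> nat \<Rightarrow> complex) \<Rightarrow> nat \<Rightarrow> nat \<Rightarrow>
      ('g \<times> 'g) exterior set set"
  where "A_component n x f p q = A_proj n x f ` R_component p q"

definition A_even ::
    "nat \<Rightarrow> (nat \<Rightarrow> 'g::complex_vector) \<Rightarrow> (nat \<Rightarrow> nat \<Rightarrow> nat \<Rightarrow> complex) \<Rightarrow>
      ('g \<times> 'g) exterior set set"
  where "A_even n x f =
    A_proj n x f ` complex_vector.span (\<Union>{R_component p q | p q. even (p + q)})"

text \<open>The map of \<open>A\<close> induced by a map \<open>D\<close> of \<open>R\<close>. The union is over all representatives of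
  the class \<open>a\<close>; if \<open>D\<close> is additive and preserves the ideal, all its members coincide, see
  \<open>A_induced_proj\<close> below.\<close>

definition A_induced ::
    "nat \<Rightarrow> (nat \<Rightarrow> 'g::complex_vector) \<Rightarrow> (nat \<Rightarrow> nat \<Rightarrow> nat \<Rightarrow> complex) \<Rightarrow>
      (('g \<times> 'g) exterior \<Rightarrow> ('g \<times> 'g) exterior) \<Rightarrow>
      ('g \<times> 'g) exterior set \<Rightarrow> ('g \<times> 'g) exterior set"
  where "A_induced n x f D a = (\<Union>r\<in>a. A_proj n x f (D r))"

definition ad2 :: "'g::complex_lie_algebra \<Rightarrow> 'g \<times> 'g \<Rightarrow> 'g \<times> 'g"
  where "ad2 y w = (lie_bracket y (fst w), lie_bracket y (snd w))"

text \<open>With \<open>(u, v)\<close> standing for \<open>u \<otimes> e\<^sub>1 + v \<otimes> e\<^sub>2\<close>, this is \<open>id \<otimes> M\<close>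
  on \<open>\<gg> \<otimes> \<complex>\<^sup>2\<close>.\<close>

definition mat2_action :: "complex^2^2 \<Rightarrow> 'g::complex_vector \<times> 'g \<Rightarrow> 'g \<times> 'g"
  where "mat2_action M w =
    (M $ 1 $ 1 *\<^sub>C fst w + M $ 1 $ 2 *\<^sub>C snd w, M $ 2 $ 1 *\<^sub>C fst w + M $ 2 $ 2 *\<^sub>C snd w)"

definition A_lie_action ::
    "nat \<Rightarrow> (nat \<Rightarrow> 'g::complex_lie_algebra) \<Rightarrow> (nat \<Rightarrow> nat \<Rightarrow> nat \<Rightarrow> complex) \<Rightarrow> 'g \<Rightarrow>
      ('g \<times> 'g) exterior set \<Rightarrow> ('g \<times> 'g) exterior set"
  where "A_lie_action n x f y = A_induced n x f (ext_deriv (ad2 y))"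

definition A_sl2_action ::
    "nat \<Rightarrow> (nat \<Rightarrow> 'g::complex_vector) \<Rightarrow> (nat \<Rightarrow> nat \<Rightarrow> nat \<Rightarrow> complex) \<Rightarrow> complex^2^2 \<Rightarrow>
      ('g \<times> 'g) exterior set \<Rightarrow> ('g \<times> 'g) exterior set"
  where "A_sl2_action n x f M = A_induced n x f (ext_deriv (mat2_action M))"

definition sl2 :: "(complex^2^2) set"
  where "sl2 = {M. trace M = 0}"

definition A_invariants ::
    "nat \<Rightarrow> (nat \<Rightarrow> 'g::complex_lie_algebra) \<Rightarrow> (nat \<Rightarrow> nat \<Rightarrow> nat \<Rightarrow> complex) \<Rightarrow>
      ('g \<times> 'g) exterior set set"
  where "A_invariants n x f =
    {a \<in> carrier (A_algebra n x f). \<forall>y. A_lie_action n x f y a = \<zero>\<^bsub>A_algebra n x f\<^esub>}"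


section \<open>The actions on \<open>A\<close> are well defined\<close>

lemma lie_anticommute: "lie_bracket u v = - lie_bracket v u"
proof -
  have "lie_bracket u v + lie_bracket v u = lie_bracket (u + v) (u + v)"
    by (simp only: lie_add_left lie_add_right lie_self [of u] lie_self [of v] add_0_left add_0_right add.commute)
  then show ?thesis by (simp add: lie_self eq_neg_iff_add_eq_0)
qed

lemma lie_minus_right: "lie_bracket u (- v) = - lie_bracket u v"
  using lie_scale_right [of u "- 1" v] by simp

lemma lie_derivation: "lie_bracket y (lie_bracket u v) = lie_bracket (lie_bracket y u) v + lie_bracket u (lie_bracket y v)"
proof -
  have "lie_bracket u (lie_bracket v y) = - lie_bracket u (lie_bracket y v)"
    by (metis lie_anticommute lie_minus_right)
  moreover have "lie_bracket v (lie_bracket y u) = - lie_bracket (lie_bracket y u) v"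
    by (rule lie_anticommute)
  ultimately show ?thesis
    using lie_jacobi [of y u v] by (simp add: algebra_simps)
qed

lemma complex_linear_ad2: "complex_linear (ad2 y)"
  by (simp add: complex_linear_iff ad2_def lie_add_right lie_scale_right scaleC_prod_def)

lemma complex_linear_mat2_action: "complex_linear (mat2_action M)"
  by (simp add: complex_linear_iff mat2_action_def scaleC_prod_def scaleC_add_right
      scaleC_scaleC mult.commute algebra_simps)

lemma A_proj_eq_iff: "A_proj n x f r = A_proj n x f s \<longleftrightarrow> r - s \<in> A_ideal n x f"
proof -
  have mem: "t \<in> A_proj n x f r \<longleftrightarrow> t - r \<in> A_ideal n x f" for t r
    unfolding A_proj_def a_r_coset_def r_coset_def
    by (auto intro!: bexI [of _ "t - r"])
  show ?thesis
  proof
    assume "A_proj n x f r = A_proj n x f s"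
    then show "r - s \<in> A_ideal n x f"
      by (metis mem A_ideal_def diff_self univ_genideal_zero)
  next
    assume rs: "r - s \<in> A_ideal n x f"
    show "A_proj n x f r = A_proj n x f s"
    proof (rule Set.set_eqI)
      fix t
      have "t - s \<in> A_ideal n x f" if "t - r \<in> A_ideal n x f"
        using univ_genideal_add [of "t - r" _ "r - s"] that rs by (simp add: A_ideal_def)
      moreover have "t - r \<in> A_ideal n x f" if "t - s \<in> A_ideal n x f"
        using univ_genideal_diff [of "t - s" _ "r - s"] that rs by (simp add: A_ideal_def)
      ultimately show "t \<in> A_proj n x f r \<longleftrightarrow> t \<in> A_proj n x f s"
        unfolding mem by blast
    qed
  qed
qed

lemma A_induced_proj:
  assumes D: "derivation D" "\<And>r. r \<in> A_ideal n x f \<Longrightarrow> D r \<in> A_ideal n x f"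
  shows "A_induced n x f D (A_proj n x f r) = A_proj n x f (D r)"
proof -
  interpret D: module_hom scaleC scaleC D
    using D by (simp add: derivation_def Vector_Spaces.linear_def)
  have "A_proj n x f (D s) = A_proj n x f (D r)" if "s \<in> A_proj n x f r" for s
  proof -
    have "s - r \<in> A_ideal n x f"
      using that unfolding A_proj_def a_r_coset_def r_coset_def by auto
    then show ?thesis
      using D(2) by (simp add: A_proj_eq_iff D.diff [symmetric])
  qed
  moreover have "r \<in> A_proj n x f r"
    unfolding A_proj_def a_r_coset_def r_coset_def
    by (auto intro!: bexI [of _ 0] simp: A_ideal_def univ_genideal_zero)
  ultimately show ?thesis unfolding A_induced_def by blast
qed

lemma derivation_genideal:
  assumes D: "derivation D" and S: "\<And>s. s \<in> S \<Longrightarrow> D s \<in> genideal univ_ring S"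
    and a: "a \<in> genideal univ_ring S"
  shows "D a \<in> genideal univ_ring S"
proof -
  interpret D: module_hom scaleC scaleC D
    using D by (simp add: derivation_def Vector_Spaces.linear_def)
  define Z where "Z = {a \<in> genideal univ_ring S. D a \<in> genideal univ_ring S}"
  have "ideal Z univ_ring"
    using D
    by (auto simp: ideal_univ_ring_iff Z_def D.zero D.add derivation_def
        intro!: univ_genideal_zero univ_genideal_add intro: univ_genideal_l univ_genideal_r)
  moreover have "S \<subseteq> Z"
    using S by (auto simp: Z_def univ_genideal_incl)
  ultimately have "a \<in> Z" using a by (rule univ_genideal_minimal)
  then show ?thesis by (simp add: Z_def)
qed

lemma univ_genideal_sum:
  "(\<And>i. i \<in> K \<Longrightarrow> g i \<in> genideal univ_ring S) \<Longrightarrow> (\<Sum>i\<in>K. g i) \<in> genideal univ_ring S"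
  by (induction K rule: infinite_finite_induct) (auto intro: univ_genideal_add univ_genideal_zero)

lemma univ_genideal_scaleC:
  fixes a :: "'v::complex_vector exterior"
  shows "a \<in> genideal univ_ring S \<Longrightarrow> c *\<^sub>C a \<in> genideal univ_ring S"
  using univ_genideal_l [of a S "c *\<^sub>C 1"] by (simp add: scaleC_mult_left)

lemma orthonormal_expand:
  assumes \<beta>: "invariant_form \<beta>" and x: "orthonormal_basis \<beta> n x"
  shows "z = (\<Sum>i<n. \<beta> z (x i) *\<^sub>C x i)"
proof -
  have add: "\<beta> (u + v) w = \<beta> u w + \<beta> v w" and scale: "\<beta> (c *\<^sub>C u) w = c * \<beta> u w"
    and zero: "\<beta> 0 w = 0" for u v w c
  proof -
    interpret B: module_hom scaleC "(*)" "\<lambda>u. \<beta> u w"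
      using \<beta> by (simp add: invariant_form_def Vector_Spaces.linear_def)
    show "\<beta> (u + v) w = \<beta> u w + \<beta> v w" "\<beta> (c *\<^sub>C u) w = c * \<beta> u w" "\<beta> 0 w = 0"
      by (rule B.add B.scale B.zero)+
  qed
  have "z \<in> complex_vector.span (x ` {..<n})"
    using x by (simp add: orthonormal_basis_def)
  then show ?thesis
  proof (induction rule: complex_vector.span_induct_alt)
    case base
    then show ?case by (simp add: zero)
  next
    case (step c b y)
    then obtain j where j: "j < n" "b = x j" by auto
    have "(\<Sum>i<n. \<beta> (x j) (x i) *\<^sub>C x i) = (\<Sum>i<n. if i = j then x j else 0)"
      by (rule sum.cong) (use x j in \<open>auto simp: orthonormal_basis_def\<close>)
    then have "(\<Sum>i<n. \<beta> (x j) (x i) *\<^sub>C x i) = x j"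
      using j by simp
    then have "(\<Sum>i<n. (c * \<beta> (x j) (x i)) *\<^sub>C x i) = c *\<^sub>C x j"
      by (metis (no_types, lifting) complex_vector.scale_sum_right scaleC_scaleC sum.cong)
    then show ?case
      using step(2) j by (simp add: add scale scaleC_add_left sum.distrib)
  qed
qed

lemma structure_constants_eq:
  assumes \<beta>: "invariant_form \<beta>" and x: "orthonormal_basis \<beta> n x" and f: "structure_constants n x f"
    and ijk: "i < n" "j < n" "k < n"
  shows "f i j k = \<beta> (lie_bracket (x i) (x j)) (x k)"
proof -
  interpret B: module_hom scaleC "(*)" "\<lambda>u. \<beta> u (x k)"
    using \<beta> by (simp add: invariant_form_def Vector_Spaces.linear_def)
  have "\<beta> (lie_bracket (x i) (x j)) (x k) = (\<Sum>l<n. f i j l * \<beta> (x l) (x k))"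
    using f ijk by (simp add: structure_constants_def B.sum B.scale)
  also have "\<dots> = (\<Sum>l<n. if l = k then f i j k else 0)"
    by (rule sum.cong) (use x ijk in \<open>auto simp: orthonormal_basis_def\<close>)
  finally show ?thesis using ijk by simp
qed

text \<open>Equivariance of the dual of the bracket; \<open>P\<close> and \<open>Q\<close>
  are arbitrary linear maps into an algebra.\<close>

lemma cobracket_equivariant:
  fixes P Q :: "'g::complex_lie_algebra \<Rightarrow> 'v::complex_vector exterior"
  assumes \<beta>: "invariant_form \<beta>" and x: "orthonormal_basis \<beta> n x" and f: "structure_constants n x f"
    and P: "complex_linear P" and Q: "complex_linear Q" and k: "k < n"
  shows "(\<Sum>i<n. \<Sum>j<n. f i j k *\<^sub>C (P (lie_bracket y (x i)) * Q (x j) + P (x i) * Q (lie_bracket y (x j))))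
    = (\<Sum>l<n. \<beta> (lie_bracket y (x k)) (x l) *\<^sub>C (\<Sum>i<n. \<Sum>j<n. f i j l *\<^sub>C (P (x i) * Q (x j))))"
proof -
  interpret P: module_hom scaleC scaleC P
    using P by (simp add: Vector_Spaces.linear_def)
  interpret Q: module_hom scaleC scaleC Q
    using Q by (simp add: Vector_Spaces.linear_def)
  have sym: "\<beta> u v = \<beta> v u" and inv: "\<beta> (lie_bracket u v) w = \<beta> u (lie_bracket v w)" for u v w
    using \<beta> unfolding invariant_form_def by blast+
  have rot: "\<beta> (lie_bracket u v) w = \<beta> (lie_bracket v w) u" for u v w
    by (simp only: inv sym [of u])
  have coef: "f i j l = \<beta> (lie_bracket (x j) (x l)) (x i)" if "i < n" "j < n" "l < n" for i j l
    unfolding structure_constants_eq [OF \<beta> x f that] by (rule rot)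
  have collapse: "(\<Sum>i<n. \<Sum>j<n. f i j l *\<^sub>C (T (x i) * Z j)) = (\<Sum>j<n. T (lie_bracket (x j) (x l)) * Z j)"
    if T: "complex_linear T" and l: "l < n"
    for T :: "'g \<Rightarrow> 'v exterior" and Z l
  proof -
    interpret T: module_hom scaleC scaleC T
      using T by (simp add: Vector_Spaces.linear_def)
    have "(\<Sum>i<n. \<Sum>j<n. f i j l *\<^sub>C (T (x i) * Z j))
        = (\<Sum>j<n. \<Sum>i<n. \<beta> (lie_bracket (x j) (x l)) (x i) *\<^sub>C (T (x i) * Z j))"
      by (subst sum.swap, intro sum.cong refl)
        (simp add: coef [OF _ _ l])
    also have "\<dots> = (\<Sum>j<n. T (\<Sum>i<n. \<beta> (lie_bracket (x j) (x l)) (x i) *\<^sub>C x i) * Z j)"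
      by (simp add: T.sum T.scale sum_distrib_right scaleC_mult_left)
    also have "\<dots> = (\<Sum>j<n. T (lie_bracket (x j) (x l)) * Z j)"
      by (simp flip: orthonormal_expand [OF \<beta> x])
    finally show ?thesis .
  qed
  have lin1: "complex_linear (\<lambda>u. P (lie_bracket y u))"
    by (simp add: complex_linear_iff lie_add_right lie_scale_right P.add P.scale)
  have jac: "lie_bracket y (lie_bracket (x m) (x k)) + lie_bracket (lie_bracket (x m) y) (x k)
      = lie_bracket (x m) (lie_bracket y (x k))" for m
    using lie_derivation [of "x m" y "x k"] by (simp add: add.commute)
  have "(\<Sum>j<n. P (lie_bracket (x j) (x k)) * Q (lie_bracket y (x j)))
      = (\<Sum>j<n. \<Sum>m<n. \<beta> (lie_bracket y (x j)) (x m) *\<^sub>C (P (lie_bracket (x j) (x k)) * Q (x m)))"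
    by (subst orthonormal_expand [OF \<beta> x, of "lie_bracket y _"])
      (simp add: Q.sum Q.scale sum_distrib_left scaleC_mult_right)
  also have "\<dots> = (\<Sum>m<n. \<Sum>j<n. \<beta> (lie_bracket (x m) y) (x j) *\<^sub>C (P (lie_bracket (x j) (x k)) * Q (x m)))"
    by (subst sum.swap, intro sum.cong refl) (simp only: rot [of "x _" y])
  also have "\<dots> = (\<Sum>m<n. P (lie_bracket (\<Sum>j<n. \<beta> (lie_bracket (x m) y) (x j) *\<^sub>C x j) (x k)) * Q (x m))"
  proof (intro sum.cong refl)
    fix m
    interpret L: module_hom scaleC scaleC "\<lambda>u. P (lie_bracket u (x k))"
      by unfold_locales (simp_all add: lie_add_left lie_scale_left P.add P.scale)
    show "(\<Sum>j<n. \<beta> (lie_bracket (x m) y) (x j) *\<^sub>C (P (lie_bracket (x j) (x k)) * Q (x m)))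
        = P (lie_bracket (\<Sum>j<n. \<beta> (lie_bracket (x m) y) (x j) *\<^sub>C x j) (x k)) * Q (x m)"
      by (simp only: L.sum L.scale sum_distrib_right scaleC_mult_left)
  qed
  also have "\<dots> = (\<Sum>m<n. P (lie_bracket (lie_bracket (x m) y) (x k)) * Q (x m))"
    by (simp flip: orthonormal_expand [OF \<beta> x])
  finally have second: "(\<Sum>i<n. \<Sum>j<n. f i j k *\<^sub>C (P (x i) * Q (lie_bracket y (x j))))
      = (\<Sum>m<n. P (lie_bracket (lie_bracket (x m) y) (x k)) * Q (x m))"
    by (simp only: collapse [OF P k])
  have "(\<Sum>i<n. \<Sum>j<n. f i j k *\<^sub>C (P (lie_bracket y (x i)) * Q (x j) + P (x i) * Q (lie_bracket y (x j))))
     = (\<Sum>m<n. P (lie_bracket (x m) (lie_bracket y (x k))) * Q (x m))"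
    by (simp add: scaleC_add_right sum.distrib collapse [OF lin1 k] second)
      (simp flip: sum.distrib distrib_right P.add add: jac)
  also have "\<dots> = (\<Sum>m<n. \<Sum>l<n. \<beta> (lie_bracket y (x k)) (x l) *\<^sub>C (P (lie_bracket (x m) (x l)) * Q (x m)))"
  proof (intro sum.cong refl)
    fix m
    interpret L: module_hom scaleC scaleC "\<lambda>u. P (lie_bracket (x m) u)"
      by unfold_locales (simp_all add: lie_add_right lie_scale_right P.add P.scale)
    show "P (lie_bracket (x m) (lie_bracket y (x k))) * Q (x m)
        = (\<Sum>l<n. \<beta> (lie_bracket y (x k)) (x l) *\<^sub>C (P (lie_bracket (x m) (x l)) * Q (x m)))"
      by (subst orthonormal_expand [OF \<beta> x, of "lie_bracket y (x k)"])
        (simp only: L.sum L.scale sum_distrib_right scaleC_mult_left)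
  qed
  also have "\<dots> = (\<Sum>l<n. \<beta> (lie_bracket y (x k)) (x l) *\<^sub>C (\<Sum>m<n. P (lie_bracket (x m) (x l)) * Q (x m)))"
    by (subst sum.swap) (simp add: complex_vector.scale_sum_right)
  also have "\<dots> = (\<Sum>l<n. \<beta> (lie_bracket y (x k)) (x l) *\<^sub>C (\<Sum>i<n. \<Sum>j<n. f i j l *\<^sub>C (P (x i) * Q (x j))))"
    by (intro sum.cong refl) (simp add: collapse [OF P])
  finally show ?thesis .
qed

lemma complex_linear_copies:
  "complex_linear (copy1 :: 'g::complex_vector \<Rightarrow> _)" "complex_linear (copy2 :: 'g::complex_vector \<Rightarrow> _)"
  by (simp_all add: complex_linear_iff scaleC_prod_def flip: ext_gen_add ext_gen_scale)

lemma A_ideal_lie_action: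
  assumes \<beta>: "invariant_form \<beta>" and x: "orthonormal_basis \<beta> n x" and f: "structure_constants n x f"
    and r: "r \<in> A_ideal n x f"
  shows "ext_deriv (ad2 y) r \<in> A_ideal n x f"
  unfolding A_ideal_def
proof (rule derivation_genideal [OF derivation_ext_deriv [OF complex_linear_ad2] _ r [unfolded A_ideal_def]])
  let ?D = "ext_deriv (ad2 y)"
  have der: "derivation ?D" by (rule derivation_ext_deriv [OF complex_linear_ad2])
  interpret D: module_hom scaleC scaleC ?D
    using der by (simp add: derivation_def Vector_Spaces.linear_def)
  have mult: "?D (a * b) = ?D a * b + a * ?D b" for a b
    using der by (simp add: derivation_def)
  have gen: "?D (copy1 u) = copy1 (lie_bracket y u)" "?D (copy2 u) = copy2 (lie_bracket y u)" for u
    using lie_scale_right [of y 0]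
    by (simp_all add: ext_deriv_gen [OF complex_linear_ad2] ad2_def)
  have main: "?D (\<Sum>i<n. \<Sum>j<n. f i j k *\<^sub>C (P (x i) * Q (x j))) \<in> genideal univ_ring (A_relations n x f)"
    if PQ: "complex_linear P" "complex_linear Q"
      "\<And>u. ?D (P u) = P (lie_bracket y u)" "\<And>u. ?D (Q u) = Q (lie_bracket y u)" "k < n"
      "\<And>l. l < n \<Longrightarrow> (\<Sum>i<n. \<Sum>j<n. f i j l *\<^sub>C (P (x i) * Q (x j))) \<in> A_relations n x f"
    for P Q k
    unfolding D.sum D.scale mult PQ(3,4) cobracket_equivariant [OF \<beta> x f PQ(1,2,5)]
    by (intro univ_genideal_sum univ_genideal_scaleC univ_genideal_incl PQ(6)) simp
  fix s assume s: "s \<in> A_relations n x f"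
  then consider
      k where "k < n" "s = (\<Sum>i<n. \<Sum>j<n. f i j k *\<^sub>C (copy1 (x i) * copy1 (x j)))"
    | k where "k < n" "s = (\<Sum>i<n. \<Sum>j<n. f i j k *\<^sub>C (copy1 (x i) * copy2 (x j)))"
    | k where "k < n" "s = (\<Sum>i<n. \<Sum>j<n. f i j k *\<^sub>C (copy2 (x i) * copy2 (x j)))"
    unfolding A_relations_def by blast
  then show "?D s \<in> genideal univ_ring (A_relations n x f)"
  proof cases
    case 1
    then show ?thesis
      using main [of copy1 copy1] complex_linear_copies gen by (auto simp: A_relations_def)
  next
    case 2
    then show ?thesis
      using main [of copy1 copy2] complex_linear_copies gen by (auto simp: A_relations_def)
  next
    case 3
    then show ?thesis
      using main [of copy2 copy2] complex_linear_copies gen by (auto simp: A_relations_def)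
  qed
qed

lemma ext_gen_anticommute: "ext_gen v * ext_gen w = - (ext_gen w * ext_gen v)"
proof -
  have "ext_gen (v + w) * ext_gen (v + w) = 0" by (rule ext_gen_square)
  then show ?thesis
    by (simp add: ext_gen_add ext_gen_square distrib_left distrib_right eq_neg_iff_add_eq_0 add.commute)
qed

lemma A_ideal_mat2_action:
  fixes x :: "nat \<Rightarrow> 'g::complex_lie_algebra"
  assumes \<beta>: "invariant_form \<beta>" and x: "orthonormal_basis \<beta> n x" and f: "structure_constants n x f"
    and r: "r \<in> A_ideal n x f"
  shows "ext_deriv (mat2_action M) r \<in> A_ideal n x f"
  unfolding A_ideal_def
proof (rule derivation_genideal
    [OF derivation_ext_deriv [OF complex_linear_mat2_action] _ r [unfolded A_ideal_def]])
  let ?D = "ext_deriv (mat2_action M :: 'g \<times> 'g \<Rightarrow> 'g \<times> 'g)"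
  let ?I = "genideal univ_ring (A_relations n x f)"
  have der: "derivation ?D" by (rule derivation_ext_deriv [OF complex_linear_mat2_action])
  interpret D: module_hom scaleC scaleC ?D
    using der by (simp add: derivation_def Vector_Spaces.linear_def)
  have mult: "?D (a * b) = ?D a * b + a * ?D b" for a b
    using der by (simp add: derivation_def)
  have pair: "ext_gen (a *\<^sub>C u, b *\<^sub>C u) = a *\<^sub>C copy1 u + b *\<^sub>C copy2 u" for a b and u :: 'g
  proof -
    have "(a *\<^sub>C u, b *\<^sub>C u) = a *\<^sub>C (u, 0) + b *\<^sub>C (0, u)"
      by (simp add: scaleC_prod_def)
    then show ?thesis
      by (simp only: ext_gen_add ext_gen_scale)
  qed
  have gen: "?D (copy1 u) = M $ 1 $ 1 *\<^sub>C copy1 u + M $ 2 $ 1 *\<^sub>C copy2 u"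
    "?D (copy2 u) = M $ 1 $ 2 *\<^sub>C copy1 u + M $ 2 $ 2 *\<^sub>C copy2 u" for u
    unfolding ext_deriv_gen [OF complex_linear_mat2_action] pair [symmetric]
    by (rule arg_cong [where f = ext_gen], simp add: mat2_action_def)+
  define S where "S P Q k = (\<Sum>i<n. \<Sum>j<n. f i j k *\<^sub>C (P (x i) * Q (x j)))"
    for P Q :: "'g \<Rightarrow> ('g \<times> 'g) exterior" and k
  have S21: "S copy2 copy1 k = S copy1 copy2 k" if "k < n" for k
  proof -
    have anti: "f i j k = - f j i k" if "i < n" "j < n" for i j
    proof -
      interpret B: module_hom scaleC "(*)" "\<lambda>u. \<beta> u (x k)"
        using \<beta> by (simp add: invariant_form_def Vector_Spaces.linear_def)
      show ?thesis
        using structure_constants_eq [OF \<beta> x f] that \<open>k < n\<close> lie_anticommute [of "x i" "x j"]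
        by (simp add: B.neg)
    qed
    have "f i j k *\<^sub>C (copy2 (x i) * copy1 (x j)) = f j i k *\<^sub>C (copy1 (x j) * copy2 (x i))"
      if "i < n" "j < n" for i j
      unfolding anti [OF that] ext_gen_anticommute [of "(0, x i)"] by simp
    then show ?thesis
      unfolding S_def by (subst (2) sum.swap) (intro sum.cong refl, simp)
  qed
  have S: "?D (S copy1 copy1 k) = (M $ 1 $ 1) *\<^sub>C S copy1 copy1 k + (M $ 2 $ 1) *\<^sub>C S copy2 copy1 k
      + ((M $ 1 $ 1) *\<^sub>C S copy1 copy1 k + (M $ 2 $ 1) *\<^sub>C S copy1 copy2 k)"
    "?D (S copy1 copy2 k) = (M $ 1 $ 1) *\<^sub>C S copy1 copy2 k + (M $ 2 $ 1) *\<^sub>C S copy2 copy2 k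
      + ((M $ 1 $ 2) *\<^sub>C S copy1 copy1 k + (M $ 2 $ 2) *\<^sub>C S copy1 copy2 k)"
    "?D (S copy2 copy2 k) = (M $ 1 $ 2) *\<^sub>C S copy1 copy2 k + (M $ 2 $ 2) *\<^sub>C S copy2 copy2 k
      + ((M $ 1 $ 2) *\<^sub>C S copy2 copy1 k + (M $ 2 $ 2) *\<^sub>C S copy2 copy2 k)" for k
    by (simp_all add: S_def D.sum D.scale mult gen distrib_left distrib_right scaleC_mult_left
        scaleC_mult_right scaleC_add_right sum.distrib complex_vector.scale_sum_right
        scaleC_scaleC mult.commute)
  have mem: "S copy1 copy1 k \<in> ?I" "S copy1 copy2 k \<in> ?I" "S copy2 copy2 k \<in> ?I" if "k < n" for k
    unfolding S_def by (rule univ_genideal_incl, use that in \<open>auto simp: A_relations_def\<close>)+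
  fix s assume "s \<in> A_relations n x f"
  then obtain k where k: "k < n" "s = S copy1 copy1 k \<or> s = S copy1 copy2 k \<or> s = S copy2 copy2 k"
    unfolding A_relations_def S_def by blast
  then show "?D s \<in> ?I"
    by (elim disjE) (simp add: S S21 mem univ_genideal_add univ_genideal_scaleC)+
qed

end

theory Submission
  imports Defs "Jordan_Normal_Form.Spectral_Radius"
begin

text \<open>Let \<open>C\<^sub>1\<close>, \<open>C\<^sub>2\<close> be the Casimir elements acting on the two copies separately. By the
  Jacobi identity, \<open>C\<^sub>i\<close> agrees modulo \<open>I\<close> with \<open>c\<close> times the degree in the \<open>i\<close>-th copy, \<open>c\<close> being
  the Casimir eigenvalue on \<open>\<gg>\<close>. On invariants of \<open>R\<close> we have \<open>C\<^sub>1 = C\<^sub>2\<close>; so if \<open>c \<noteq> 0\<close> and invariants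
  of \<open>A\<close> lift to invariants of \<open>R\<close>, then \<open>h \<in> sl(2)\<close> kills \<open>A\<^sup>\<gg>\<close>, and \<open>[h, e] = 2 e\<close>, \<open>[h, f] = - 2 f\<close>
  give the same for \<open>e\<close> and \<open>f\<close>.

  Both \<open>c \<noteq> 0\<close> and the lifting follow once the adjoint operators, in a suitable orthonormal basis,
  span a space closed under conjugate transposition. Such a basis is found by a variational argument
  (Kempf--Ness, Richardson, Donaldson): minimise the norm of the structure tensor over all orthonormal
  bases, a noncompact family, after adding \<open>\<epsilon>\<close> times a coercive term. If the minimisers escape to
  infinity as \<open>\<epsilon> \<rightarrow> 0\<close>, their rescaled Gram matrices degenerate to one whose kernel is a proper
  nonzero ideal. Otherwise they converge to a basis satisfying the moment map equation, which forces
  the conjugates of the adjoint matrices to be derivations, hence inner.\<close>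

section \<open>Operators on words\<close>

text \<open>On R the two copies of \<gg> can be acted on separately, but these separate actions do
  not preserve I: the mixed relations span only one copy of \<gg> inside \<gg> \<otimes> \<gg>. So
  C1 = C2 cannot be argued in A, which is why invariants are lifted first. The lifting takes place
  on coefficient functions of noncommutative words, which carry an evident Hermitian product;
  relations among words are absorbed by the subspace that is projected away. Without the \<epsilon>
  term a minimum need not exist. With it, everything depends on an estimate whose constant is free
  of \<epsilon>; it results from the mere sign of a norm square. Real rotations are unitary and
  leave the energy fixed, so only rotations by imaginary angles give equations, and these concern
  the imaginary parts of Gram matrices. Notation in the comments: Y is the complex orthogonal matrix
  of coordinates of a frame in the reference basis \<open>x\<close>, Y^H its conjugate transpose,
  and H = Y^H Y.\<close>

fun word_act :: "'j set \<Rightarrow> ('j \<Rightarrow> 'j \<Rightarrow> complex) \<Rightarrow> ('j list \<Rightarrow> complex) \<Rightarrow> 'j list \<Rightarrow> complex"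
  where
    "word_act J D t [] = 0"
  | "word_act J D t (i # w) = (\<Sum>j\<in>J. D i j * t (j # w)) + word_act J D (\<lambda>v. t (i # v)) w"

text \<open>Lengths up to \<open>m\<close> are taken together because elements of the exterior
  algebra are not assumed homogeneous; \<open>word_act\<close> preserves length and so respects the
  truncation.\<close>

definition words :: "'j set \<Rightarrow> nat \<Rightarrow> 'j list set"
  where "words J m = {w. set w \<subseteq> J \<and> length w \<le> m}"

lemma finite_words: "finite J \<Longrightarrow> finite (words J m)"
  unfolding words_def by (rule finite_lists_length_le)

lemma words_0 [simp]: "words J 0 = {[]}"
  by (auto simp: words_def)

lemma sum_words_Suc:
  assumes "finite J"
  shows "(\<Sum>w\<in>words J (Suc m). g w) = g [] + (\<Sum>i\<in>J. \<Sum>w\<in>words J m. g (i # w))"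
proof -
  have eq: "words J (Suc m) = insert [] ((\<lambda>(i, w). i # w) ` (J \<times> words J m))"
  proof (rule Set.set_eqI)
    fix w show "w \<in> words J (Suc m) \<longleftrightarrow> w \<in> insert [] ((\<lambda>(i, w). i # w) ` (J \<times> words J m))"
      by (cases w) (auto simp: words_def image_iff)
  qed
  have "(\<Sum>w\<in>words J (Suc m). g w) = g [] + (\<Sum>w\<in>(\<lambda>(i, w). i # w) ` (J \<times> words J m). g w)"
    unfolding eq using assms by (subst sum.insert) (auto intro: finite_words)
  also have "(\<Sum>w\<in>(\<lambda>(i, w). i # w) ` (J \<times> words J m). g w) = (\<Sum>(i, w)\<in>J \<times> words J m. g (i # w))"
    by (subst sum.reindex) (auto simp: inj_on_def case_prod_unfold)
  finally show ?thesis
    by (simp add: sum.cartesian_product)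
qed

lemma word_act_add: "word_act J D (\<lambda>w. s w + t w) w = word_act J D s w + word_act J D t w"
  by (induction w arbitrary: s t) (simp_all add: distrib_left sum.distrib)

lemma word_act_scale: "word_act J D (\<lambda>w. c * t w) w = c * word_act J D t w"
  by (induction w arbitrary: t) (simp_all add: distrib_left sum_distrib_left mult.left_commute)

lemma word_act_sum: "word_act J D (\<lambda>w. \<Sum>k\<in>K. t k w) w = (\<Sum>k\<in>K. word_act J D (t k) w)"
proof (induction K rule: infinite_finite_induct)
  case empty
  show ?case using word_act_scale [of J D 0 "\<lambda>_. 0"] by simp
next
  case (infinite K)
  then show ?case using word_act_scale [of J D 0 "\<lambda>_. 0"] by simp
qed (simp add: word_act_add)

lemma word_act_matrix_scale: "word_act J (\<lambda>i j. c * D i j) t w = c * word_act J D t w"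
  by (induction w arbitrary: t) (simp_all add: distrib_left sum_distrib_left mult.assoc)

lemma word_act_matrix_sum:
  "word_act J (\<lambda>i j. \<Sum>k\<in>K. D k i j) t w = (\<Sum>k\<in>K. word_act J (D k) t w)"
proof (induction w arbitrary: t)
  case (Cons i w)
  have "(\<Sum>j\<in>J. (\<Sum>k\<in>K. D k i j) * t (j # w)) = (\<Sum>k\<in>K. \<Sum>j\<in>J. D k i j * t (j # w))"
    by (subst sum.swap) (simp add: sum_distrib_right)
  then show ?case by (simp add: Cons sum.distrib)
qed simp

lemma word_act_matrix_cong:
  assumes "\<And>i j. i \<in> J \<Longrightarrow> j \<in> J \<Longrightarrow> D i j = E i j" and "set w \<subseteq> J"
  shows "word_act J D t w = word_act J E t w"
  using assms(2) by (induction w arbitrary: t) (simp_all add: assms(1))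

lemma word_act_cong:
  assumes "\<And>v. set v \<subseteq> J \<Longrightarrow> length v = length w \<Longrightarrow> s v = t v" and "set w \<subseteq> J"
  shows "word_act J D s w = word_act J D t w"
  using assms
proof (induction w arbitrary: s t)
  case (Cons i w)
  have "word_act J D (\<lambda>v. s (i # v)) w = word_act J D (\<lambda>v. t (i # v)) w"
    using Cons.prems by (intro Cons.IH) auto
  moreover have "s (j # w) = t (j # w)" if "j \<in> J" for j
    using Cons.prems that by auto
  ultimately show ?case by simp
qed simp

text \<open>A derivation applies the matrix to one letter at a time, and on a single letter the
  adjoint is the conjugate transpose; summing over positions gives the adjoint of the whole
  operator.\<close>

lemma word_act_adjoint:
  assumes J: "finite J" and E: "\<And>i j. i \<in> J \<Longrightarrow> j \<in> J \<Longrightarrow> E i j = cnj (D j i)"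
  shows "(\<Sum>w\<in>words J m. word_act J D s w * cnj (t w)) = (\<Sum>w\<in>words J m. s w * cnj (word_act J E t w))"
proof (induction m arbitrary: s t)
  case (Suc m)
  have "(\<Sum>i\<in>J. \<Sum>w\<in>words J m. (\<Sum>j\<in>J. D i j * s (j # w)) * cnj (t (i # w)))
      = (\<Sum>i\<in>J. \<Sum>j\<in>J. \<Sum>w\<in>words J m. D i j * s (j # w) * cnj (t (i # w)))"
    by (rule sum.cong [OF refl], subst sum.swap) (simp add: sum_distrib_right)
  also have "\<dots> = (\<Sum>j\<in>J. \<Sum>i\<in>J. \<Sum>w\<in>words J m. s (j # w) * cnj (E j i * t (i # w)))"
    by (subst sum.swap, intro sum.cong refl) (simp add: E mult_ac)
  also have "\<dots> = (\<Sum>j\<in>J. \<Sum>w\<in>words J m. s (j # w) * cnj (\<Sum>i\<in>J. E j i * t (i # w)))"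
    by (rule sum.cong [OF refl], subst sum.swap) (simp add: sum_distrib_left)
  finally show ?case
    by (simp add: sum_words_Suc [OF J] distrib_left distrib_right sum.distrib Suc del: cnj_sum)
qed simp

definition commutator_matrix ::
    "'j set \<Rightarrow> ('j \<Rightarrow> 'j \<Rightarrow> complex) \<Rightarrow> ('j \<Rightarrow> 'j \<Rightarrow> complex) \<Rightarrow> 'j \<Rightarrow> 'j \<Rightarrow> complex"
  where "commutator_matrix J A B i k = (\<Sum>j\<in>J. A i j * B j k) - (\<Sum>j\<in>J. B i j * A j k)"

text \<open>Operators on different letters commute, so only the terms with both matrices on the same
  letter survive.\<close>

lemma word_act_commutator:
  "word_act J A (word_act J B t) w - word_act J B (word_act J A t) w
    = word_act J (commutator_matrix J A B) t w"
proof (induction w arbitrary: t)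
  case (Cons i w)
  have two: "word_act J A (word_act J B t) (i # w)
      = (\<Sum>k\<in>J. (\<Sum>j\<in>J. A i j * B j k) * t (k # w)) + (\<Sum>j\<in>J. A i j * word_act J B (\<lambda>v. t (j # v)) w)
        + (\<Sum>j\<in>J. B i j * word_act J A (\<lambda>v. t (j # v)) w) + word_act J A (word_act J B (\<lambda>v. t (i # v))) w"
    for A B
  proof -
    have "(\<Sum>j\<in>J. A i j * (\<Sum>k\<in>J. B j k * t (k # w))) = (\<Sum>k\<in>J. (\<Sum>j\<in>J. A i j * B j k) * t (k # w))"
      unfolding sum_distrib_left sum_distrib_right by (subst sum.swap) (simp add: mult.assoc)
    then show ?thesis
      by (simp add: distrib_left sum.distrib word_act_add word_act_sum word_act_scale)
  qed
  show ?case
    unfolding two [of A B] two [of B A] word_act.simps(2) [of J "commutator_matrix J A B"] Cons [symmetric]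
    by (simp add: commutator_matrix_def left_diff_distrib sum_subtractf del: word_act.simps)
qed simp

text \<open>Induction on the coordinates: members of \<open>N\<close> vanishing at the new
  coordinate are covered by the induction hypothesis, and \<open>N\<close> exceeds them by at most
  one direction. Only values on \<open>W\<close> enter the product, so the projection
  \<open>b\<close> exists but is not claimed to be unique.\<close>

lemma orthogonal_decomposition:
  fixes N :: "('a \<Rightarrow> complex) set"
  assumes "finite W" and add: "\<And>s t. s \<in> N \<Longrightarrow> t \<in> N \<Longrightarrow> (\<lambda>w. s w + t w) \<in> N"
    and scale: "\<And>c t. t \<in> N \<Longrightarrow> (\<lambda>w. c * t w) \<in> N" and ne: "(\<lambda>w. 0) \<in> N"
  shows "\<exists>b\<in>N. \<forall>s\<in>N. (\<Sum>w\<in>W. (t w - b w) * cnj (s w)) = 0"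
  using assms
proof (induction W arbitrary: N t rule: finite_induct)
  case empty
  then show ?case by auto
next
  case (insert x W)
  note add = insert.prems(1) and scale = insert.prems(2) and ne = insert.prems(3)
  let ?ip = "\<lambda>s t. \<Sum>w\<in>insert x W. s w * cnj (t w)"
  define N0 where "N0 = {s \<in> N. s x = 0}"
  have dec: "\<exists>b\<in>N0. \<forall>s\<in>N0. ?ip (\<lambda>w. t w - b w) s = 0" for t
  proof -
    have "\<exists>b\<in>N0. \<forall>s\<in>N0. (\<Sum>w\<in>W. (t w - b w) * cnj (s w)) = 0"
      by (rule insert.IH) (auto simp: N0_def add scale ne)
    then show ?thesis using insert.hyps by (auto simp: N0_def)
  qed
  show ?case
  proof (cases "N = N0")
    case True
    then show ?thesis using dec by blast
  next
    case False
    then obtain v where v: "v \<in> N" "v x \<noteq> 0" by (auto simp: N0_def)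
    obtain v0 where v0: "v0 \<in> N0" "\<forall>s\<in>N0. ?ip (\<lambda>w. v w - v0 w) s = 0" using dec by blast
    \<comment> \<open>\<open>u\<close> spans what \<open>N\<close> has beyond \<open>N0\<close>,
      made orthogonal to \<open>N0\<close>; its multiple \<open>c\<close> corrects the projection
      \<open>b0\<close> onto \<open>N0\<close>.\<close>
    define u where "u w = v w + (- 1) * v0 w" for w
    have u: "u \<in> N" "u x \<noteq> 0"
      unfolding u_def using v v0 add [OF v(1) scale [of v0 "-1"]] by (auto simp: N0_def)
    have u_perp: "?ip u s = 0" if "s \<in> N0" for s
      using v0 that by (simp add: u_def)
    obtain b0 where b0: "b0 \<in> N0" "\<forall>s\<in>N0. ?ip (\<lambda>w. t w - b0 w) s = 0" using dec by blast
    have uu: "?ip u u \<noteq> 0"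
    proof -
      have "?ip u u = of_real (\<Sum>w\<in>insert x W. (cmod (u w))\<^sup>2)"
        by (simp only: complex_norm_square [symmetric] of_real_sum)
      moreover have "(\<Sum>w\<in>insert x W. (cmod (u w))\<^sup>2) > 0"
        using insert.hyps(1) u by (intro sum_pos2 [of _ x]) auto
      ultimately show ?thesis by (metis of_real_eq_0_iff less_irrefl)
    qed
    define c where "c = ?ip (\<lambda>w. t w - b0 w) u / ?ip u u"
    define b where "b w = b0 w + c * u w" for w
    have b: "b \<in> N"
      unfolding b_def using b0 u by (intro add scale) (auto simp: N0_def)
    have lin: "?ip (\<lambda>w. t w - b w) s = ?ip (\<lambda>w. t w - b0 w) s - c * ?ip u s" for s
      unfolding b_def sum_distrib_left sum_subtractf [symmetric]
      by (intro sum.cong refl) (simp add: algebra_simps)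
    have u0: "?ip (\<lambda>w. t w - b w) u = 0"
      unfolding lin using uu by (simp add: c_def)
    have "?ip (\<lambda>w. t w - b w) s = 0" if s: "s \<in> N" for s
    proof -
      \<comment> \<open>With this \<open>d\<close> the difference \<open>s0\<close> vanishes at
        \<open>x\<close>, which splits \<open>s\<close> into a member of \<open>N0\<close> and a
        multiple of \<open>u\<close>.\<close>
      define d where "d = s x / u x"
      define s0 where "s0 w = s w + (- d) * u w" for w
      have "s0 \<in> N" unfolding s0_def by (intro add scale s u)
      moreover have "s0 x = 0" using u by (simp add: s0_def d_def)
      ultimately have s0: "s0 \<in> N0" by (simp add: N0_def)
      have "?ip (\<lambda>w. t w - b w) s = ?ip (\<lambda>w. t w - b w) s0 + cnj d * ?ip (\<lambda>w. t w - b w) u"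
        unfolding s0_def sum_distrib_left sum.distrib [symmetric]
        by (intro sum.cong refl) (simp add: algebra_simps)
      also have "\<dots> = 0"
        unfolding u0 using lin [of s0] b0 s0 u_perp by simp
      finally show ?thesis .
    qed
    then show ?thesis using b by blast
  qed
qed

section \<open>Sums, sequences and eigenvectors\<close>

lemma sum_swap_pairs:
  "(\<Sum>i\<in>I. \<Sum>l\<in>L. \<Sum>j\<in>J. \<Sum>c\<in>C. g i l j c) = (\<Sum>j\<in>J. \<Sum>c\<in>C. \<Sum>i\<in>I. \<Sum>l\<in>L. g i l j c)"
proof -
  have "(\<Sum>i\<in>I. \<Sum>l\<in>L. \<Sum>j\<in>J. \<Sum>c\<in>C. g i l j c) = (\<Sum>p\<in>I \<times> L. \<Sum>q\<in>J \<times> C. g (fst p) (snd p) (fst q) (snd q))"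
    by (simp add: sum.cartesian_product' case_prod_unfold)
  also have "\<dots> = (\<Sum>q\<in>J \<times> C. \<Sum>p\<in>I \<times> L. g (fst p) (snd p) (fst q) (snd q))"
    by (rule sum.swap)
  finally show ?thesis by (simp add: sum.cartesian_product' case_prod_unfold)
qed

lemma antisymmetric_sum_eq_zero:
  fixes B S :: "nat \<Rightarrow> nat \<Rightarrow> complex"
  assumes "\<And>i l. i < n \<Longrightarrow> l < n \<Longrightarrow> B l i = - B i l" "\<And>i l. i < n \<Longrightarrow> l < n \<Longrightarrow> S l i = S i l"
  shows "(\<Sum>i<n. \<Sum>l<n. B i l * S i l) = 0"
proof -
  have "(\<Sum>i<n. \<Sum>l<n. B i l * S i l) = (\<Sum>i<n. \<Sum>l<n. B l i * S l i)"
    by (rule sum.swap)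
  also have "\<dots> = - (\<Sum>i<n. \<Sum>l<n. B i l * S i l)"
    unfolding sum_negf [symmetric] by (intro sum.cong refl) (metis assms lessThan_iff mult_minus_left)
  finally show ?thesis by simp
qed

lemma sum_swap_triple:
  "(\<Sum>i\<in>I. \<Sum>j\<in>J. \<Sum>k\<in>K. g i j k) = (\<Sum>k\<in>K. \<Sum>i\<in>I. \<Sum>j\<in>J. g i j k)"
proof -
  have "(\<Sum>i\<in>I. \<Sum>j\<in>J. \<Sum>k\<in>K. g i j k) = (\<Sum>i\<in>I. \<Sum>k\<in>K. \<Sum>j\<in>J. g i j k)"
    by (rule sum.cong [OF refl], rule sum.swap)
  also have "\<dots> = (\<Sum>k\<in>K. \<Sum>i\<in>I. \<Sum>j\<in>J. g i j k)"
    by (rule sum.swap)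
  finally show ?thesis .
qed

lemma cmod_sum_mult_square_le:
  "(cmod (\<Sum>i\<in>I. f i * g i))\<^sup>2 \<le> (\<Sum>i\<in>I. (cmod (f i))\<^sup>2) * (\<Sum>i\<in>I. (cmod (g i))\<^sup>2)"
proof -
  have "cmod (\<Sum>i\<in>I. f i * g i) \<le> (\<Sum>i\<in>I. cmod (f i) * cmod (g i))"
    by (rule order_trans [OF norm_sum]) (simp add: norm_mult)
  then have "(cmod (\<Sum>i\<in>I. f i * g i))\<^sup>2 \<le> (\<Sum>i\<in>I. cmod (f i) * cmod (g i))\<^sup>2"
    by (intro power_mono) auto
  also have "\<dots> \<le> (\<Sum>i\<in>I. (cmod (f i))\<^sup>2) * (\<Sum>i\<in>I. (cmod (g i))\<^sup>2)"
    by (rule Cauchy_Schwarz_ineq_sum)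
  finally show ?thesis .
qed

lemma convergent_subsequence_coordinates:
  fixes F :: "nat \<Rightarrow> 'i \<Rightarrow> complex"
  assumes "finite S" "\<And>i. i \<in> S \<Longrightarrow> bounded (range (\<lambda>N. F N i))"
  shows "\<exists>r l. strict_mono (r :: nat \<Rightarrow> nat) \<and> (\<forall>i\<in>S. (\<lambda>N. F (r N) i) \<longlonglongrightarrow> l i)"
  using assms
proof (induction S rule: finite_induct)
  case empty
  show ?case by (auto intro: strict_mono_id)
next
  case (insert a S)
  then obtain r l where r: "strict_mono (r :: nat \<Rightarrow> nat)" "\<forall>i\<in>S. (\<lambda>N. F (r N) i) \<longlonglongrightarrow> l i"
    by auto
  have "bounded (range (\<lambda>N. F (r N) a))"
    by (rule bounded_subset [OF insert.prems [of a]]) auto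
  from bounded_imp_convergent_subsequence [OF this]
  obtain k r' where r': "strict_mono (r' :: nat \<Rightarrow> nat)" "((\<lambda>N. F (r N) a) \<circ> r') \<longlonglongrightarrow> k"
    by auto
  have "(\<lambda>N. F ((r \<circ> r') N) i) \<longlonglongrightarrow> (if i = a then k else l i)" if "i \<in> insert a S" for i
  proof (cases "i = a")
    case True
    then show ?thesis using r' by (simp add: o_def)
  next
    case False
    then have "(\<lambda>N. F (r N) i) \<longlonglongrightarrow> l i" using that r by auto
    from LIMSEQ_subseq_LIMSEQ [OF this r'(1)] show ?thesis using False by (simp add: o_def)
  qed
  then show ?case
    using strict_mono_o [OF r(1) r'(1)]
    by (intro exI [of _ "r \<circ> r'"] exI [of _ "\<lambda>i. if i = a then k else l i"]) (simp add: o_def)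
qed

lemma has_real_derivative_cmod_square:
  assumes "(z has_vector_derivative z') (at s)"
  shows "((\<lambda>s. (cmod (z s))\<^sup>2) has_real_derivative 2 * Re (cnj (z s) * z')) (at s)"
proof -
  have "((\<lambda>s. z s \<bullet> z s) has_vector_derivative (z s \<bullet> z' + z' \<bullet> z s)) (at s)"
    by (rule bounded_bilinear.has_vector_derivative [OF bounded_bilinear_inner assms assms])
  then show ?thesis
    by (simp add: dot_square_norm has_real_derivative_iff_has_vector_derivative inner_complex_def algebra_simps)
qed

lemma complex_matrix_eigenvector:
  fixes K :: "nat \<Rightarrow> nat \<Rightarrow> complex"
  assumes "n > 0"
  shows "\<exists>v c. (\<exists>i<n. v i \<noteq> 0) \<and> (\<forall>i<n. (\<Sum>j<n. K i j * v j) = c * v i)"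
proof -
  let ?M = "Matrix.mat n n (\<lambda>(i, j). K i j)"
  have M: "?M \<in> carrier_mat n n" by simp
  obtain c where "eigenvalue ?M c"
    using spectrum_non_empty [OF M assms] by (auto simp: spectrum_def)
  then obtain v where v: "v \<in> carrier_vec n" "v \<noteq> 0\<^sub>v n" "?M *\<^sub>v v = c \<cdot>\<^sub>v v"
    by (auto simp: eigenvalue_def eigenvector_def)
  have "(\<Sum>j<n. K i j * vec_index v j) = c * vec_index v i" if "i < n" for i
  proof -
    have "vec_index (?M *\<^sub>v v) i = (\<Sum>j<n. K i j * vec_index v j)"
      using that v(1) by (simp add: scalar_prod_def atLeast0LessThan)
    then show ?thesis using that v by simp
  qed
  moreover have "\<exists>i<n. vec_index v i \<noteq> 0"
    using v(1,2) by (metis carrier_vecD eq_vecI index_zero_vec)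
  ultimately show ?thesis by blast
qed

section \<open>Limits of orthonormal bases\<close>

locale metric_lie_algebra =
  fixes \<beta> :: "'g::complex_lie_algebra \<Rightarrow> 'g \<Rightarrow> complex"
  assumes form: "invariant_form \<beta>"
begin

lemma form_sym: "\<beta> u v = \<beta> v u"
  and form_bracket: "\<beta> (lie_bracket u v) w = \<beta> u (lie_bracket v w)"
  using form by (auto simp: invariant_form_def)

lemma form_add_right: "\<beta> u (v + w) = \<beta> u v + \<beta> u w"
  and form_scale_right: "\<beta> u (c *\<^sub>C v) = c * \<beta> u v"
  and form_zero_right: "\<beta> u 0 = 0"
  and form_sum_right: "\<beta> u (\<Sum>i\<in>K. g i) = (\<Sum>i\<in>K. \<beta> u (g i))"
  and form_minus_right: "\<beta> u (- v) = - \<beta> u v"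
proof -
  interpret B: Modules.module_hom scaleC "(*)" "\<beta> u"
    using form by (simp add: invariant_form_def Vector_Spaces.linear_def)
  show "\<beta> u (v + w) = \<beta> u v + \<beta> u w" "\<beta> u (c *\<^sub>C v) = c * \<beta> u v" "\<beta> u 0 = 0"
    "\<beta> u (\<Sum>i\<in>K. g i) = (\<Sum>i\<in>K. \<beta> u (g i))" "\<beta> u (- v) = - \<beta> u v"
    by (rule B.add B.scale B.zero B.sum B.neg)+
qed

lemma form_add_left: "\<beta> (v + w) u = \<beta> v u + \<beta> w u"
  and form_scale_left: "\<beta> (c *\<^sub>C v) u = c * \<beta> v u"
  and form_zero_left: "\<beta> 0 u = 0"
  and form_sum_left: "\<beta> (\<Sum>i\<in>K. g i) u = (\<Sum>i\<in>K. \<beta> (g i) u)"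
  and form_minus_left: "\<beta> (- v) u = - \<beta> v u"
  by (simp_all add: form_sym [of _ u] form_add_right form_scale_right form_zero_right
      form_sum_right form_minus_right)

lemmas form_linear = form_add_right form_scale_right form_zero_right form_sum_right form_minus_right
  form_add_left form_scale_left form_zero_left form_sum_left form_minus_left

lemma form_diff: "\<beta> u (v - w) = \<beta> u v - \<beta> u w" "\<beta> (v - w) u = \<beta> v u - \<beta> w u"
  using form_add_right [of u v "- w"] form_add_left [of v "- w" u] by (simp_all add: form_linear)

lemma bracket_zero: "lie_bracket u (0::'g) = 0" "lie_bracket (0::'g) u = 0"
  using lie_scale_right [of u 0 0] lie_scale_left [of 0 0 u] by simp_all

lemma bracket_sum: "lie_bracket u (\<Sum>i\<in>K. g i) = (\<Sum>i\<in>K. lie_bracket u (g i :: 'g))"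
  "lie_bracket (\<Sum>i\<in>K. g i) u = (\<Sum>i\<in>K. lie_bracket (g i :: 'g) u)"
  by (induction K rule: infinite_finite_induct)
    (simp_all add: bracket_zero lie_add_right lie_add_left)

lemmas bracket_linear = lie_add_left lie_add_right lie_scale_left lie_scale_right bracket_zero bracket_sum

text \<open>The structure constants of orthonormal bases, read as one trilinear form. It is
  alternating by the lemmas below, so its three slots can be treated alike.\<close>

definition cubic :: "'g \<Rightarrow> 'g \<Rightarrow> 'g \<Rightarrow> complex"
  where "cubic u v w = \<beta> (lie_bracket u v) w"

lemma cubic_linear:
  "cubic (a + b) v w = cubic a v w + cubic b v w" "cubic (c *\<^sub>C a) v w = c * cubic a v w"
  "cubic u (a + b) w = cubic u a w + cubic u b w" "cubic u (c *\<^sub>C a) w = c * cubic u a w"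
  "cubic u v (a + b) = cubic u v a + cubic u v b" "cubic u v (c *\<^sub>C a) = c * cubic u v a"
  "cubic 0 v w = 0" "cubic u 0 w = 0" "cubic u v 0 = 0"
  "cubic (\<Sum>i\<in>K. g i) v w = (\<Sum>i\<in>K. cubic (g i) v w)"
  "cubic u (\<Sum>i\<in>K. g i) w = (\<Sum>i\<in>K. cubic u (g i) w)"
  "cubic u v (\<Sum>i\<in>K. g i) = (\<Sum>i\<in>K. cubic u v (g i))"
  by (simp_all add: cubic_def bracket_linear form_linear)

lemma cubic_minus: "cubic (- u) v w = - cubic u v w"
  using cubic_linear(2) [of "- 1" u v w] by simp

lemma cubic_rotate: "cubic u v w = cubic v w u"
  unfolding cubic_def by (metis form_bracket form_sym)

lemma cubic_swap: "cubic u v w = - cubic v u w"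
  unfolding cubic_def by (subst lie_anticommute) (simp add: form_linear)

lemma cubic_swap': "cubic u v w = - cubic u w v"
  by (metis cubic_rotate cubic_swap)

lemma cubic_invariant:
  "cubic (lie_bracket u a) b c + cubic a (lie_bracket u b) c + cubic a b (lie_bracket u c) = 0"
proof -
  have "cubic a b (lie_bracket u c) = - \<beta> (lie_bracket u (lie_bracket a b)) c"
    unfolding cubic_def form_bracket [symmetric]
    by (subst lie_anticommute [of "lie_bracket a b"]) (simp add: form_linear)
  then show ?thesis
    by (simp add: cubic_def form_linear lie_derivation [of u a b])
qed

end

locale based_metric_lie_algebra = metric_lie_algebra +
  fixes n :: nat and x :: "nat \<Rightarrow> 'a"
  assumes basis: "orthonormal_basis \<beta> n x"
begin

lemma orthonormal: "orthonormal_basis \<beta> n y \<Longrightarrow> i < n \<Longrightarrow> j < n \<Longrightarrow> \<beta> (y i) (y j) = (if i = j then 1 else 0)"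
  by (simp add: orthonormal_basis_def)

lemma parseval:
  assumes "orthonormal_basis \<beta> n y"
  shows "(\<Sum>i<n. \<beta> u (y i) * \<beta> (y i) v) = \<beta> u v"
proof -
  have "\<beta> u v = \<beta> (\<Sum>i<n. \<beta> u (y i) *\<^sub>C y i) v"
    using orthonormal_expand [OF form assms, of u] by simp
  then show ?thesis by (simp add: form_linear)
qed

lemma eq_by_coordinates:
  assumes "orthonormal_basis \<beta> n y" "\<And>i. i < n \<Longrightarrow> \<beta> u (y i) = \<beta> v (y i)"
  shows "u = v"
  using orthonormal_expand [OF form assms(1), of u] orthonormal_expand [OF form assms(1), of v] assms(2)
  by simp

lemma orthonormal_basisI:
  assumes orth: "\<And>i j. i < n \<Longrightarrow> j < n \<Longrightarrow> \<beta> (y i) (y j) = (if i = j then 1 else 0)"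
    and expand: "\<And>z. z = (\<Sum>i<n. \<beta> z (y i) *\<^sub>C y i)"
  shows "orthonormal_basis \<beta> n y"
  unfolding orthonormal_basis_def
proof (intro conjI)
  show inj: "inj_on y {..<n}"
  proof (rule inj_onI)
    fix i j assume "i \<in> {..<n}" "j \<in> {..<n}" "y i = y j"
    then show "i = j" using orth [of i j] orth [of j j] by (auto split: if_splits)
  qed
  show "complex_vector.independent (y ` {..<n})"
  proof (rule complex_vector.independent_if_scalars_zero)
    fix c v assume c: "(\<Sum>v\<in>y ` {..<n}. c v *\<^sub>C v) = 0" and v: "v \<in> y ` {..<n}"
    then obtain j where j: "j < n" "v = y j" by auto
    have "0 = \<beta> (\<Sum>i<n. c (y i) *\<^sub>C y i) (y j)"
      using c by (simp add: sum.reindex [OF inj] form_linear)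
    also have "\<dots> = (\<Sum>i<n. if i = j then c (y i) else 0)"
      unfolding form_linear by (rule sum.cong) (use orth j in auto)
    finally show "c v = 0" using j by simp
  qed simp
  show "complex_vector.span (y ` {..<n}) = UNIV"
  proof -
    have "z \<in> complex_vector.span (y ` {..<n})" for z
      by (subst expand [of z])
        (intro complex_vector.span_sum complex_vector.span_scale complex_vector.span_base, auto)
    then show ?thesis by auto
  qed
  show "\<forall>i<n. \<forall>j<n. \<beta> (y i) (y j) = (if i = j then 1 else 0)" using orth by blast
qed

text \<open>The algebra carries no topology, so convergence is stated through the form: each
  coordinate converges as a complex number.\<close>

definition frame_limit :: "(nat \<Rightarrow> nat \<Rightarrow> 'a) \<Rightarrow> (nat \<Rightarrow> 'a) \<Rightarrow> bool"
  where "frame_limit Y y \<longleftrightarrow> (\<forall>i<n. \<forall>z. (\<lambda>N. \<beta> (Y N i) z) \<longlonglongrightarrow> \<beta> (y i) z)"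

text \<open>Orthonormality and completeness are polynomial identities in the coordinates, hence
  survive limits. Boundedness is an assumption because complex orthogonal frames form a noncompact
  set.\<close>

lemma frame_limit_exists:
  assumes Y: "\<And>N. orthonormal_basis \<beta> n (Y N)"
    and bdd: "\<And>N i a. i < n \<Longrightarrow> a < n \<Longrightarrow> cmod (\<beta> (Y N i) (x a)) \<le> B"
  shows "\<exists>r y. strict_mono (r :: nat \<Rightarrow> nat) \<and> orthonormal_basis \<beta> n y \<and> frame_limit (\<lambda>N. Y (r N)) y"
proof -
  have "\<exists>r l. strict_mono (r :: nat \<Rightarrow> nat) \<and>
      (\<forall>p\<in>{..<n} \<times> {..<n}. (\<lambda>N. \<beta> (Y (r N) (fst p)) (x (snd p))) \<longlonglongrightarrow> l p)"
    by (rule convergent_subsequence_coordinates) (use bdd in \<open>auto simp: bounded_iff, blast\<close>)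
  then obtain r l where r: "strict_mono (r :: nat \<Rightarrow> nat)"
    and l: "\<And>i a. i < n \<Longrightarrow> a < n \<Longrightarrow> (\<lambda>N. \<beta> (Y (r N) i) (x a)) \<longlonglongrightarrow> l (i, a)"
    by auto
  define y where "y i = (\<Sum>a<n. l (i, a) *\<^sub>C x a)" for i
  have coord: "\<beta> (y i) (x a) = l (i, a)" if "a < n" for i a
  proof -
    have "\<beta> (y i) (x a) = (\<Sum>b<n. if b = a then l (i, b) else 0)"
      unfolding y_def form_linear by (rule sum.cong) (use orthonormal [OF basis] that in auto)
    then show ?thesis using that by simp
  qed
  have exp: "\<beta> v z = (\<Sum>a<n. \<beta> v (x a) * \<beta> (x a) z)" for v z
    by (simp add: parseval [OF basis])
  have lim: "(\<lambda>N. \<beta> (Y (r N) i) z) \<longlonglongrightarrow> \<beta> (y i) z" if "i < n" for i z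
    by (subst (1 2) exp) (intro tendsto_sum tendsto_mult tendsto_const, use l that coord in auto)
  have "orthonormal_basis \<beta> n y"
  proof (rule orthonormal_basisI)
    fix i j assume ij: "i < n" "j < n"
    have "(\<lambda>N. \<Sum>a<n. \<beta> (Y (r N) i) (x a) * \<beta> (Y (r N) j) (x a))
        \<longlonglongrightarrow> (\<Sum>a<n. \<beta> (y i) (x a) * \<beta> (y j) (x a))"
      by (intro tendsto_sum tendsto_mult lim ij)
    moreover have "(\<Sum>a<n. \<beta> u (x a) * \<beta> v (x a)) = \<beta> u v" for u v
      using parseval [OF basis, of u v] by (simp add: form_sym [of v])
    ultimately have "(\<lambda>N. \<beta> (Y (r N) i) (Y (r N) j)) \<longlonglongrightarrow> \<beta> (y i) (y j)" by simp
    then show "\<beta> (y i) (y j) = (if i = j then 1 else 0)"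
      by (simp add: orthonormal [OF Y ij] LIMSEQ_const_iff)
  next
    fix z
    show "z = (\<Sum>i<n. \<beta> z (y i) *\<^sub>C y i)"
    \<comment> \<open>Tested against the reference basis, completeness becomes a numerical identity
      that passes to the limit.\<close>
    proof (rule eq_by_coordinates [OF basis])
      fix b assume "b < n"
      have "(\<lambda>N. \<Sum>i<n. \<beta> (Y (r N) i) z * \<beta> (Y (r N) i) (x b)) \<longlonglongrightarrow> (\<Sum>i<n. \<beta> (y i) z * \<beta> (y i) (x b))"
        by (intro tendsto_sum tendsto_mult lim) auto
      moreover have "(\<Sum>i<n. \<beta> (Y (r N) i) z * \<beta> (Y (r N) i) (x b)) = \<beta> z (x b)" for N
        using parseval [OF Y [of "r N"], of z "x b"] by (simp add: form_sym [of z])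
      ultimately have "(\<Sum>i<n. \<beta> (y i) z * \<beta> (y i) (x b)) = \<beta> z (x b)"
        by (simp add: LIMSEQ_const_iff)
      then show "\<beta> z (x b) = \<beta> (\<Sum>i<n. \<beta> z (y i) *\<^sub>C y i) (x b)"
        by (simp add: form_linear form_sym [of z])
    qed
  qed
  then show ?thesis using r lim by (auto simp: frame_limit_def)
qed

lemma cubic_expand:
  "cubic u v w = (\<Sum>a<n. \<Sum>b<n. \<Sum>c<n. \<beta> u (x a) * \<beta> v (x b) * \<beta> w (x c) * cubic (x a) (x b) (x c))"
proof -
  have 1: "cubic u v w = (\<Sum>a<n. \<beta> u (x a) * cubic (x a) v w)" for u v w
    by (subst orthonormal_expand [OF form basis, of u]) (simp add: cubic_linear)
  have 2: "cubic u v w = (\<Sum>b<n. \<beta> v (x b) * cubic u (x b) w)" for u v w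
    by (subst orthonormal_expand [OF form basis, of v]) (simp add: cubic_linear)
  have 3: "cubic u v w = (\<Sum>c<n. \<beta> w (x c) * cubic u v (x c))" for u v w
    by (subst orthonormal_expand [OF form basis, of w]) (simp add: cubic_linear)
  show ?thesis
    unfolding 1 [of u v w] 2 [of "x _" v w] 3 [of "x _" "x _" w] sum_distrib_left mult.assoc ..
qed

lemma frame_limit_cubic:
  assumes "frame_limit Y y" "i < n" "j < n" "k < n"
  shows "(\<lambda>N. cubic (Y N i) (Y N j) (Y N k)) \<longlonglongrightarrow> cubic (y i) (y j) (y k)"
  by (subst (1 2) cubic_expand)
    (intro tendsto_sum tendsto_mult tendsto_const, use assms in \<open>auto simp: frame_limit_def\<close>)

section \<open>Minimal bases\<close>

text \<open>The second summand makes the energy coercive on the noncompact set of orthonormal bases.\<close>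

definition energy :: "real \<Rightarrow> (nat \<Rightarrow> 'a) \<Rightarrow> real"
  where "energy \<epsilon> y = (\<Sum>i<n. \<Sum>j<n. \<Sum>k<n. (cmod (cubic (y i) (y j) (y k)))\<^sup>2)
    + \<epsilon> * (\<Sum>i<n. \<Sum>a<n. (cmod (\<beta> (y i) (x a)))\<^sup>2)"

lemma coordinate_le_sum:
  assumes "i < n" "a < n"
  shows "(cmod (\<beta> (y i) (x a)))\<^sup>2 \<le> (\<Sum>i<n. \<Sum>a<n. (cmod (\<beta> (y i) (x a)))\<^sup>2)"
proof -
  have "(cmod (\<beta> (y i) (x a)))\<^sup>2 \<le> (\<Sum>a<n. (cmod (\<beta> (y i) (x a)))\<^sup>2)"
    by (rule member_le_sum [of a "{..<n}" "\<lambda>a. (cmod (\<beta> (y i) (x a)))\<^sup>2"]) (use assms in auto)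
  also have "\<dots> \<le> (\<Sum>i<n. \<Sum>a<n. (cmod (\<beta> (y i) (x a)))\<^sup>2)"
    by (rule member_le_sum [of i "{..<n}" "\<lambda>i. \<Sum>a<n. (cmod (\<beta> (y i) (x a)))\<^sup>2"])
      (use assms in \<open>auto intro: sum_nonneg\<close>)
  finally show ?thesis .
qed

text \<open>Direct method: the \<epsilon> term bounds the coordinates along a minimising sequence,
  so a subsequence converges, and the energy is continuous in the coordinates.\<close>

lemma energy_minimiser:
  assumes \<epsilon>: "\<epsilon> > 0"
  shows "\<exists>y. orthonormal_basis \<beta> n y \<and> (\<forall>z. orthonormal_basis \<beta> n z \<longrightarrow> energy \<epsilon> y \<le> energy \<epsilon> z)"
proof -
  define S where "S = energy \<epsilon> ` {y. orthonormal_basis \<beta> n y}"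
  have ne: "S \<noteq> {}" using basis by (auto simp: S_def)
  have pos: "energy \<epsilon> y \<ge> 0" for y
    unfolding energy_def using \<epsilon> by (intro add_nonneg_nonneg mult_nonneg_nonneg sum_nonneg) auto
  then have bdd: "bdd_below S" by (auto simp: S_def intro!: bdd_belowI [of _ 0])
  have "\<exists>y. orthonormal_basis \<beta> n y \<and> energy \<epsilon> y < Inf S + 1 / real (Suc N)" for N
  proof -
    have "\<exists>e\<in>S. e < Inf S + 1 / real (Suc N)"
      using cInf_lessD [OF ne, of "Inf S + 1 / real (Suc N)"] by auto
    then show ?thesis by (auto simp: S_def)
  qed
  then obtain Y where Y: "\<And>N. orthonormal_basis \<beta> n (Y N)" "\<And>N. energy \<epsilon> (Y N) < Inf S + 1 / real (Suc N)"
    by metis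
  have "\<exists>r y. strict_mono (r :: nat \<Rightarrow> nat) \<and> orthonormal_basis \<beta> n y \<and> frame_limit (\<lambda>N. Y (r N)) y"
  proof (rule frame_limit_exists [OF Y(1)])
    fix N i a assume ia: "i < n" "a < n"
    let ?s = "\<Sum>i<n. \<Sum>a<n. (cmod (\<beta> (Y N i) (x a)))\<^sup>2"
    have "\<epsilon> * ?s \<le> energy \<epsilon> (Y N)"
      unfolding energy_def by (simp add: sum_nonneg)
    also have "\<dots> \<le> Inf S + 1"
      using Y(2) [of N] by (smt (verit) divide_le_eq_1 of_nat_0_less_iff of_nat_1 of_nat_le_iff zero_less_Suc Suc_le_mono le0 One_nat_def)
    finally have "?s \<le> (Inf S + 1) / \<epsilon>" using \<epsilon> by (simp add: field_simps)
    with coordinate_le_sum [OF ia, of "Y N"] show "cmod (\<beta> (Y N i) (x a)) \<le> sqrt ((Inf S + 1) / \<epsilon>)"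
      by (intro real_le_rsqrt) linarith
  qed
  then obtain r y where r: "strict_mono (r :: nat \<Rightarrow> nat)" and y: "orthonormal_basis \<beta> n y"
    and lim: "frame_limit (\<lambda>N. Y (r N)) y" by blast
  have "(\<lambda>N. energy \<epsilon> (Y (r N))) \<longlonglongrightarrow> energy \<epsilon> y"
    unfolding energy_def
    by (intro tendsto_add tendsto_mult tendsto_sum tendsto_power tendsto_norm tendsto_const
        frame_limit_cubic [OF lim]) (use lim in \<open>auto simp: frame_limit_def\<close>)
  moreover have "(\<lambda>N. Inf S + 1 / real (Suc (r N))) \<longlonglongrightarrow> Inf S + 0"
    using LIMSEQ_subseq_LIMSEQ [OF LIMSEQ_inverse_real_of_nat r]
    by (intro tendsto_add tendsto_const) (simp add: o_def inverse_eq_divide)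
  ultimately have "energy \<epsilon> y \<le> Inf S + 0"
    by (rule LIMSEQ_le) (use Y(2) less_imp_le in blast)
  moreover have "Inf S \<le> energy \<epsilon> z" if "orthonormal_basis \<beta> n z" for z
    using that bdd by (intro cInf_lower) (auto simp: S_def)
  ultimately show ?thesis using y by force
qed

section \<open>First variation along rotations by imaginary angles\<close>

definition rotation_velocity :: "nat \<Rightarrow> nat \<Rightarrow> (nat \<Rightarrow> 'a) \<Rightarrow> nat \<Rightarrow> 'a"
  where "rotation_velocity a b y i = (if i = a then \<i> *\<^sub>C y b else if i = b then (- \<i>) *\<^sub>C y a else 0)"

text \<open>Rotation in the plane of \<open>y a\<close> and \<open>y b\<close> by the complex angle \<open>\<i> z\<close>.\<close>

definition rotation :: "nat \<Rightarrow> nat \<Rightarrow> (nat \<Rightarrow> 'a) \<Rightarrow> complex \<Rightarrow> nat \<Rightarrow> 'a"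
  where "rotation a b y z i =
    (if i = a \<or> i = b then cosh z else 1) *\<^sub>C y i + sinh z *\<^sub>C rotation_velocity a b y i"

text \<open>The angle being imaginary, the identity cosh^2 - sinh^2 = 1 takes the place of the
  Pythagorean one.\<close>

lemma orthonormal_rotation:
  assumes y: "orthonormal_basis \<beta> n y" and ab: "a < n" "b < n" "a \<noteq> b"
  shows "orthonormal_basis \<beta> n (rotation a b y z)"
proof (rule orthonormal_basisI)
  have cs: "cosh z * cosh z = 1 + sinh z * sinh z"
    using cosh_square_eq [of z] by (simp add: power2_eq_square)
  fix i j assume ij: "i < n" "j < n"
  show "\<beta> (rotation a b y z i) (rotation a b y z j) = (if i = j then 1 else 0)"
    using ab ij
    by (cases "i = a"; cases "i = b"; cases "j = a"; cases "j = b")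
      (simp_all add: rotation_def rotation_velocity_def form_linear form_diff orthonormal [OF y] cs algebra_simps)
next
  have cs: "cosh z * cosh z = 1 + sinh z * sinh z"
    using cosh_square_eq [of z] by (simp add: power2_eq_square)
  let ?r = "rotation a b y z"
  have split: "(\<Sum>i<n. g i) = g a + g b + (\<Sum>i\<in>{..<n} - {a, b}. g i)" for g :: "nat \<Rightarrow> complex"
  proof -
    have "{..<n} = insert a (insert b ({..<n} - {a, b}))" using ab by auto
    then have "(\<Sum>i<n. g i) = (\<Sum>i\<in>insert a (insert b ({..<n} - {a, b})). g i)" by simp
    then show ?thesis using ab by (simp add: add.assoc)
  qed
  have "(\<Sum>i<n. \<beta> u (?r i) * \<beta> (?r i) w) = (\<Sum>i<n. \<beta> u (y i) * \<beta> (y i) w)" for u w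
  proof -
    have "\<beta> u (?r a) * \<beta> (?r a) w + \<beta> u (?r b) * \<beta> (?r b) w
        = (cosh z * cosh z - sinh z * sinh z) * (\<beta> u (y a) * \<beta> (y a) w + \<beta> u (y b) * \<beta> (y b) w)"
      using ab by (simp add: rotation_def rotation_velocity_def form_linear form_diff algebra_simps)
    moreover have "?r i = y i" if "i \<noteq> a" "i \<noteq> b" for i
      using that by (simp add: rotation_def rotation_velocity_def scaleC_one)
    ultimately show ?thesis unfolding split cs by simp
  qed
  then have par: "(\<Sum>i<n. \<beta> u (?r i) * \<beta> (?r i) w) = \<beta> u w" for u w
    by (simp add: parseval [OF y])
  fix u
  show "u = (\<Sum>i<n. \<beta> u (?r i) *\<^sub>C ?r i)"
    by (rule eq_by_coordinates [OF y]) (simp add: form_linear par)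
qed

text \<open>A Hermitian matrix, so its real part is symmetric and its imaginary part antisymmetric.
  The imaginary part is the moment map, at the structure tensor, of the complex orthogonal
  group.\<close>

definition cubic_gram :: "(nat \<Rightarrow> 'a) \<Rightarrow> nat \<Rightarrow> nat \<Rightarrow> complex"
  where "cubic_gram y a b = (\<Sum>j<n. \<Sum>k<n. cubic (y a) (y j) (y k) * cnj (cubic (y b) (y j) (y k)))"

text \<open>This is Y Y^H, in contrast to H = Y^H Y in \<open>gram_functional\<close>.\<close>

definition gram :: "(nat \<Rightarrow> 'a) \<Rightarrow> nat \<Rightarrow> nat \<Rightarrow> complex"
  where "gram y a b = (\<Sum>c<n. \<beta> (y a) (x c) * cnj (\<beta> (y b) (x c)))"

lemma cnj_cubic_gram: "cnj (cubic_gram y a b) = cubic_gram y b a"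
  by (simp add: cubic_gram_def mult.commute)

lemma cnj_gram: "cnj (gram y a b) = gram y b a"
  by (simp add: gram_def mult.commute)

text \<open>Before restriction to real \<open>s\<close> the curve is holomorphic in the angle, so
  complex differentiation rules apply; at 0 the function cosh is stationary and sinh has slope
  1.\<close>

lemma rotation_derivatives:
  fixes a b y
  defines "r \<equiv> rotation a b y" and "d \<equiv> rotation_velocity a b y"
  shows "((\<lambda>s. cubic (r (of_real s) i) (r (of_real s) j) (r (of_real s) k)) has_vector_derivative
      cubic (d i) (y j) (y k) + cubic (y i) (d j) (y k) + cubic (y i) (y j) (d k)) (at 0)" (is ?cubic)
    and "((\<lambda>s. \<beta> (r (of_real s) i) w) has_vector_derivative \<beta> (d i) w) (at 0)" (is ?linear)
proof -
  define c where "c i z = (if i = a \<or> i = b then cosh z else 1 :: complex)" for i z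
  have c0: "c i 0 = 1" for i by (simp add: c_def)
  have c: "(c i has_field_derivative 0) (at 0)" for i
  proof (cases "i = a \<or> i = b")
    case True
    have "(cosh has_field_derivative (0::complex)) (at 0)"
      by (auto intro!: derivative_eq_intros)
    moreover have "c i = cosh" using True by (auto simp: c_def)
    ultimately show ?thesis by simp
  next
    case False
    then have "c i = (\<lambda>_. 1)" by (auto simp: c_def)
    then show ?thesis by simp
  qed
  have r: "r z i = c i z *\<^sub>C y i + sinh z *\<^sub>C d i" for z i
    by (simp add: r_def d_def rotation_def c_def)
  have "((\<lambda>z. cubic (r z i) (r z j) (r z k)) has_field_derivative
      cubic (d i) (y j) (y k) + cubic (y i) (d j) (y k) + cubic (y i) (y j) (d k)) (at (of_real 0))"
    unfolding r cubic_linear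
    by (auto intro!: derivative_eq_intros c simp: c0 algebra_simps)
  then show ?cubic by (rule has_vector_derivative_real_field)
  have "((\<lambda>z. \<beta> (r z i) w) has_field_derivative \<beta> (d i) w) (at (of_real 0))"
    unfolding r form_linear
    by (auto intro!: derivative_eq_intros c simp: c0)
  then show ?linear by (rule has_vector_derivative_real_field)
qed

text \<open>The energy along the rotation of \<open>y a\<close> and \<open>y b\<close> has a minimum
  at 0. By alternation the three slots of the tensor contribute equally, whence the factor 3; the
  coercive term has a single slot.\<close>

lemma energy_minimiser_critical:
  assumes y: "orthonormal_basis \<beta> n y"
    and min: "\<And>z. orthonormal_basis \<beta> n z \<Longrightarrow> energy \<epsilon> y \<le> energy \<epsilon> z"
    and ab: "a < n" "b < n"
  shows "3 * Im (cubic_gram y a b) + \<epsilon> * Im (gram y a b) = 0"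
proof (cases "a = b")
  case True
  have "Im (cubic_gram y a a) = 0" "Im (gram y a a) = 0"
    using cnj_cubic_gram [of y a a] cnj_gram [of y a a] by (simp_all add: complex_eq_iff)
  then show ?thesis using True by simp
next
  case False
  define d where "d = rotation_velocity a b y"
  define r where "r s = rotation a b y (of_real s)" for s :: real
  let ?m = "\<lambda>i j k. cubic (y i) (y j) (y k)"
  let ?D = "\<lambda>i j k. cubic (d i) (y j) (y k) + cubic (y i) (d j) (y k) + cubic (y i) (y j) (d k)"
  have r0: "r 0 i = y i" for i
    by (simp add: r_def rotation_def scaleC_one)
  have der: "((\<lambda>s. (cmod (cubic (r s i) (r s j) (r s k)))\<^sup>2) has_real_derivative
      2 * Re (cnj (?m i j k) * ?D i j k)) (at 0)"
    "((\<lambda>s. (cmod (\<beta> (r s i) w))\<^sup>2) has_real_derivative 2 * Re (cnj (\<beta> (y i) w) * \<beta> (d i) w)) (at 0)"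
    for i j k w
    using has_real_derivative_cmod_square [OF rotation_derivatives(1) [of a b y i j k]]
      has_real_derivative_cmod_square [OF rotation_derivatives(2) [of a b y i w]]
    unfolding r_def [symmetric] d_def [symmetric] r0 .
  have "((\<lambda>s. energy \<epsilon> (r s)) has_real_derivative
      (\<Sum>i<n. \<Sum>j<n. \<Sum>k<n. 2 * Re (cnj (?m i j k) * ?D i j k))
        + \<epsilon> * (\<Sum>i<n. \<Sum>c<n. 2 * Re (cnj (\<beta> (y i) (x c)) * \<beta> (d i) (x c)))) (at 0)"
    unfolding energy_def by (intro DERIV_add DERIV_cmult DERIV_sum der)
  moreover have "energy \<epsilon> (r 0) \<le> energy \<epsilon> (r s)" for s
  proof -
    have "r 0 = y" using r0 by blast
    then show ?thesis using min orthonormal_rotation [OF y ab False] by (simp add: r_def)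
  qed
  ultimately have zero: "(\<Sum>i<n. \<Sum>j<n. \<Sum>k<n. 2 * Re (cnj (?m i j k) * ?D i j k))
        + \<epsilon> * (\<Sum>i<n. \<Sum>c<n. 2 * Re (cnj (\<beta> (y i) (x c)) * \<beta> (d i) (x c))) = 0"
    by (intro DERIV_local_min [of _ _ 0 1]) auto
  have two: "(\<Sum>i<n. if i = a then P else if i = b then Q else 0) = P + Q" for P Q :: complex
  proof -
    have "(\<Sum>i<n. if i = a then P else if i = b then Q else 0)
        = (\<Sum>i<n. (if i = a then P else 0) + (if i = b then Q else 0))"
      by (rule sum.cong) (use False in auto)
    then show ?thesis using ab by (simp add: sum.distrib)
  qed
  let ?S = "\<Sum>i<n. \<Sum>j<n. \<Sum>k<n. cnj (?m i j k) * cubic (d i) (y j) (y k)"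
  have S2: "(\<Sum>i<n. \<Sum>j<n. \<Sum>k<n. cnj (?m i j k) * cubic (y i) (d j) (y k)) = ?S"
  proof -
    have "cnj (?m j i k) * cubic (y j) (d i) (y k) = cnj (?m i j k) * cubic (d i) (y j) (y k)" for i j k
      by (subst cubic_swap [of "y j" "y i"], subst cubic_swap [of "y j" "d i"]) simp
    then show ?thesis by (subst sum.swap) (simp only:)
  qed
  have S3: "(\<Sum>i<n. \<Sum>j<n. \<Sum>k<n. cnj (?m i j k) * cubic (y i) (y j) (d k)) = ?S"
  proof -
    have "(\<Sum>i<n. \<Sum>j<n. \<Sum>k<n. cnj (?m i j k) * cubic (y i) (y j) (d k))
        = (\<Sum>i<n. \<Sum>j<n. \<Sum>k<n. cnj (?m i j k) * cubic (y i) (d j) (y k))"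
    proof (rule sum.cong [OF refl], subst sum.swap)
      fix i
      have "cnj (?m i k j) * cubic (y i) (y k) (d j) = cnj (?m i j k) * cubic (y i) (d j) (y k)" for j k
        by (subst cubic_swap' [of "y i" "y k" "y j"], subst cubic_swap' [of "y i" "y k" "d j"]) simp
      then show "(\<Sum>j<n. \<Sum>k<n. cnj (?m i k j) * cubic (y i) (y k) (d j))
          = (\<Sum>j<n. \<Sum>k<n. cnj (?m i j k) * cubic (y i) (d j) (y k))"
        by (simp only:)
    qed
    then show ?thesis using S2 by simp
  qed
  \<comment> \<open>By Hermitian symmetry this is 2 \<open>Im (cubic_gram y a b)\<close>, so the
    variation sees only the imaginary part. The same happens for \<open>gram\<close> below.\<close>
  have S: "?S = \<i> * (cubic_gram y b a - cubic_gram y a b)"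
  proof -
    have "?S = (\<Sum>i<n. if i = a then \<i> * cubic_gram y b a else if i = b then - \<i> * cubic_gram y a b else 0)"
      by (rule sum.cong [OF refl])
        (simp add: d_def rotation_velocity_def cubic_linear cubic_minus cubic_gram_def sum_distrib_left mult_ac sum_negf)
    then show ?thesis unfolding two by (simp add: algebra_simps)
  qed
  have L: "(\<Sum>i<n. \<Sum>c<n. cnj (\<beta> (y i) (x c)) * \<beta> (d i) (x c)) = \<i> * (gram y b a - gram y a b)"
  proof -
    have "(\<Sum>i<n. \<Sum>c<n. cnj (\<beta> (y i) (x c)) * \<beta> (d i) (x c))
        = (\<Sum>i<n. if i = a then \<i> * gram y b a else if i = b then - \<i> * gram y a b else 0)"
      by (rule sum.cong [OF refl])
        (simp add: d_def rotation_velocity_def form_linear gram_def sum_distrib_left mult_ac sum_negf)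
    then show ?thesis unfolding two by (simp add: algebra_simps)
  qed
  have "(\<Sum>i<n. \<Sum>j<n. \<Sum>k<n. 2 * Re (cnj (?m i j k) * ?D i j k))
      = 2 * Re (\<Sum>i<n. \<Sum>j<n. \<Sum>k<n. cnj (?m i j k) * ?D i j k)"
    by (simp only: Re_sum sum_distrib_left)
  also have "(\<Sum>i<n. \<Sum>j<n. \<Sum>k<n. cnj (?m i j k) * ?D i j k) = 3 * ?S"
    using S2 S3 by (simp only: distrib_left sum.distrib) simp
  finally have e1: "(\<Sum>i<n. \<Sum>j<n. \<Sum>k<n. 2 * Re (cnj (?m i j k) * ?D i j k)) = 2 * Re (3 * ?S)" .
  have e2: "(\<Sum>i<n. \<Sum>c<n. 2 * Re (cnj (\<beta> (y i) (x c)) * \<beta> (d i) (x c)))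
      = 2 * Re (\<Sum>i<n. \<Sum>c<n. cnj (\<beta> (y i) (x c)) * \<beta> (d i) (x c))"
    by (simp only: Re_sum sum_distrib_left)
  show ?thesis
    using zero unfolding e1 e2 S L cnj_cubic_gram [of y a b, symmetric] cnj_gram [of y a b, symmetric]
    by (simp add: algebra_simps)
qed

section \<open>The moment map identity\<close>

definition frame_tensor :: "(nat \<Rightarrow> 'a) \<Rightarrow> nat list \<Rightarrow> complex"
  where "frame_tensor y w = (case w of [i, j, k] \<Rightarrow> cubic (y i) (y j) (y k) | _ \<Rightarrow> 0)"

definition ad_matrix :: "(nat \<Rightarrow> 'a) \<Rightarrow> 'a \<Rightarrow> nat \<Rightarrow> nat \<Rightarrow> complex"
  where "ad_matrix y u i j = \<beta> (lie_bracket u (y j)) (y i)"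

text \<open>Entry \<open>c\<close> of H applied to the reference coordinates of \<open>w\<close>.
  The reference basis stays fixed while frames run to infinity, so these matrices can be rescaled
  and compared.\<close>

definition gram_functional :: "(nat \<Rightarrow> 'a) \<Rightarrow> nat \<Rightarrow> 'a \<Rightarrow> complex"
  where "gram_functional y c w = (\<Sum>l<n. cnj (\<beta> (y l) (x c)) * \<beta> (y l) w)"

lemma ad_matrix_antisym: "ad_matrix y u j i = - ad_matrix y u i j"
  unfolding ad_matrix_def form_bracket
  by (subst lie_anticommute) (simp add: form_linear)

lemma ad_matrix_expand:
  assumes "orthonormal_basis \<beta> n y"
  shows "(\<Sum>l<n. ad_matrix y u i l *\<^sub>C y l) = - lie_bracket u (y i)"
proof (rule eq_by_coordinates [OF assms])
  fix j assume "j < n"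
  have "\<beta> (\<Sum>l<n. ad_matrix y u i l *\<^sub>C y l) (y j) = (\<Sum>l<n. if l = j then ad_matrix y u i l else 0)"
    unfolding form_linear by (rule sum.cong) (use orthonormal [OF assms] \<open>j < n\<close> in auto)
  also have "\<dots> = ad_matrix y u i j" using \<open>j < n\<close> by simp
  also have "\<dots> = - ad_matrix y u j i" by (rule ad_matrix_antisym)
  finally show "\<beta> (\<Sum>l<n. ad_matrix y u i l *\<^sub>C y l) (y j) = \<beta> (- lie_bracket u (y i)) (y j)"
    by (simp add: ad_matrix_def form_linear)
qed

lemma words_3_cases:
  assumes "w \<in> words {..<n} 3"
  obtains "w = []" | i where "w = [i]" | i j where "w = [i, j]"
    | i j k where "w = [i, j, k]" "i < n" "j < n" "k < n"
proof -
  have "length w \<le> 3" "set w \<subseteq> {..<n}" using assms by (auto simp: words_def)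
  then have "w = [] \<or> (\<exists>i. w = [i]) \<or> (\<exists>i j. w = [i, j])
      \<or> (\<exists>i j k. w = [i, j, k] \<and> i < n \<and> j < n \<and> k < n)"
    by (auto simp: le_Suc_eq numeral_3_eq_3 length_Suc_conv)
  then show thesis using that by blast
qed

text \<open>Antisymmetry of the adjoint matrix turns its rows into minus brackets, so this is
  invariance of \<open>cubic\<close> with the sign reversed.\<close>

lemma frame_tensor_invariant:
  assumes y: "orthonormal_basis \<beta> n y" and w: "w \<in> words {..<n} 3"
  shows "word_act {..<n} (ad_matrix y u) (frame_tensor y) w = 0"
  using w
proof (cases rule: words_3_cases)
  case (4 i j k)
  have "word_act {..<n} (ad_matrix y u) (frame_tensor y) w
      = cubic (\<Sum>l<n. ad_matrix y u i l *\<^sub>C y l) (y j) (y k)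
        + cubic (y i) (\<Sum>l<n. ad_matrix y u j l *\<^sub>C y l) (y k)
        + cubic (y i) (y j) (\<Sum>l<n. ad_matrix y u k l *\<^sub>C y l)"
    by (simp add: 4(1) frame_tensor_def cubic_linear)
  also have "\<dots> = - (cubic (lie_bracket u (y i)) (y j) (y k) + cubic (y i) (lie_bracket u (y j)) (y k)
      + cubic (y i) (y j) (lie_bracket u (y k)))"
    unfolding ad_matrix_expand [OF y]
    using cubic_linear(2,4,6) [where c = "- 1"] by simp
  finally show ?thesis by (simp add: cubic_invariant)
qed (simp_all add: frame_tensor_def)

lemma sum_frame_tensor:
  "(\<Sum>w\<in>words {..<n} 3. frame_tensor y w * g w)
    = (\<Sum>i<n. \<Sum>j<n. \<Sum>k<n. cubic (y i) (y j) (y k) * g [i, j, k])"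
  by (simp add: numeral_3_eq_3 sum_words_Suc frame_tensor_def)

text \<open>With \<open>\<mu>\<close> the tensor and \<open>A\<close> the matrix of \<open>ad u\<close>, invariance gives \<open>A \<mu> = 0\<close>, so
  \<open>\<parallel>A\<^sup>* \<mu>\<parallel>\<^sup>2 = \<langle>[A, A\<^sup>*] \<mu>, \<mu>\<rangle>\<close>; the right-hand side is linear in the Gram matrix of \<open>\<mu>\<close>, to which
  the critical equation applies.\<close>

lemma moment_identity:
  fixes u
  assumes y: "orthonormal_basis \<beta> n y"
    and crit: "\<And>a b. a < n \<Longrightarrow> b < n \<Longrightarrow> 3 * Im (cubic_gram y a b) + \<epsilon> * Im (gram y a b) = 0"
  defines "A \<equiv> ad_matrix y u"
  shows "(\<Sum>w\<in>words {..<n} 3. (cmod (word_act {..<n} (\<lambda>i j. cnj (A j i)) (frame_tensor y) w))\<^sup>2)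
    = \<epsilon> * ((\<Sum>m<n. \<Sum>c<n. (cmod (\<beta> (lie_bracket u (y m)) (x c)))\<^sup>2)
         - (\<Sum>m<n. \<Sum>c<n. (cmod (gram_functional y c (lie_bracket u (y m))))\<^sup>2))"
proof -
  let ?J = "{..<n}" and ?t = "frame_tensor y"
  define E where "E i j = cnj (A j i)" for i j
  define B where "B = commutator_matrix ?J A E"
  let ?m = "\<lambda>i j k. cubic (y i) (y j) (y k)"
  have A: "A j i = - A i j" for i j
    unfolding A_def by (rule ad_matrix_antisym)
  have E: "E j i = - E i j" for i j
    unfolding E_def by (subst A) simp
  \<comment> \<open>\<open>B\<close> is Hermitian, being the commutator of a matrix with its
    adjoint, and antisymmetric, being a commutator of antisymmetric matrices. So it is purely
    imaginary and pairs to zero with the symmetric real part of a Gram matrix.\<close>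
  have B_anti: "B l i = - B i l" for i l
  proof -
    have "A l j * E j i = E i j * A j l" "E l j * A j i = A i j * E j l" for j
      unfolding A [of l] A [of i] E [of l] E [of i] by (simp_all add: A [of j] E [of j])
    then show ?thesis by (simp add: B_def commutator_matrix_def)
  qed
  have B_herm: "cnj (B i l) = - B i l" for i l
  proof -
    have "cnj (B i l) = B l i"
      by (simp add: B_def commutator_matrix_def E_def mult.commute)
    then show ?thesis by (simp only: B_anti [of l i])
  qed
  have "(\<Sum>w\<in>words ?J 3. complex_of_real ((cmod (word_act ?J E ?t w))\<^sup>2))
      = (\<Sum>w\<in>words ?J 3. word_act ?J E ?t w * cnj (word_act ?J E ?t w))"
    by (simp only: complex_norm_square)
  also have "\<dots> = (\<Sum>w\<in>words ?J 3. ?t w * cnj (word_act ?J A (word_act ?J E ?t) w))"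
    by (rule word_act_adjoint) (simp_all add: E_def)
  also have "\<dots> = (\<Sum>w\<in>words ?J 3. ?t w * cnj (word_act ?J B ?t w))"
  proof (intro sum.cong refl)
    fix w assume w: "w \<in> words ?J 3"
    have "word_act ?J E (word_act ?J A ?t) w = word_act ?J E (\<lambda>_. 0) w"
      by (rule word_act_cong) (use w frame_tensor_invariant [OF y, of _ u] in \<open>auto simp: words_def A_def\<close>)
    also have "\<dots> = 0"
      using word_act_scale [of ?J E 0 "\<lambda>_. 0" w] by simp
    finally show "?t w * cnj (word_act ?J A (word_act ?J E ?t) w) = ?t w * cnj (word_act ?J B ?t w)"
      using word_act_commutator [of ?J A E ?t w] by (simp add: B_def)
  qed
  also have "\<dots> = (\<Sum>i<n. \<Sum>j<n. \<Sum>k<n. ?m i j k * cnj (\<Sum>l<n. B i l * ?m l j k))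
      + (\<Sum>i<n. \<Sum>j<n. \<Sum>k<n. ?m i j k * cnj (\<Sum>l<n. B j l * ?m i l k))
      + (\<Sum>i<n. \<Sum>j<n. \<Sum>k<n. ?m i j k * cnj (\<Sum>l<n. B k l * ?m i j l))"
  proof -
    have "word_act ?J B ?t [i, j, k] = (\<Sum>l<n. B i l * ?m l j k) + (\<Sum>l<n. B j l * ?m i l k)
        + (\<Sum>l<n. B k l * ?m i j l)" for i j k
      by (simp add: frame_tensor_def)
    then show ?thesis
      by (simp only: sum_frame_tensor complex_cnj_add distrib_left sum.distrib)
  qed
  \<comment> \<open>Alternation makes the three slots equal; the resulting 3 is the one in the
    critical equation.\<close>
  also have "(\<Sum>i<n. \<Sum>j<n. \<Sum>k<n. ?m i j k * cnj (\<Sum>l<n. B k l * ?m i j l))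
      = (\<Sum>i<n. \<Sum>j<n. \<Sum>k<n. ?m i j k * cnj (\<Sum>l<n. B j l * ?m i l k))"
  proof (rule sum.cong [OF refl], subst sum.swap)
    fix i
    have "?m i k j * cnj (\<Sum>l<n. B j l * ?m i k l) = ?m i j k * cnj (\<Sum>l<n. B j l * ?m i l k)" for j k
      by (subst cubic_swap' [of "y i" "y k"], subst cubic_swap' [of "y i" "y k"]) (simp add: sum_negf)
    then show "(\<Sum>j<n. \<Sum>k<n. ?m i k j * cnj (\<Sum>l<n. B j l * ?m i k l))
        = (\<Sum>j<n. \<Sum>k<n. ?m i j k * cnj (\<Sum>l<n. B j l * ?m i l k))"
      by (simp only:)
  qed
  also have "(\<Sum>i<n. \<Sum>j<n. \<Sum>k<n. ?m i j k * cnj (\<Sum>l<n. B j l * ?m i l k))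
      = (\<Sum>i<n. \<Sum>j<n. \<Sum>k<n. ?m i j k * cnj (\<Sum>l<n. B i l * ?m l j k))"
  proof -
    have "?m j i k * cnj (\<Sum>l<n. B i l * ?m j l k) = ?m i j k * cnj (\<Sum>l<n. B i l * ?m l j k)" for i j k
      by (subst cubic_swap [of "y j"], subst cubic_swap [of "y j"]) (simp add: sum_negf)
    then show ?thesis by (subst sum.swap) (simp only:)
  qed
  also have "(\<Sum>i<n. \<Sum>j<n. \<Sum>k<n. ?m i j k * cnj (\<Sum>l<n. B i l * ?m l j k))
      = (\<Sum>i<n. \<Sum>l<n. cnj (B i l) * cubic_gram y i l)"
  proof (rule sum.cong [OF refl])
    fix i
    have "(\<Sum>j<n. \<Sum>k<n. ?m i j k * cnj (\<Sum>l<n. B i l * ?m l j k))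
        = (\<Sum>j<n. \<Sum>k<n. \<Sum>l<n. cnj (B i l) * (?m i j k * cnj (?m l j k)))"
      by (simp add: sum_distrib_left mult_ac)
    also have "\<dots> = (\<Sum>j<n. \<Sum>l<n. \<Sum>k<n. cnj (B i l) * (?m i j k * cnj (?m l j k)))"
      by (rule sum.cong [OF refl], rule sum.swap)
    also have "\<dots> = (\<Sum>l<n. \<Sum>j<n. \<Sum>k<n. cnj (B i l) * (?m i j k * cnj (?m l j k)))"
      by (rule sum.swap)
    finally show "(\<Sum>j<n. \<Sum>k<n. ?m i j k * cnj (\<Sum>l<n. B i l * ?m l j k))
        = (\<Sum>l<n. cnj (B i l) * cubic_gram y i l)"
      by (simp only: cubic_gram_def sum_distrib_left)
  qed
  also have "\<dots> = (\<Sum>i<n. \<Sum>l<n. cnj (B i l) * (\<i> * of_real (Im (cubic_gram y i l))))"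
  proof -
    have "(\<Sum>i<n. \<Sum>l<n. cnj (B i l) * of_real (Re (cubic_gram y i l))) = 0"
      using B_anti cnj_cubic_gram [of y]
      by (intro antisymmetric_sum_eq_zero) (metis complex_cnj_minus, metis cnj.simps(1))
    moreover have "cnj (B i l) * cubic_gram y i l = cnj (B i l) * of_real (Re (cubic_gram y i l))
        + cnj (B i l) * (\<i> * of_real (Im (cubic_gram y i l)))" for i l
      by (simp only: distrib_left [symmetric] complex_eq [symmetric])
    ultimately show ?thesis by (simp only: sum.distrib add_0_left)
  qed
  finally have 1: "(\<Sum>w\<in>words ?J 3. complex_of_real ((cmod (word_act ?J E ?t w))\<^sup>2))
      = (\<Sum>i<n. \<Sum>l<n. cnj (B i l) * (\<i> * of_real (3 * Im (cubic_gram y i l))))"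
    by (simp add: sum_distrib_left mult_ac flip: sum.distrib)
  have "\<dots> = (\<Sum>i<n. \<Sum>l<n. cnj (B i l) * (\<i> * of_real (- \<epsilon> * Im (gram y i l))))"
  proof (intro sum.cong refl)
    fix i l assume "i \<in> ?J" "l \<in> ?J"
    then have "3 * Im (cubic_gram y i l) = - \<epsilon> * Im (gram y i l)" using crit [of i l] by simp
    then show "cnj (B i l) * (\<i> * of_real (3 * Im (cubic_gram y i l)))
        = cnj (B i l) * (\<i> * of_real (- \<epsilon> * Im (gram y i l)))" by (simp only:)
  qed
  also have "\<dots> = - \<epsilon> * (\<Sum>i<n. \<Sum>l<n. cnj (B i l) * (\<i> * of_real (Im (gram y i l))))"
    by (simp add: sum_distrib_left mult_ac)
  also have "(\<Sum>i<n. \<Sum>l<n. cnj (B i l) * (\<i> * of_real (Im (gram y i l))))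
      = (\<Sum>i<n. \<Sum>l<n. cnj (B i l) * gram y i l)"
  proof -
    have "(\<Sum>i<n. \<Sum>l<n. cnj (B i l) * of_real (Re (gram y i l))) = 0"
      using B_anti cnj_gram [of y]
      by (intro antisymmetric_sum_eq_zero) (metis complex_cnj_minus, metis cnj.simps(1))
    moreover have "cnj (B i l) * gram y i l = cnj (B i l) * of_real (Re (gram y i l))
        + cnj (B i l) * (\<i> * of_real (Im (gram y i l)))" for i l
      by (simp only: distrib_left [symmetric] complex_eq [symmetric])
    ultimately show ?thesis by (simp only: sum.distrib add_0_left)
  qed
  finally have 2: "(\<Sum>w\<in>words ?J 3. complex_of_real ((cmod (word_act ?J E ?t w))\<^sup>2))
      = \<epsilon> * (\<Sum>i<n. \<Sum>l<n. B i l * gram y i l)"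
    unfolding 1 by (simp add: B_herm sum_negf)
  \<comment> \<open>The two halves of the commutator become norms: A A^H gives the brackets
    \<open>lie_bracket u (y m)\<close> themselves, A^H A gives their images under H.\<close>
  have first: "(\<Sum>i<n. \<Sum>l<n. (\<Sum>j<n. A i j * E j l) * gram y i l)
      = (\<Sum>m<n. \<Sum>c<n. complex_of_real ((cmod (\<beta> (lie_bracket u (y m)) (x c)))\<^sup>2))"
  proof -
    have p: "(\<Sum>i<n. A i j * \<beta> (y i) (x c)) = \<beta> (lie_bracket u (y j)) (x c)" for j c
      unfolding A_def ad_matrix_def by (rule parseval [OF y])
    have "(\<Sum>i<n. \<Sum>l<n. (\<Sum>j<n. A i j * E j l) * gram y i l)
        = (\<Sum>j<n. \<Sum>c<n. \<Sum>i<n. \<Sum>l<n. A i j * E j l * (\<beta> (y i) (x c) * cnj (\<beta> (y l) (x c))))"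
      unfolding gram_def sum_product by (rule sum_swap_pairs)
    also have "\<dots> = (\<Sum>j<n. \<Sum>c<n. (\<Sum>i<n. A i j * \<beta> (y i) (x c)) * cnj (\<Sum>l<n. A l j * \<beta> (y l) (x c)))"
      by (simp add: sum_product E_def mult_ac)
    finally show ?thesis unfolding p complex_norm_square .
  qed
  have second: "(\<Sum>i<n. \<Sum>l<n. (\<Sum>j<n. E i j * A j l) * gram y i l)
      = (\<Sum>m<n. \<Sum>c<n. complex_of_real ((cmod (gram_functional y c (lie_bracket u (y m))))\<^sup>2))"
  proof -
    have g: "(\<Sum>l<n. A j l * cnj (\<beta> (y l) (x c))) = - gram_functional y c (lie_bracket u (y j))" for j c
    proof -
      have "A j l = - \<beta> (y l) (lie_bracket u (y j))" for l
        by (metis A A_def ad_matrix_def form_sym)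
      then show ?thesis by (simp add: gram_functional_def sum_negf mult.commute)
    qed
    have "(\<Sum>i<n. \<Sum>l<n. (\<Sum>j<n. E i j * A j l) * gram y i l)
        = (\<Sum>j<n. \<Sum>c<n. \<Sum>i<n. \<Sum>l<n. E i j * A j l * (\<beta> (y i) (x c) * cnj (\<beta> (y l) (x c))))"
      unfolding gram_def sum_product by (rule sum_swap_pairs)
    also have "\<dots> = (\<Sum>j<n. \<Sum>c<n. cnj (\<Sum>i<n. A j i * cnj (\<beta> (y i) (x c))) * (\<Sum>l<n. A j l * cnj (\<beta> (y l) (x c))))"
      unfolding cnj_sum sum_product E_def by (simp add: mult_ac)
    finally show ?thesis
      unfolding g complex_norm_square by (simp only: complex_cnj_minus minus_mult_minus mult.commute)
  qed
  have B: "(\<Sum>i<n. \<Sum>l<n. B i l * gram y i l) = (\<Sum>i<n. \<Sum>l<n. (\<Sum>j<n. A i j * E j l) * gram y i l)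
      - (\<Sum>i<n. \<Sum>l<n. (\<Sum>j<n. E i j * A j l) * gram y i l)"
    by (simp only: B_def commutator_matrix_def left_diff_distrib sum_subtractf)
  have "complex_of_real (\<Sum>w\<in>words ?J 3. (cmod (word_act ?J E ?t w))\<^sup>2)
    = complex_of_real (\<epsilon> * ((\<Sum>m<n. \<Sum>c<n. (cmod (\<beta> (lie_bracket u (y m)) (x c)))\<^sup>2)
         - (\<Sum>m<n. \<Sum>c<n. (cmod (gram_functional y c (lie_bracket u (y m))))\<^sup>2)))"
    by (simp only: of_real_sum of_real_mult of_real_diff 2 B first second)
  moreover have "E = (\<lambda>i j. cnj (A j i))" by (intro ext) (simp add: E_def)
  ultimately show ?thesis by (simp only: of_real_eq_iff)
qed

section \<open>Degeneration of rescaled Gram matrices\<close>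

definition frame_size :: "(nat \<Rightarrow> 'a) \<Rightarrow> real"
  where "frame_size y = (\<Sum>i<n. \<Sum>a<n. (cmod (\<beta> (y i) (x a)))\<^sup>2)"

lemma frame_size_nonneg: "0 \<le> frame_size y"
  by (simp add: frame_size_def sum_nonneg)

text \<open>In matrix form w^H H w = |Y w|^2. It expresses the right-hand side of the bracket bound
  through H, so that the bound survives rescaling.\<close>

lemma gram_functional_self:
  "(\<Sum>c<n. cnj (\<beta> w (x c)) * gram_functional y c w) = of_real (\<Sum>m<n. (cmod (\<beta> (y m) w))\<^sup>2)"
proof -
  have "(\<Sum>c<n. cnj (\<beta> w (x c)) * gram_functional y c w)
      = (\<Sum>m<n. \<Sum>c<n. \<beta> (y m) w * cnj (\<beta> (y m) (x c) * \<beta> (x c) w))"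
    unfolding gram_functional_def sum_distrib_left
    by (subst sum.swap) (simp add: mult_ac form_sym [of w])
  also have "\<dots> = (\<Sum>m<n. \<beta> (y m) w * cnj (\<beta> (y m) w))"
    by (simp only: parseval [OF basis] flip: sum_distrib_left cnj_sum)
  finally show ?thesis by (simp only: of_real_sum complex_norm_square)
qed

lemma gram_functional_trace: "(\<Sum>c<n. gram_functional y c (x c)) = of_real (frame_size y)"
proof -
  have "(\<Sum>c<n. gram_functional y c (x c)) = (\<Sum>i<n. \<Sum>c<n. \<beta> (y i) (x c) * cnj (\<beta> (y i) (x c)))"
    unfolding gram_functional_def by (subst sum.swap) (simp only: mult.commute)
  then show ?thesis by (simp only: frame_size_def of_real_sum complex_norm_square)
qed

lemma gram_functional_expand:
  "gram_functional y c w = (\<Sum>d<n. \<beta> w (x d) * gram_functional y c (x d))"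
proof -
  have "(\<Sum>d<n. \<beta> w (x d) * gram_functional y c (x d))
      = (\<Sum>l<n. cnj (\<beta> (y l) (x c)) * (\<Sum>d<n. \<beta> w (x d) * \<beta> (x d) (y l)))"
    unfolding gram_functional_def sum_distrib_left
    by (subst sum.swap) (simp add: mult_ac form_sym [of "y _"])
  also have "\<dots> = gram_functional y c w"
    unfolding parseval [OF basis] gram_functional_def by (simp only: form_sym [of w])
  finally show ?thesis ..
qed

text \<open>The left side of the moment identity is a sum of squares; so, summed over the frame, the
  images of brackets under H are no larger than the brackets. Expanding \<open>w\<close> in the
  frame and Cauchy-Schwarz give the rest. The factor \<epsilon> has been divided out, so the bound
  is uniform as \<epsilon> \<rightarrow> 0.\<close>

lemma gram_functional_bracket_bound:
  assumes y: "orthonormal_basis \<beta> n y" and \<epsilon>: "\<epsilon> > 0"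
    and crit: "\<And>a b. a < n \<Longrightarrow> b < n \<Longrightarrow> 3 * Im (cubic_gram y a b) + \<epsilon> * Im (gram y a b) = 0"
  shows "(\<Sum>c<n. (cmod (gram_functional y c (lie_bracket u w)))\<^sup>2)
    \<le> (\<Sum>m<n. (cmod (\<beta> (y m) w))\<^sup>2)
        * (frame_size y * (\<Sum>a<n. \<Sum>c<n. (cmod (\<beta> (lie_bracket u (x a)) (x c)))\<^sup>2))"
proof -
  let ?P = "\<Sum>m<n. (cmod (\<beta> (y m) w))\<^sup>2"
  have "0 \<le> \<epsilon> * ((\<Sum>m<n. \<Sum>c<n. (cmod (\<beta> (lie_bracket u (y m)) (x c)))\<^sup>2)
         - (\<Sum>m<n. \<Sum>c<n. (cmod (gram_functional y c (lie_bracket u (y m))))\<^sup>2))"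
    using moment_identity [of y \<epsilon> u, OF y crit] by (metis (no_types, lifting) sum_nonneg zero_le_power2)
  then have mom: "(\<Sum>m<n. \<Sum>c<n. (cmod (gram_functional y c (lie_bracket u (y m))))\<^sup>2)
      \<le> (\<Sum>m<n. \<Sum>c<n. (cmod (\<beta> (lie_bracket u (y m)) (x c)))\<^sup>2)"
    using \<epsilon> by (simp add: zero_le_mult_iff)
  have g: "gram_functional y c (lie_bracket u w) = (\<Sum>m<n. \<beta> (y m) w * gram_functional y c (lie_bracket u (y m)))" for c
  proof -
    have "lie_bracket u w = (\<Sum>m<n. \<beta> w (y m) *\<^sub>C lie_bracket u (y m))"
      by (subst orthonormal_expand [OF form y, of w]) (simp only: bracket_linear)
    then have "gram_functional y c (lie_bracket u w)
        = (\<Sum>l<n. \<Sum>m<n. cnj (\<beta> (y l) (x c)) * (\<beta> w (y m) * \<beta> (y l) (lie_bracket u (y m))))"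
      by (simp only: gram_functional_def form_linear sum_distrib_left)
    also have "\<dots> = (\<Sum>m<n. \<Sum>l<n. cnj (\<beta> (y l) (x c)) * (\<beta> w (y m) * \<beta> (y l) (lie_bracket u (y m))))"
      by (rule sum.swap)
    finally show ?thesis
      by (simp add: gram_functional_def sum_distrib_left mult_ac form_sym [of w])
  qed
  have "(\<Sum>c<n. (cmod (gram_functional y c (lie_bracket u w)))\<^sup>2)
      \<le> (\<Sum>c<n. ?P * (\<Sum>m<n. (cmod (gram_functional y c (lie_bracket u (y m))))\<^sup>2))"
    unfolding g by (intro sum_mono cmod_sum_mult_square_le)
  also have "\<dots> = ?P * (\<Sum>m<n. \<Sum>c<n. (cmod (gram_functional y c (lie_bracket u (y m))))\<^sup>2)"
    unfolding sum_distrib_left by (rule sum.swap)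
  also have "\<dots> \<le> ?P * (\<Sum>m<n. \<Sum>c<n. (cmod (\<beta> (lie_bracket u (y m)) (x c)))\<^sup>2)"
    by (intro mult_left_mono mom sum_nonneg) auto
  also have "\<dots> \<le> ?P * (frame_size y * (\<Sum>a<n. \<Sum>c<n. (cmod (\<beta> (lie_bracket u (x a)) (x c)))\<^sup>2))"
  proof (intro mult_left_mono)
    have e: "\<beta> (lie_bracket u (y m)) (x c) = (\<Sum>a<n. \<beta> (y m) (x a) * \<beta> (lie_bracket u (x a)) (x c))" for m c
      by (subst orthonormal_expand [OF form basis, of "y m"]) (simp only: bracket_linear form_linear)
    have "(\<Sum>m<n. \<Sum>c<n. (cmod (\<beta> (lie_bracket u (y m)) (x c)))\<^sup>2)
        \<le> (\<Sum>m<n. \<Sum>c<n. (\<Sum>a<n. (cmod (\<beta> (y m) (x a)))\<^sup>2) * (\<Sum>a<n. (cmod (\<beta> (lie_bracket u (x a)) (x c)))\<^sup>2))"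
      unfolding e by (intro sum_mono cmod_sum_mult_square_le)
    also have "\<dots> = frame_size y * (\<Sum>c<n. \<Sum>a<n. (cmod (\<beta> (lie_bracket u (x a)) (x c)))\<^sup>2)"
      unfolding frame_size_def sum_product ..
    finally show "(\<Sum>m<n. \<Sum>c<n. (cmod (\<beta> (lie_bracket u (y m)) (x c)))\<^sup>2)
        \<le> frame_size y * (\<Sum>a<n. \<Sum>c<n. (cmod (\<beta> (lie_bracket u (x a)) (x c)))\<^sup>2)"
      by (subst sum.swap)
  qed (auto intro: sum_nonneg)
  finally show ?thesis .
qed

text \<open>An entry of a positive Hermitian matrix is at most its trace, so division by
  \<open>frame_size\<close>, the trace of H, leaves bounded matrices.\<close>

lemma cmod_gram_functional_le:
  assumes "c < n" "d < n"
  shows "cmod (gram_functional y c (x d)) \<le> frame_size y"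
proof -
  have fs: "(\<Sum>l<n. (cmod (\<beta> (y l) (x a)))\<^sup>2) \<le> frame_size y" if "a < n" for a
    unfolding frame_size_def
    by (intro sum_mono member_le_sum [of a "{..<n}" "\<lambda>a. (cmod (\<beta> (y _) (x a)))\<^sup>2"]) (use that in auto)
  have "(cmod (gram_functional y c (x d)))\<^sup>2
      \<le> (\<Sum>l<n. (cmod (cnj (\<beta> (y l) (x c))))\<^sup>2) * (\<Sum>l<n. (cmod (\<beta> (y l) (x d)))\<^sup>2)"
    unfolding gram_functional_def by (rule cmod_sum_mult_square_le)
  also have "\<dots> \<le> frame_size y * frame_size y"
    using fs [OF assms(1)] fs [OF assms(2)] by (intro mult_mono) (auto intro: sum_nonneg frame_size_nonneg)
  finally have "(cmod (gram_functional y c (x d)))\<^sup>2 \<le> (frame_size y)\<^sup>2"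
    by (simp only: power2_eq_square)
  then show ?thesis by (rule power2_le_imp_le [OF _ frame_size_nonneg])
qed

text \<open>Y is complex orthogonal, so H times its complex conjugate is the identity: large
  eigenvalues come with small ones, and a rescaled limit of escaping H must be singular.\<close>

lemma gram_functional_inverse:
  assumes y: "orthonormal_basis \<beta> n y" and ce: "c < n" "e < n"
  shows "(\<Sum>d<n. cnj (gram_functional y d (x e)) * gram_functional y c (x d)) = (if c = e then 1 else 0)"
proof -
  have "(\<Sum>d<n. cnj (gram_functional y d (x e)) * gram_functional y c (x d))
      = (\<Sum>d<n. \<Sum>m<n. \<Sum>l<n. \<beta> (y m) (x d) * cnj (\<beta> (y m) (x e)) * (cnj (\<beta> (y l) (x c)) * \<beta> (y l) (x d)))"
    by (simp add: gram_functional_def sum_product)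
  also have "\<dots> = (\<Sum>m<n. \<Sum>l<n. \<Sum>d<n. \<beta> (y m) (x d) * cnj (\<beta> (y m) (x e)) * (cnj (\<beta> (y l) (x c)) * \<beta> (y l) (x d)))"
    by (subst sum.swap) (intro sum.cong refl sum.swap)
  also have "\<dots> = (\<Sum>m<n. \<Sum>l<n. cnj (\<beta> (y m) (x e)) * cnj (\<beta> (y l) (x c)) * (\<Sum>d<n. \<beta> (y m) (x d) * \<beta> (x d) (y l)))"
    by (simp add: sum_distrib_left mult_ac form_sym [of "x _" "y _"])
  also have "\<dots> = (\<Sum>m<n. \<Sum>l<n. if l = m then cnj (\<beta> (y m) (x e)) * cnj (\<beta> (y m) (x c)) else 0)"
    unfolding parseval [OF basis]
    by (intro sum.cong refl) (auto simp: orthonormal [OF y])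
  also have "\<dots> = cnj (\<Sum>m<n. \<beta> (x e) (y m) * \<beta> (y m) (x c))"
    by (simp add: form_sym [of "x e"])
  finally show ?thesis
    unfolding parseval [OF y] using ce by (auto simp: orthonormal [OF basis])
qed

text \<open>If minimisers escape to infinity, the kernel of the limit of their rescaled Gram matrices
  is an ideal.\<close>

lemma escaping_frames_not_simple:
  assumes simple: "simple_lie_algebra TYPE('a)"
    and Z: "\<And>K. orthonormal_basis \<beta> n (Z K)" and big: "\<And>K. frame_size (Z K) > real K"
    and bound: "\<And>K u w. (\<Sum>c<n. (cmod (gram_functional (Z K) c (lie_bracket u w)))\<^sup>2)
    \<le> (\<Sum>m<n. (cmod (\<beta> (Z K m) w))\<^sup>2)
        * (frame_size (Z K) * (\<Sum>a<n. \<Sum>c<n. (cmod (\<beta> (lie_bracket u (x a)) (x c)))\<^sup>2))"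
  shows False
proof -
  define s where "s K = frame_size (Z K)" for K
  have s: "s K > 0" for K using big [of K] of_nat_0_le_iff [of K, where ?'a = real] unfolding s_def by linarith
  have "\<exists>r l. strict_mono (r :: nat \<Rightarrow> nat) \<and> (\<forall>p\<in>{..<n} \<times> {..<n}.
      (\<lambda>K. gram_functional (Z (r K)) (fst p) (x (snd p)) / of_real (s (r K))) \<longlonglongrightarrow> l p)"
  proof (rule convergent_subsequence_coordinates)
    have "cmod (gram_functional (Z K) c (x d) / of_real (s K)) \<le> 1" if "c < n" "d < n" for c d K
      using cmod_gram_functional_le [OF that, of "Z K"] s [of K] by (simp add: norm_divide s_def)
    then show "bounded (range (\<lambda>K. gram_functional (Z K) (fst p) (x (snd p)) / of_real (s K)))"
      if "p \<in> {..<n} \<times> {..<n}" for p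
      using that by (auto simp: bounded_iff intro!: exI [of _ 1])
  qed simp
  then obtain r l where r: "strict_mono (r :: nat \<Rightarrow> nat)"
    and l: "\<And>c d. c < n \<Longrightarrow> d < n \<Longrightarrow>
      (\<lambda>K. gram_functional (Z (r K)) c (x d) / of_real (s (r K))) \<longlonglongrightarrow> l (c, d)"
    by auto
  have inv_s: "(\<lambda>K. 1 / s (r K)) \<longlonglongrightarrow> 0"
  proof (rule tendsto_sandwich [OF _ _ tendsto_const lim_inverse_n'])
    show "\<forall>\<^sub>F K in sequentially. 0 \<le> 1 / s (r K)"
      by (intro always_eventually allI) (simp add: s less_imp_le)
    show "\<forall>\<^sub>F K in sequentially. 1 / s (r K) \<le> 1 / real K"
    proof (rule eventually_mono [OF eventually_gt_at_top [of 0]])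
      fix K :: nat assume "0 < K"
      moreover have "real K \<le> s (r K)"
        using big [of "r K"] seq_suble [OF r, of K] unfolding s_def by linarith
      ultimately show "1 / s (r K) \<le> 1 / real K" by (intro divide_left_mono mult_pos_pos) (auto simp: s)
    qed
  qed
  define G where "G c w = (\<Sum>d<n. \<beta> w (x d) * l (c, d))" for c w
  have G: "(\<lambda>K. gram_functional (Z (r K)) c w / of_real (s (r K))) \<longlonglongrightarrow> G c w" if "c < n" for c w
    unfolding G_def
    by (subst gram_functional_expand, unfold sum_divide_distrib times_divide_eq_right [symmetric])
      (intro tendsto_sum tendsto_mult tendsto_const l that, auto)
  \<comment> \<open>The kernel of the limit L of H / trace H.\<close>
  define J where "J = {w. \<forall>c<n. G c w = 0}"
  have "lie_ideal J"
    unfolding lie_ideal_def complex_vector.subspace_def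
  proof (intro conjI ballI allI)
    fix u w assume w: "w \<in> J"
    let ?b = "\<Sum>a<n. \<Sum>c<n. (cmod (\<beta> (lie_bracket u (x a)) (x c)))\<^sup>2"
    \<comment> \<open>Divided by the square of trace H, the bracket bound keeps a single factor w^H
      (H / trace H) w, which tends to 0 for \<open>w\<close> in the kernel.\<close>
    have P: "(\<lambda>K. Re (\<Sum>c<n. cnj (\<beta> w (x c)) * (gram_functional (Z (r K)) c w / of_real (s (r K))))) \<longlonglongrightarrow> 0"
    proof -
      have "(\<lambda>K. Re (\<Sum>c<n. cnj (\<beta> w (x c)) * (gram_functional (Z (r K)) c w / of_real (s (r K)))))
          \<longlonglongrightarrow> Re (\<Sum>c<n. cnj (\<beta> w (x c)) * G c w)"
        by (intro tendsto_Re tendsto_sum tendsto_mult tendsto_const G) auto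
      then show ?thesis using w by (simp add: J_def)
    qed
    have "G c (lie_bracket u w) = 0" if c: "c < n" for c
    proof -
      have le: "(cmod (gram_functional (Z (r K)) c (lie_bracket u w) / of_real (s (r K))))\<^sup>2
          \<le> Re (\<Sum>c<n. cnj (\<beta> w (x c)) * (gram_functional (Z (r K)) c w / of_real (s (r K)))) * ?b" for K
      proof -
        have "(cmod (gram_functional (Z (r K)) c (lie_bracket u w)))\<^sup>2
            \<le> (\<Sum>c<n. (cmod (gram_functional (Z (r K)) c (lie_bracket u w)))\<^sup>2)"
          by (rule member_le_sum [of c "{..<n}" "\<lambda>c. (cmod (gram_functional (Z (r K)) c (lie_bracket u w)))\<^sup>2"])
            (use c in auto)
        also note bound [of "r K" u w]
        finally have "(cmod (gram_functional (Z (r K)) c (lie_bracket u w)))\<^sup>2 / (s (r K))\<^sup>2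
            \<le> (\<Sum>m<n. (cmod (\<beta> (Z (r K) m) w))\<^sup>2) * (s (r K) * ?b) / (s (r K))\<^sup>2"
          unfolding s_def by (rule divide_right_mono) simp
        also have "\<dots> = (\<Sum>m<n. (cmod (\<beta> (Z (r K) m) w))\<^sup>2) / s (r K) * ?b"
          using s [of "r K"] by (simp add: power2_eq_square)
        also have "(\<Sum>m<n. (cmod (\<beta> (Z (r K) m) w))\<^sup>2) / s (r K)
            = Re ((\<Sum>c<n. cnj (\<beta> w (x c)) * gram_functional (Z (r K)) c w) / of_real (s (r K)))"
          unfolding gram_functional_self by simp
        finally show ?thesis
          using s [of "r K"] by (simp add: norm_divide power_divide sum_divide_distrib)
      qed
      have "(\<lambda>K. (cmod (gram_functional (Z (r K)) c (lie_bracket u w) / of_real (s (r K))))\<^sup>2)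
          \<longlonglongrightarrow> (cmod (G c (lie_bracket u w)))\<^sup>2"
        by (intro tendsto_power tendsto_norm G c)
      moreover have "(\<lambda>K. Re (\<Sum>c<n. cnj (\<beta> w (x c)) * (gram_functional (Z (r K)) c w / of_real (s (r K)))) * ?b)
          \<longlonglongrightarrow> 0 * ?b"
        by (intro tendsto_mult tendsto_const P)
      ultimately have "(cmod (G c (lie_bracket u w)))\<^sup>2 \<le> 0 * ?b"
        by (rule LIMSEQ_le) (use le in blast)
      then show ?thesis by simp
    qed
    then show "lie_bracket u w \<in> J" by (simp add: J_def)
  qed (auto simp: J_def G_def form_linear distrib_right sum.distrib mult.assoc simp flip: sum_distrib_left)
  then have J: "J = {0} \<or> J = UNIV"
    using simple unfolding simple_lie_algebra_def by blast
  \<comment> \<open>The limit keeps trace 1, so L is not zero and its kernel is proper.\<close>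
  have trace: "(\<Sum>c<n. l (c, c)) = 1"
  proof -
    have "(\<lambda>K. \<Sum>c<n. gram_functional (Z (r K)) c (x c) / of_real (s (r K))) \<longlonglongrightarrow> (\<Sum>c<n. l (c, c))"
      by (intro tendsto_sum l) auto
    moreover have "(\<Sum>c<n. gram_functional (Z (r K)) c (x c) / of_real (s (r K))) = 1" for K
      unfolding sum_divide_distrib [symmetric] gram_functional_trace s_def [symmetric] using s [of "r K"] by simp
    ultimately show ?thesis by (simp add: LIMSEQ_const_iff)
  qed
  have G_x: "G c (x d) = l (c, d)" if "d < n" for c d
  proof -
    have "G c (x d) = (\<Sum>e<n. if e = d then l (c, e) else 0)"
      unfolding G_def by (rule sum.cong) (use that in \<open>auto simp: orthonormal [OF basis]\<close>)
    then show ?thesis using that by simp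
  qed
  show False
  proof (cases "J = UNIV")
    case True
    have "l (c, c) = 0" if "c < n" for c
    proof -
      have "x c \<in> J" using True by simp
      then show ?thesis using that G_x [of c c] by (simp add: J_def)
    qed
    then show False using trace by simp
  next
    case False
    \<comment> \<open>Column \<open>e\<close> of the complex conjugate of L. As H times its
      conjugate is 1, L times its conjugate is the limit of 1 / (trace H)^2, which is 0; so
      \<open>v e\<close> lies in the kernel. A zero kernel would make the diagonal of L
      vanish.\<close>
    define v where "v e = (\<Sum>d<n. cnj (l (d, e)) *\<^sub>C x d)" for e
    have v: "\<beta> (v e) (x d) = cnj (l (d, e))" if "d < n" for d e
    proof -
      have "\<beta> (v e) (x d) = (\<Sum>a<n. if a = d then cnj (l (a, e)) else 0)"
        unfolding v_def form_linear by (rule sum.cong) (use that in \<open>auto simp: orthonormal [OF basis]\<close>)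
      then show ?thesis using that by simp
    qed
    have "G c (v e) = 0" if ce: "c < n" "e < n" for c e
    proof -
      have "(\<lambda>K. \<Sum>d<n. cnj (gram_functional (Z (r K)) d (x e) / of_real (s (r K)))
            * (gram_functional (Z (r K)) c (x d) / of_real (s (r K))))
          \<longlonglongrightarrow> (\<Sum>d<n. cnj (l (d, e)) * l (c, d))"
        by (intro tendsto_sum tendsto_mult tendsto_cnj l ce) auto
      moreover have "(\<Sum>d<n. cnj (gram_functional (Z (r K)) d (x e) / of_real (s (r K)))
            * (gram_functional (Z (r K)) c (x d) / of_real (s (r K))))
          = of_real (1 / s (r K)) * of_real (1 / s (r K)) * (if c = e then 1 else 0)" for K
        unfolding gram_functional_inverse [OF Z [of "r K"] ce, symmetric]
        by (simp add: sum_divide_distrib)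
      moreover have "(\<lambda>K. of_real (1 / s (r K)) * of_real (1 / s (r K)) * (if c = e then 1 else 0 :: complex))
          \<longlonglongrightarrow> of_real 0 * of_real 0 * (if c = e then 1 else 0)"
        by (intro tendsto_mult tendsto_of_real inv_s tendsto_const)
      ultimately have "(\<Sum>d<n. cnj (l (d, e)) * l (c, d)) = of_real 0 * of_real 0 * (if c = e then 1 else 0)"
        by (auto intro: LIMSEQ_unique)
      then show ?thesis using v by (simp add: G_def)
    qed
    then have "v e = 0" if "e < n" for e
      using J False that by (auto simp: J_def)
    then have "l (e, e) = 0" if "e < n" for e
      using v [of e e] that by (simp add: form_linear)
    then show False using trace by simp
  qed
qed

text \<open>Bounded frames subconverge, and in the limit the \<epsilon> term drops out of the
  critical equation.\<close>

lemma balanced_frame_exists: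
  assumes simple: "simple_lie_algebra TYPE('a)"
  shows "\<exists>y. orthonormal_basis \<beta> n y \<and> (\<forall>a<n. \<forall>b<n. Im (cubic_gram y a b) = 0)"
proof -
  define e where "e N = 1 / real (Suc N)" for N
  have e: "e N > 0" for N by (simp add: e_def)
  have "\<exists>y. orthonormal_basis \<beta> n y \<and> (\<forall>a<n. \<forall>b<n. 3 * Im (cubic_gram y a b) + e N * Im (gram y a b) = 0)" for N
    using energy_minimiser [OF e [of N]] energy_minimiser_critical by metis
  then obtain Y where Y: "\<And>N. orthonormal_basis \<beta> n (Y N)"
    and crit: "\<And>N a b. a < n \<Longrightarrow> b < n \<Longrightarrow> 3 * Im (cubic_gram (Y N) a b) + e N * Im (gram (Y N) a b) = 0"
    by metis
  have "\<exists>B. \<forall>N. frame_size (Y N) \<le> B"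
  proof (rule ccontr)
    assume "\<nexists>B. \<forall>N. frame_size (Y N) \<le> B"
    then have "\<exists>N. frame_size (Y N) > real K" for K by (metis not_le)
    \<comment> \<open>The choice \<open>N\<close> carries no order: the bracket bound is free of
      \<epsilon>, so largeness of the frames alone gives the contradiction.\<close>
    then obtain N where N: "\<And>K. frame_size (Y (N K)) > real K" by metis
    show False
      by (rule escaping_frames_not_simple [OF simple, of "\<lambda>K. Y (N K)"])
        (use Y N gram_functional_bracket_bound [OF Y e crit] in auto)
  qed
  then obtain B where B: "\<And>N. frame_size (Y N) \<le> B" by blast
  have bdd: "cmod (\<beta> (Y N i) (x a)) \<le> sqrt B" if "i < n" "a < n" for N i a
    using coordinate_le_sum [OF that, of "Y N"] B [of N] unfolding frame_size_def
    by (intro real_le_rsqrt) linarith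
  have "\<exists>r y. strict_mono (r :: nat \<Rightarrow> nat) \<and> orthonormal_basis \<beta> n y \<and> frame_limit (\<lambda>N. Y (r N)) y"
    by (rule frame_limit_exists [OF Y]) (rule bdd)
  then obtain r y where r: "strict_mono (r :: nat \<Rightarrow> nat)" and y: "orthonormal_basis \<beta> n y"
    and lim: "frame_limit (\<lambda>N. Y (r N)) y"
    by (elim exE conjE) (rule that)
  have "Im (cubic_gram y a b) = 0" if ab: "a < n" "b < n" for a b
  proof -
    have "(\<lambda>N. 3 * Im (cubic_gram (Y (r N)) a b) + e (r N) * Im (gram (Y (r N)) a b))
        \<longlonglongrightarrow> 3 * Im (cubic_gram y a b) + 0 * Im (gram y a b)"
      unfolding cubic_gram_def gram_def
    proof (intro tendsto_add tendsto_mult tendsto_const tendsto_Im tendsto_sum tendsto_cnj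
        frame_limit_cubic [OF lim] ab)
      show "(\<lambda>N. e (r N)) \<longlonglongrightarrow> 0"
        using LIMSEQ_subseq_LIMSEQ [OF LIMSEQ_inverse_real_of_nat r] by (simp add: o_def e_def inverse_eq_divide)
    qed (use lim ab in \<open>auto simp: frame_limit_def\<close>)
    then show ?thesis by (simp add: crit ab LIMSEQ_const_iff)
  qed
  then show ?thesis using y by blast
qed

section \<open>The Casimir operator\<close>

text \<open>Invariance of \<Sum> \<open>y i\<close> \<otimes> \<open>y i\<close> under the adjoint
  action, tested on an arbitrary bilinear map. It holds because
  \<open>\<beta> (lie_bracket (y i) z) (y j)\<close> is antisymmetric in \<open>i\<close> and
  \<open>j\<close>.\<close>

lemma invariant_tensor:
  fixes B :: "'a \<Rightarrow> 'a \<Rightarrow> 'b::complex_vector"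
  assumes y: "orthonormal_basis \<beta> n y"
    and lin: "\<And>u. complex_linear (B u)" "\<And>v. complex_linear (\<lambda>u. B u v)"
  shows "(\<Sum>i<n. B (y i) (lie_bracket (y i) z)) + (\<Sum>i<n. B (lie_bracket (y i) z) (y i)) = 0"
proof -
  have right: "B u (\<Sum>j<n. c j *\<^sub>C y j) = (\<Sum>j<n. c j *\<^sub>C B u (y j))"
    and left: "B (\<Sum>j<n. c j *\<^sub>C y j) u = (\<Sum>j<n. c j *\<^sub>C B (y j) u)" for u c
  proof -
    interpret R: Modules.module_hom scaleC scaleC "B u"
      using lin by (simp add: Vector_Spaces.linear_def)
    interpret L: Modules.module_hom scaleC scaleC "\<lambda>v. B v u"
      using lin by (simp add: Vector_Spaces.linear_def)
    show "B u (\<Sum>j<n. c j *\<^sub>C y j) = (\<Sum>j<n. c j *\<^sub>C B u (y j))"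
      "B (\<Sum>j<n. c j *\<^sub>C y j) u = (\<Sum>j<n. c j *\<^sub>C B (y j) u)"
      by (simp_all only: R.sum R.scale L.sum L.scale)
  qed
  have anti: "\<beta> (lie_bracket (y i) z) (y j) = - \<beta> (lie_bracket (y j) z) (y i)" for i j
    using cubic_rotate [of "y i" z "y j"] cubic_swap' [of "y j" "y i" z]
    by (simp add: cubic_def) (metis cubic_def cubic_rotate)
  have "(\<Sum>i<n. B (y i) (lie_bracket (y i) z)) = (\<Sum>i<n. \<Sum>j<n. \<beta> (lie_bracket (y i) z) (y j) *\<^sub>C B (y i) (y j))"
    by (subst orthonormal_expand [OF form y, of "lie_bracket _ z"]) (simp only: right)
  moreover have "(\<Sum>i<n. B (lie_bracket (y i) z) (y i))
      = (\<Sum>i<n. \<Sum>j<n. - (\<beta> (lie_bracket (y i) z) (y j) *\<^sub>C B (y i) (y j)))"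
  proof -
    have "(\<Sum>i<n. B (lie_bracket (y i) z) (y i)) = (\<Sum>i<n. \<Sum>j<n. \<beta> (lie_bracket (y i) z) (y j) *\<^sub>C B (y j) (y i))"
      by (subst orthonormal_expand [OF form y, of "lie_bracket _ z"]) (simp only: left)
    also have "\<dots> = (\<Sum>i<n. \<Sum>j<n. \<beta> (lie_bracket (y j) z) (y i) *\<^sub>C B (y i) (y j))"
      by (rule sum.swap)
    finally show ?thesis
      by (subst (asm) anti) simp
  qed
  ultimately show ?thesis by (simp add: sum_negf)
qed

definition casimir :: "(nat \<Rightarrow> 'a) \<Rightarrow> 'a \<Rightarrow> 'a"
  where "casimir y u = (\<Sum>i<n. lie_bracket (y i) (lie_bracket (y i) u))"

lemma casimir_linear: "casimir y (u + v) = casimir y u + casimir y v" "casimir y (c *\<^sub>C u) = c *\<^sub>C casimir y u"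
  "casimir y 0 = 0" "casimir y (\<Sum>i\<in>I. g i) = (\<Sum>i\<in>I. casimir y (g i))"
proof -
  show add: "casimir y (u + v) = casimir y u + casimir y v" for u v
    by (simp add: casimir_def bracket_linear sum.distrib)
  show "casimir y (c *\<^sub>C u) = c *\<^sub>C casimir y u"
    by (simp add: casimir_def bracket_linear complex_vector.scale_sum_right)
  show zero: "casimir y 0 = 0" by (simp add: casimir_def bracket_linear)
  show "casimir y (\<Sum>i\<in>I. g i) = (\<Sum>i\<in>I. casimir y (g i))"
    by (induction I rule: infinite_finite_induct) (simp_all add: add zero)
qed

lemma casimir_commute:
  assumes y: "orthonormal_basis \<beta> n y"
  shows "casimir y (lie_bracket z u) = lie_bracket z (casimir y u)"
proof -
  have "(\<Sum>i<n. lie_bracket (y i) (lie_bracket (lie_bracket (y i) z) u))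
      + (\<Sum>i<n. lie_bracket (lie_bracket (y i) z) (lie_bracket (y i) u)) = 0"
    by (rule invariant_tensor [OF y, of "\<lambda>a b. lie_bracket a (lie_bracket b u)"])
      (simp_all add: complex_linear_iff bracket_linear)
  moreover have "lie_bracket (y i) (lie_bracket (y i) (lie_bracket z u))
      = lie_bracket (y i) (lie_bracket (lie_bracket (y i) z) u)
        + lie_bracket (lie_bracket (y i) z) (lie_bracket (y i) u)
        + lie_bracket z (lie_bracket (y i) (lie_bracket (y i) u))" for i
    by (simp add: lie_derivation [of "y i" z u] lie_derivation [of "y i" z "lie_bracket (y i) u"] lie_add_right add.assoc)
  ultimately show ?thesis
    by (simp add: casimir_def bracket_linear sum.distrib)
qed

text \<open>Schur's argument: an eigenspace of the Casimir operator is an ideal, and over the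
  complex numbers some eigenspace is nonzero.\<close>

lemma casimir_scalar:
  assumes simple: "simple_lie_algebra TYPE('a)" and y: "orthonormal_basis \<beta> n y"
  shows "\<exists>c. \<forall>u. casimir y u = c *\<^sub>C u"
proof -
  obtain a b :: 'a where ab: "lie_bracket a b \<noteq> 0" using simple by (auto simp: simple_lie_algebra_def)
  have "n > 0"
  proof (rule ccontr)
    assume "\<not> n > 0"
    then have "a = 0" using orthonormal_expand [OF form y, of a] by simp
    then show False using ab bracket_zero by simp
  qed
  then obtain v c where v: "\<exists>i<n. v i \<noteq> 0"
    and c: "\<forall>i<n. (\<Sum>j<n. \<beta> (casimir y (y j)) (y i) * v j) = c * v i"
    using complex_matrix_eigenvector [of n "\<lambda>i j. \<beta> (casimir y (y j)) (y i)"] by auto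
  define u where "u = (\<Sum>j<n. v j *\<^sub>C y j)"
  have coord: "\<beta> u (y i) = v i" if "i < n" for i
  proof -
    have "\<beta> u (y i) = (\<Sum>j<n. if j = i then v j else 0)"
      unfolding u_def form_linear by (rule sum.cong) (use orthonormal [OF y] that in auto)
    then show ?thesis using that by simp
  qed
  have "u \<noteq> 0" using v coord form_zero_left by metis
  have eig: "casimir y u = c *\<^sub>C u"
  proof (rule eq_by_coordinates [OF y])
    fix i assume "i < n"
    then show "\<beta> (casimir y u) (y i) = \<beta> (c *\<^sub>C u) (y i)"
      using c coord [of i] by (simp add: u_def casimir_linear form_linear mult.commute)
  qed
  define J where "J = {w. casimir y w = c *\<^sub>C w}"
  have "lie_ideal J"
    by (auto simp: lie_ideal_def complex_vector.subspace_def J_def casimir_linear casimir_commute [OF y]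
        bracket_linear scaleC_add_right scaleC_scaleC mult.commute)
  then have "J = {0} \<or> J = UNIV" using simple by (auto simp: simple_lie_algebra_def)
  moreover have "u \<in> J" using eig by (simp add: J_def)
  ultimately have "J = UNIV" using \<open>u \<noteq> 0\<close> by auto
  then show ?thesis by (auto simp: J_def)
qed

text \<open>The left side is minus the trace of ad \<open>u\<close> ad \<open>v\<close>, so the
  Killing form is \<beta> composed with the Casimir operator. A nonzero Casimir eigenvalue is thus
  nondegeneracy of the Killing form.\<close>

lemma casimir_killing:
  assumes y: "orthonormal_basis \<beta> n y"
  shows "(\<Sum>j<n. \<Sum>k<n. cubic u (y j) (y k) * cubic v (y j) (y k)) = - \<beta> (casimir y u) v"
proof -
  have "\<beta> (lie_bracket (y j) (lie_bracket (y j) u)) v = - \<beta> (lie_bracket (y j) u) (lie_bracket (y j) v)" for j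
    by (subst lie_anticommute) (simp add: form_linear form_bracket)
  then have "- \<beta> (casimir y u) v = (\<Sum>j<n. \<beta> (lie_bracket (y j) u) (lie_bracket (y j) v))"
    by (simp add: casimir_def form_linear sum_negf)
  also have "\<dots> = (\<Sum>j<n. \<Sum>k<n. \<beta> (lie_bracket (y j) u) (y k) * \<beta> (y k) (lie_bracket (y j) v))"
    by (simp only: parseval [OF y])
  also have "\<dots> = (\<Sum>j<n. \<Sum>k<n. cubic u (y j) (y k) * cubic v (y j) (y k))"
    by (intro sum.cong refl, subst cubic_swap [of u], subst cubic_swap [of v])
      (simp add: cubic_def form_sym)
  finally show ?thesis by simp
qed

section \<open>Conjugates of adjoint matrices are adjoint matrices\<close>

lemma bracket_exchange:
  "\<beta> (lie_bracket i l) (lie_bracket m j) - \<beta> (lie_bracket i j) (lie_bracket m l)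
    = \<beta> (lie_bracket l j) (lie_bracket i m)"
proof -
  have "lie_bracket l (lie_bracket m j) - lie_bracket j (lie_bracket m l) = lie_bracket m (lie_bracket l j)"
    using lie_derivation [of l m j] lie_anticommute [of "lie_bracket l m" j] lie_anticommute [of l m]
      lie_minus_right [of j "lie_bracket l m"]
    by (simp add: algebra_simps)
  then have "\<beta> i (lie_bracket l (lie_bracket m j)) - \<beta> i (lie_bracket j (lie_bracket m l))
      = \<beta> i (lie_bracket m (lie_bracket l j))"
    by (simp flip: form_diff)
  moreover have "\<beta> (lie_bracket l j) (lie_bracket i m) = \<beta> i (lie_bracket m (lie_bracket l j))"
    by (subst form_sym) (rule form_bracket)
  ultimately show ?thesis
    by (simp only: form_bracket [of i])
qed

text \<open>By \<open>moment_identity\<close> with \<open>\<epsilon> = 0\<close> the conjugate of an adjoint matrix is a derivation. Contracting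
  the derivation identity with the structure tensor shows that it is inner, up to the factor \<open>c\<close>.\<close>

lemma balanced_conjugate_ad:
  assumes y: "orthonormal_basis \<beta> n y" and bal: "\<And>a b. a < n \<Longrightarrow> b < n \<Longrightarrow> Im (cubic_gram y a b) = 0"
    and c: "\<And>u. casimir y u = - c *\<^sub>C u" and aim: "a < n" "i < n" "m < n"
  shows "c * cnj (cubic (y a) (y i) (y m)) = (\<Sum>k<n. cubic_gram y k a * cubic (y k) (y i) (y m))"
proof -
  let ?f = "\<lambda>i j k. cubic (y i) (y j) (y k)"
  \<comment> \<open>The conjugate transpose of the adjoint matrix of \<open>y a\<close>.\<close>
  define D where "D i l = cnj (?f a i l)" for i l
  have D_anti: "D l i = - D i l" for i l
    unfolding D_def by (subst cubic_swap') simp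
  have der: "(\<Sum>l<n. D i l * ?f l j k) + (\<Sum>l<n. D j l * ?f i l k) + (\<Sum>l<n. D k l * ?f i j l) = 0"
    if "j < n" "k < n" for j k
  proof -
    let ?E = "\<lambda>i j. cnj (ad_matrix y (y a) j i)"
    have "(\<Sum>w\<in>words {..<n} 3. (cmod (word_act {..<n} ?E (frame_tensor y) w))\<^sup>2) = 0"
      using moment_identity [of y 0 "y a", OF y] bal by simp
    moreover have "[i, j, k] \<in> words {..<n} 3" using that aim by (simp add: words_def)
    ultimately have "word_act {..<n} ?E (frame_tensor y) [i, j, k] = 0"
      by (subst (asm) sum_nonneg_eq_0_iff) (auto simp: finite_words)
    moreover have "?E i j = D i j" for i j
      by (simp add: D_def ad_matrix_def cubic_def)
    ultimately show ?thesis by (simp add: frame_tensor_def add.assoc)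
  qed
  \<comment> \<open>Contract with \<open>?f m j k\<close> over \<open>j\<close> and
    \<open>k\<close>: the first slot yields the Killing form, and the other two agree by
    alternation.\<close>
  have "0 = (\<Sum>j<n. \<Sum>k<n. ((\<Sum>l<n. D i l * ?f l j k) + (\<Sum>l<n. D j l * ?f i l k) + (\<Sum>l<n. D k l * ?f i j l)) * ?f m j k)"
    by (simp add: der)
  also have "\<dots> = (\<Sum>j<n. \<Sum>k<n. \<Sum>l<n. D i l * ?f l j k * ?f m j k)
      + (\<Sum>j<n. \<Sum>k<n. \<Sum>l<n. D j l * ?f i l k * ?f m j k)
      + (\<Sum>j<n. \<Sum>k<n. \<Sum>l<n. D k l * ?f i j l * ?f m j k)"
    by (simp only: distrib_right sum.distrib sum_distrib_right)
  also have "(\<Sum>j<n. \<Sum>k<n. \<Sum>l<n. D k l * ?f i j l * ?f m j k) = (\<Sum>j<n. \<Sum>k<n. \<Sum>l<n. D j l * ?f i l k * ?f m j k)"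
  proof -
    have eq: "D j l * ?f i k l * ?f m k j = D j l * ?f i l k * ?f m j k" for j k l
      by (subst cubic_swap' [of "y i"], subst cubic_swap' [of "y m"]) simp
    have "(\<Sum>k<n. \<Sum>j<n. \<Sum>l<n. D k l * ?f i j l * ?f m j k)
        = (\<Sum>j<n. \<Sum>k<n. \<Sum>l<n. D j l * ?f i l k * ?f m j k)"
      by (intro sum.cong refl eq)
    moreover have "(\<Sum>j<n. \<Sum>k<n. \<Sum>l<n. D k l * ?f i j l * ?f m j k)
        = (\<Sum>k<n. \<Sum>j<n. \<Sum>l<n. D k l * ?f i j l * ?f m j k)" by (rule sum.swap)
    ultimately show ?thesis by simp
  qed
  also have "(\<Sum>j<n. \<Sum>k<n. \<Sum>l<n. D i l * ?f l j k * ?f m j k) = c * D i m"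
  proof -
    have "(\<Sum>j<n. \<Sum>k<n. \<Sum>l<n. D i l * ?f l j k * ?f m j k) = (\<Sum>j<n. \<Sum>l<n. \<Sum>k<n. D i l * (?f l j k * ?f m j k))"
      by (rule sum.cong [OF refl], subst sum.swap) (simp only: mult.assoc)
    also have "\<dots> = (\<Sum>l<n. D i l * (\<Sum>j<n. \<Sum>k<n. ?f l j k * ?f m j k))"
      by (subst sum.swap) (simp only: sum_distrib_left)
    also have "\<dots> = (\<Sum>l<n. if l = m then c * D i m else 0)"
      unfolding casimir_killing [OF y] c using aim
      by (intro sum.cong refl) (auto simp: form_linear orthonormal [OF y])
    finally show ?thesis using aim by simp
  qed
  also have "(\<Sum>j<n. \<Sum>k<n. \<Sum>l<n. D j l * ?f i l k * ?f m j k)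
      = (\<Sum>j<n. \<Sum>l<n. D j l * \<beta> (lie_bracket (y i) (y l)) (lie_bracket (y m) (y j)))"
  proof (rule sum.cong [OF refl])
    fix j
    have "(\<Sum>k<n. \<Sum>l<n. D j l * ?f i l k * ?f m j k) = (\<Sum>l<n. \<Sum>k<n. D j l * (\<beta> (lie_bracket (y i) (y l)) (y k) * \<beta> (y k) (lie_bracket (y m) (y j))))"
      by (subst sum.swap) (simp only: cubic_def mult.assoc form_sym [of "y _" "lie_bracket (y m) (y j)"])
    then show "(\<Sum>k<n. \<Sum>l<n. D j l * ?f i l k * ?f m j k)
        = (\<Sum>l<n. D j l * \<beta> (lie_bracket (y i) (y l)) (lie_bracket (y m) (y j)))"
      by (simp only: parseval [OF y] flip: sum_distrib_left)
  qed
  finally have 1: "0 = c * D i m + 2 * (\<Sum>j<n. \<Sum>l<n. D j l * \<beta> (lie_bracket (y i) (y l)) (lie_bracket (y m) (y j)))"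
    by (simp only: mult_2 add.assoc)
  \<comment> \<open>Antisymmetry of \<open>D\<close> turns twice this sum into a difference of two
    pairings, which the Jacobi identity in \<open>bracket_exchange\<close> collapses to one.\<close>
  have "(\<Sum>j<n. \<Sum>l<n. D j l * \<beta> (lie_bracket (y i) (y l)) (lie_bracket (y m) (y j)))
      = (\<Sum>j<n. \<Sum>l<n. D l j * \<beta> (lie_bracket (y i) (y j)) (lie_bracket (y m) (y l)))"
    by (rule sum.swap)
  also have "\<dots> = - (\<Sum>j<n. \<Sum>l<n. D j l * \<beta> (lie_bracket (y i) (y j)) (lie_bracket (y m) (y l)))"
    unfolding sum_negf [symmetric] by (intro sum.cong refl) (subst D_anti, simp)
  finally have "2 * (\<Sum>j<n. \<Sum>l<n. D j l * \<beta> (lie_bracket (y i) (y l)) (lie_bracket (y m) (y j)))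
      = (\<Sum>j<n. \<Sum>l<n. D j l * \<beta> (lie_bracket (y i) (y l)) (lie_bracket (y m) (y j)))
        - (\<Sum>j<n. \<Sum>l<n. D j l * \<beta> (lie_bracket (y i) (y j)) (lie_bracket (y m) (y l)))"
    by simp
  also have "\<dots> = (\<Sum>j<n. \<Sum>l<n. D j l * \<beta> (lie_bracket (y l) (y j)) (lie_bracket (y i) (y m)))"
    by (simp only: bracket_exchange flip: sum_subtractf right_diff_distrib)
  also have "\<dots> = (\<Sum>j<n. \<Sum>l<n. \<Sum>k<n. D j l * (?f l j k * ?f k i m))"
  proof -
    have "\<beta> (lie_bracket (y l) (y j)) (lie_bracket (y i) (y m)) = (\<Sum>k<n. ?f l j k * ?f k i m)" for j l
      unfolding cubic_def form_bracket [of "y _" "y i" "y m"] by (simp only: parseval [OF y])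
    then show ?thesis by (simp only: sum_distrib_left)
  qed
  also have "\<dots> = (\<Sum>k<n. \<Sum>j<n. \<Sum>l<n. D j l * (?f l j k * ?f k i m))"
    by (rule sum_swap_triple)
  also have "\<dots> = (\<Sum>k<n. - (cubic_gram y k a * ?f k i m))"
  proof (rule sum.cong [OF refl])
    fix k
    have "?f l j k = - ?f k j l" for j l
      by (metis cubic_rotate cubic_swap)
    then have "D j l * (?f l j k * ?f k i m) = - (?f k j l * cnj (?f a j l) * ?f k i m)" for j l
      by (simp add: D_def)
    then show "(\<Sum>j<n. \<Sum>l<n. D j l * (?f l j k * ?f k i m)) = - (cubic_gram y k a * ?f k i m)"
      by (simp add: sum_negf cubic_gram_def sum_distrib_right)
  qed
  finally show ?thesis using 1 by (simp add: D_def sum_negf)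
qed

text \<open>\<open>cubic_gram\<close> of a balanced frame is real. If \<open>c\<close> were 0,
  contracting \<open>conj\<close> with the conjugate tensor would therefore make a sum of squares of
  real numbers vanish, and the bracket with it. Dividing by \<open>c\<close> then gives
  \<open>U\<close>.\<close>

lemma self_adjoint_frame_exists:
  assumes simple: "simple_lie_algebra TYPE('a)"
  shows "\<exists>y c U. orthonormal_basis \<beta> n y \<and> c \<noteq> 0 \<and> (\<forall>u. casimir y u = c *\<^sub>C u) \<and>
    (\<forall>a<n. \<forall>i<n. \<forall>m<n. cnj (cubic (y a) (y i) (y m)) = (\<Sum>k<n. U a k * cubic (y k) (y i) (y m)))"
proof -
  obtain y where y: "orthonormal_basis \<beta> n y" and bal: "\<And>a b. a < n \<Longrightarrow> b < n \<Longrightarrow> Im (cubic_gram y a b) = 0"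
    using balanced_frame_exists [OF simple] by blast
  obtain c' where "\<And>u. casimir y u = c' *\<^sub>C u" using casimir_scalar [OF simple y] by blast
  \<comment> \<open>With this sign the contraction in \<open>casimir_killing\<close> is
    \<open>c\<close> times \<beta>; the sign is undone in the witness \<open>- c\<close> at the
    end.\<close>
  then obtain c where c: "\<And>u. casimir y u = - c *\<^sub>C u" by (metis minus_minus)
  have conj: "c * cnj (cubic (y a) (y i) (y m)) = (\<Sum>k<n. cubic_gram y k a * cubic (y k) (y i) (y m))"
    if "a < n" "i < n" "m < n" for a i m
    by (rule balanced_conjugate_ad [OF y]) (use bal c that in auto)
  have "c \<noteq> 0"
  proof
    assume "c = 0"
    have zero: "cubic (y a) (y i) (y m) = 0" if aim: "a < n" "i < n" "m < n" for a i m
    proof -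
      have "0 = (\<Sum>i<n. \<Sum>m<n. (\<Sum>k<n. cubic_gram y k a * cubic (y k) (y i) (y m)) * cnj (cubic (y a) (y i) (y m)))"
        using conj [OF aim(1)] \<open>c = 0\<close> by simp
      also have "\<dots> = (\<Sum>i<n. \<Sum>m<n. \<Sum>k<n. cubic_gram y k a * (cubic (y k) (y i) (y m) * cnj (cubic (y a) (y i) (y m))))"
        by (simp only: sum_distrib_right mult.assoc)
      also have "\<dots> = (\<Sum>k<n. \<Sum>i<n. \<Sum>m<n. cubic_gram y k a * (cubic (y k) (y i) (y m) * cnj (cubic (y a) (y i) (y m))))"
        by (rule sum_swap_triple)
      also have "\<dots> = (\<Sum>k<n. cubic_gram y k a * cubic_gram y k a)"
        by (simp only: cubic_gram_def sum_distrib_left)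
      also have "\<dots> = of_real (\<Sum>k<n. (Re (cubic_gram y k a))\<^sup>2)"
        unfolding of_real_sum using bal aim(1)
        by (intro sum.cong refl) (simp add: complex_eq_iff power2_eq_square)
      finally have "(\<Sum>k<n. (Re (cubic_gram y k a))\<^sup>2) = 0" by (metis of_real_eq_0_iff)
      then have "Re (cubic_gram y a a) = 0"
        using aim by (subst (asm) sum_nonneg_eq_0_iff) auto
      moreover have "cubic_gram y a a = of_real (\<Sum>j<n. \<Sum>k<n. (cmod (cubic (y a) (y j) (y k)))\<^sup>2)"
        by (simp only: cubic_gram_def of_real_sum complex_norm_square)
      ultimately have "(\<Sum>j<n. \<Sum>k<n. (cmod (cubic (y a) (y j) (y k)))\<^sup>2) = 0" by simp
      then have "(\<Sum>k<n. (cmod (cubic (y a) (y i) (y k)))\<^sup>2) = 0"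
        using aim by (subst (asm) sum_nonneg_eq_0_iff) (auto intro: sum_nonneg)
      then show ?thesis
        using aim by (subst (asm) sum_nonneg_eq_0_iff) auto
    qed
    have "lie_bracket u v = 0" for u v :: 'a
    proof (rule eq_by_coordinates [OF y])
      fix m assume m: "m < n"
      have "cubic u v (y m) = cubic (\<Sum>i<n. \<beta> u (y i) *\<^sub>C y i) (\<Sum>i<n. \<beta> v (y i) *\<^sub>C y i) (y m)"
        by (simp flip: orthonormal_expand [OF form y])
      also have "\<dots> = 0" using m by (simp add: cubic_linear zero)
      finally show "\<beta> (lie_bracket u v) (y m) = \<beta> 0 (y m)" by (simp add: cubic_def form_linear)
    qed
    then show False using simple by (auto simp: simple_lie_algebra_def)
  qed
  show ?thesis
  proof (intro exI conjI allI impI)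
    show "orthonormal_basis \<beta> n y" "- c \<noteq> 0" "casimir y u = - c *\<^sub>C u" for u
      using y \<open>c \<noteq> 0\<close> c by auto
    fix a i m assume "a < n" "i < n" "m < n"
    then have "c * cnj (cubic (y a) (y i) (y m)) = (\<Sum>k<n. cubic_gram y k a * cubic (y k) (y i) (y m))"
      by (rule conj)
    then have "cnj (cubic (y a) (y i) (y m)) = (\<Sum>k<n. cubic_gram y k a * cubic (y k) (y i) (y m)) / c"
      using \<open>c \<noteq> 0\<close> by (simp add: field_simps)
    then show "cnj (cubic (y a) (y i) (y m)) = (\<Sum>k<n. (\<lambda>a k. cubic_gram y k a / c) a k * cubic (y k) (y i) (y m))"
      by (simp add: sum_divide_distrib)
  qed
qed

end

section \<open>Lifting invariants to the exterior algebra\<close>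

lemma derivation_linear:
  assumes "derivation D"
  shows "D (a + b) = D a + D b" "D (c *\<^sub>C a) = c *\<^sub>C D a" "D 0 = 0" "D (a - b) = D a - D b"
    "D (- a) = - D a" "D (\<Sum>i\<in>K. g i) = (\<Sum>i\<in>K. D (g i))" "D (a * b) = D a * b + a * D b" "D 1 = 0"
proof -
  interpret Modules.module_hom scaleC scaleC D
    using assms by (simp add: derivation_def Vector_Spaces.linear_def)
  show "D (a + b) = D a + D b" "D (c *\<^sub>C a) = c *\<^sub>C D a" "D 0 = 0" "D (a - b) = D a - D b"
    "D (- a) = - D a" "D (\<Sum>i\<in>K. g i) = (\<Sum>i\<in>K. D (g i))"
    by (rule add scale zero diff neg sum)+
  show "D (a * b) = D a * b + a * D b" using assms by (simp add: derivation_def)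
  show "D 1 = 0" using assms by (rule derivation_one)
qed

lemma ext_deriv_eqI:
  assumes "complex_linear \<phi>" "derivation D" "\<And>v. D (ext_gen v) = ext_gen (\<phi> v)"
  shows "ext_deriv \<phi> a = D a"
  using derivation_unique [OF derivation_ext_deriv [OF assms(1)] assms(2)]
  by (simp add: ext_deriv_gen [OF assms(1)] assms(3))

lemma ext_deriv_add:
  assumes "complex_linear \<phi>" "complex_linear \<psi>"
  shows "ext_deriv (\<lambda>v. \<phi> v + \<psi> v) a = ext_deriv \<phi> a + ext_deriv \<psi> a"
proof (rule ext_deriv_eqI)
  note 1 = derivation_linear [OF derivation_ext_deriv [OF assms(1)]]
    and 2 = derivation_linear [OF derivation_ext_deriv [OF assms(2)]]
  show "complex_linear (\<lambda>v. \<phi> v + \<psi> v)"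
    using assms by (simp add: complex_linear_iff scaleC_add_right)
  show "derivation (\<lambda>a. ext_deriv \<phi> a + ext_deriv \<psi> a)"
    by (simp add: derivation_def complex_linear_iff 1(1,2,7) 2(1,2,7) scaleC_add_right algebra_simps)
qed (simp add: assms ext_deriv_gen ext_gen_add)

lemma ext_deriv_scale:
  assumes "complex_linear \<phi>"
  shows "ext_deriv (\<lambda>v. c *\<^sub>C \<phi> v) a = c *\<^sub>C ext_deriv \<phi> a"
proof (rule ext_deriv_eqI)
  note 1 = derivation_linear [OF derivation_ext_deriv [OF assms(1)]]
  show "complex_linear (\<lambda>v. c *\<^sub>C \<phi> v)"
    using assms by (simp add: complex_linear_iff scaleC_add_right scaleC_scaleC mult.commute)
  show "derivation (\<lambda>a. c *\<^sub>C ext_deriv \<phi> a)"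
    by (simp add: derivation_def complex_linear_iff 1(1,2,7) scaleC_add_right scaleC_scaleC
        scaleC_mult_left scaleC_mult_right mult.commute)
qed (simp add: assms ext_deriv_gen ext_gen_scale)

text \<open>A commutator of derivations is a derivation, and derivations are determined on
  generators, so commutation relations need checking on \<open>'v\<close> only.\<close>

lemma ext_deriv_commutator:
  assumes "complex_linear \<phi>" "complex_linear \<psi>" "complex_linear \<omega>" "\<And>v. \<phi> (\<psi> v) = \<psi> (\<phi> v) + \<omega> v"
  shows "ext_deriv \<phi> (ext_deriv \<psi> a) = ext_deriv \<psi> (ext_deriv \<phi> a) + ext_deriv \<omega> a"
proof -
  note 1 = derivation_linear [OF derivation_ext_deriv [OF assms(1)]]
    and 2 = derivation_linear [OF derivation_ext_deriv [OF assms(2)]]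
  have "ext_deriv \<omega> a = ext_deriv \<phi> (ext_deriv \<psi> a) - ext_deriv \<psi> (ext_deriv \<phi> a)"
  proof (rule ext_deriv_eqI [OF assms(3)])
    show "derivation (\<lambda>a. ext_deriv \<phi> (ext_deriv \<psi> a) - ext_deriv \<psi> (ext_deriv \<phi> a))"
      by (simp add: derivation_def complex_linear_iff 1 2 complex_vector.scale_right_diff_distrib algebra_simps)
  qed (simp add: assms ext_deriv_gen ext_gen_add)
  then show ?thesis by simp
qed

lemma ext_gen_zero: "ext_gen 0 = 0"
  using ext_gen_scale [of 0 0] by simp

lemma ext_gen_sum: "ext_gen (\<Sum>i\<in>K. g i) = (\<Sum>i\<in>K. ext_gen (g i))"
  by (induction K rule: infinite_finite_induct) (simp_all add: ext_gen_zero ext_gen_add)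

definition word_product :: "('j \<Rightarrow> 'v) \<Rightarrow> 'j list \<Rightarrow> 'v::complex_vector exterior"
  where "word_product e w = prod_list (map (\<lambda>i. ext_gen (e i)) w)"

text \<open>The map from truncated noncommutative polynomials to the exterior algebra. It has a
  kernel, so a coefficient function is only a representative.\<close>

definition word_sum :: "'j set \<Rightarrow> ('j \<Rightarrow> 'v) \<Rightarrow> nat \<Rightarrow> ('j list \<Rightarrow> complex) \<Rightarrow> 'v::complex_vector exterior"
  where "word_sum J e m t = (\<Sum>w\<in>words J m. t w *\<^sub>C word_product e w)"

lemma word_sum_linear:
  "word_sum J e m (\<lambda>w. s w + t w) = word_sum J e m s + word_sum J e m t"
  "word_sum J e m (\<lambda>w. s w - t w) = word_sum J e m s - word_sum J e m t"
  "word_sum J e m (\<lambda>w. c * t w) = c *\<^sub>C word_sum J e m t"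
  "word_sum J e m (\<lambda>w. 0) = 0"
  "word_sum J e m (\<lambda>w. \<Sum>k\<in>K. g k w) = (\<Sum>k\<in>K. word_sum J e m (g k))"
proof -
  show "word_sum J e m (\<lambda>w. \<Sum>k\<in>K. g k w) = (\<Sum>k\<in>K. word_sum J e m (g k))"
    unfolding word_sum_def complex_vector.scale_sum_left by (rule sum.swap)
qed (simp_all add: word_sum_def scaleC_add_left sum.distrib complex_vector.scale_sum_right scaleC_scaleC
    complex_vector.scale_left_diff_distrib sum_subtractf)

lemma word_sum_cong:
  "(\<And>w. w \<in> words J m \<Longrightarrow> s w = t w) \<Longrightarrow> word_sum J e m s = word_sum J e m t"
  by (simp add: word_sum_def)

lemma word_sum_Suc:
  assumes "finite J"
  shows "word_sum J e (Suc m) t = t [] *\<^sub>C 1 + (\<Sum>i\<in>J. ext_gen (e i) * word_sum J e m (\<lambda>w. t (i # w)))"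
  by (simp add: word_sum_def sum_words_Suc [OF assms] word_product_def sum_distrib_left scaleC_mult_right)

lemma word_sum_pad:
  assumes "finite J" "m \<le> M"
  shows "word_sum J e m t = word_sum J e M (\<lambda>w. if length w \<le> m then t w else 0)"
  unfolding word_sum_def
  by (rule sum.mono_neutral_cong_left) (use assms in \<open>auto simp: words_def finite_lists_length_le\<close>)

lemma word_sum_surj:
  fixes e :: "'j \<Rightarrow> 'v::complex_vector"
  assumes J: "finite J" and span: "\<And>v. \<exists>c. v = (\<Sum>j\<in>J. c j *\<^sub>C e j)"
  shows "\<exists>m t. r = word_sum J e m t"
proof (induction r rule: exterior_induct)
  case (add a b)
  then obtain m t m' t' where *: "a = word_sum J e m t" "b = word_sum J e m' t'" by blast
  have "a + b = word_sum J e (max m m')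
      (\<lambda>w. (if length w \<le> m then t w else 0) + (if length w \<le> m' then t' w else 0))"
    by (simp only: * word_sum_linear(1) word_sum_pad [OF J max.cobounded1, of e m t m']
        word_sum_pad [OF J max.cobounded2, of e m' t' m])
  then show ?case by blast
next
  case (scale c a)
  then obtain m t where "a = word_sum J e m t" by blast
  then have "c *\<^sub>C a = word_sum J e m (\<lambda>w. c * t w)" by (simp only: word_sum_linear(3))
  then show ?case by blast
next
  case one
  have "1 = word_sum J e 0 (\<lambda>_. 1)" by (simp add: word_sum_def word_product_def scaleC_one)
  then show ?case by blast
next
  case (gen v a)
  then obtain m t where a: "a = word_sum J e m t" by blast
  obtain c where c: "v = (\<Sum>j\<in>J. c j *\<^sub>C e j)" using span by blast
  have "ext_gen v * a = word_sum J e (Suc m) (\<lambda>w. case w of [] \<Rightarrow> 0 | i # w' \<Rightarrow> c i * t w')"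
    unfolding word_sum_Suc [OF J]
    by (simp add: a c ext_gen_zero ext_gen_sum ext_gen_scale word_sum_linear sum_distrib_right scaleC_mult_left scaleC_mult_right)
  then show ?case by blast
qed

text \<open>Columns of \<open>D\<close> describe \<phi> on the family \<open>e\<close>, so
  coefficients transform like coordinates, by summation over the second index. Through this the
  derivation is lifted to words.\<close>

lemma ext_deriv_word_sum:
  fixes e :: "'j \<Rightarrow> 'v::complex_vector"
  assumes J: "finite J" and \<phi>: "complex_linear \<phi>" and D: "\<And>j. j \<in> J \<Longrightarrow> \<phi> (e j) = (\<Sum>i\<in>J. D i j *\<^sub>C e i)"
  shows "ext_deriv \<phi> (word_sum J e m t) = word_sum J e m (word_act J D t)"
proof (induction m arbitrary: t)
  case 0
  show ?case
    by (simp add: word_sum_def word_product_def derivation_linear [OF derivation_ext_deriv [OF \<phi>]])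
next
  case (Suc m)
  note d = derivation_linear [OF derivation_ext_deriv [OF \<phi>]]
  let ?s = "\<lambda>i. word_sum J e m (\<lambda>w. t (i # w))"
  have "ext_deriv \<phi> (word_sum J e (Suc m) t)
      = (\<Sum>j\<in>J. ext_gen (\<phi> (e j)) * ?s j) + (\<Sum>j\<in>J. ext_gen (e j) * word_sum J e m (word_act J D (\<lambda>w. t (j # w))))"
    by (simp add: word_sum_Suc [OF J] d ext_deriv_gen [OF \<phi>] Suc sum.distrib)
  also have "(\<Sum>j\<in>J. ext_gen (\<phi> (e j)) * ?s j) = (\<Sum>j\<in>J. \<Sum>i\<in>J. ext_gen (e i) * (D i j *\<^sub>C ?s j))"
    by (intro sum.cong refl)
      (simp add: D ext_gen_zero ext_gen_sum ext_gen_scale sum_distrib_right scaleC_mult_left scaleC_mult_right)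
  also have "\<dots> = (\<Sum>i\<in>J. ext_gen (e i) * (\<Sum>j\<in>J. D i j *\<^sub>C ?s j))"
    by (subst sum.swap) (simp only: sum_distrib_left)
  finally show ?case
    by (simp add: word_sum_Suc [OF J] word_sum_linear distrib_left sum.distrib)
qed

text \<open>Weyl's unitary trick: if the span of the operators is closed under adjoints, the
  orthogonal complement of a submodule of the words is a submodule.\<close>

lemma invariant_lift:
  fixes e :: "'j \<Rightarrow> 'v::complex_vector" and \<phi> :: "'k \<Rightarrow> 'v \<Rightarrow> 'v"
  assumes J: "finite J" and span: "\<And>v. \<exists>c. v = (\<Sum>j\<in>J. c j *\<^sub>C e j)"
    and \<phi>: "\<And>k. k \<in> K \<Longrightarrow> complex_linear (\<phi> k)"
    and D: "\<And>k j. k \<in> K \<Longrightarrow> j \<in> J \<Longrightarrow> \<phi> k (e j) = (\<Sum>i\<in>J. D k i j *\<^sub>C e i)"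
    and adj: "\<And>k i j. k \<in> K \<Longrightarrow> i \<in> J \<Longrightarrow> j \<in> J \<Longrightarrow> cnj (D k j i) = (\<Sum>l\<in>K. U k l * D l i j)"
    and I: "0 \<in> I" "\<And>a b. a \<in> I \<Longrightarrow> b \<in> I \<Longrightarrow> a + b \<in> I" "\<And>c a. a \<in> I \<Longrightarrow> c *\<^sub>C a \<in> I"
      "\<And>k a. k \<in> K \<Longrightarrow> a \<in> I \<Longrightarrow> ext_deriv (\<phi> k) a \<in> I"
    and r: "\<And>k. k \<in> K \<Longrightarrow> ext_deriv (\<phi> k) r \<in> I"
  shows "\<exists>r'. r - r' \<in> I \<and> (\<forall>k\<in>K. ext_deriv (\<phi> k) r' = 0)"
proof -
  obtain m t where t: "r = word_sum J e m t" using word_sum_surj [OF J span] by blast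
  \<comment> \<open>Since 0 \<in> I, this contains all relations among words, so orthogonality to
    \<open>N\<close> takes care of them as well.\<close>
  define N where "N = {s. word_sum J e m s \<in> I}"
  have N_add: "(\<lambda>w. s w + s' w) \<in> N" if "s \<in> N" "s' \<in> N" for s s'
    using that I by (simp add: N_def word_sum_linear)
  have N_scale: "(\<lambda>w. c * s w) \<in> N" if "s \<in> N" for s c
    using that I by (simp add: N_def word_sum_linear)
  have N_zero: "(\<lambda>w. 0) \<in> N" using I by (simp add: N_def word_sum_linear)
  have N_act: "word_act J (D k) s \<in> N" if "k \<in> K" "s \<in> N" for k s
    using I(4) [OF that(1), of "word_sum J e m s"] that(2)
    by (simp add: N_def ext_deriv_word_sum [OF J \<phi> [OF that(1)] D [OF that(1)]])
  have N_sum: "(\<lambda>w. \<Sum>l\<in>L. g l w) \<in> N" if "\<And>l. l \<in> L \<Longrightarrow> g l \<in> N" for L :: "'k set" and g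
    using that by (induction L rule: infinite_finite_induct) (auto simp: N_zero N_add)
  obtain b where b: "b \<in> N" and perp: "\<And>s. s \<in> N \<Longrightarrow> (\<Sum>w\<in>words J m. (t w - b w) * cnj (s w)) = 0"
    using orthogonal_decomposition [OF finite_words [OF J] N_add N_scale N_zero, of t m] by blast
  define t' where "t' = (\<lambda>w. t w - b w)"
  have r': "word_sum J e m t' = r - word_sum J e m b"
    by (simp add: t'_def word_sum_linear t)
  have "ext_deriv (\<phi> k) (word_sum J e m t') = 0" if k: "k \<in> K" for k
  proof -
    note d = derivation_linear [OF derivation_ext_deriv [OF \<phi> [OF k]]]
    define s where "s = word_act J (D k) t'"
    have ws: "word_sum J e m s = ext_deriv (\<phi> k) (word_sum J e m t')"
      unfolding s_def by (rule ext_deriv_word_sum [OF J \<phi> [OF k] D [OF k], symmetric])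
    have "word_sum J e m s = ext_deriv (\<phi> k) r + (- 1) *\<^sub>C ext_deriv (\<phi> k) (word_sum J e m b)"
      unfolding ws r' d by (simp add: scaleC_one)
    also have "\<dots> \<in> I" using b k by (intro I r) (simp_all add: N_def)
    finally have s: "s \<in> N" by (simp add: N_def)
    \<comment> \<open>The adjoint operator applied to \<open>s\<close>, written by
      \<open>adj\<close> through the given operators. It stays in \<open>N\<close>, to which
      \<open>t'\<close> is orthogonal, so the norm of \<open>s\<close> vanishes: \<open>t'\<close>
      is invariant already as a function on words.\<close>
    define s' where "s' = (\<lambda>w. \<Sum>l\<in>K. U k l * word_act J (D l) s w)"
    have "s' \<in> N" unfolding s'_def by (intro N_sum N_scale N_act s)
    have "(\<Sum>w\<in>words J m. s w * cnj (s w))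
        = (\<Sum>w\<in>words J m. t' w * cnj (word_act J (\<lambda>i j. cnj (D k j i)) s w))"
      unfolding s_def by (rule word_act_adjoint [OF J]) simp
    also have "\<dots> = (\<Sum>w\<in>words J m. t' w * cnj (s' w))"
    proof (intro sum.cong refl)
      fix w assume w: "w \<in> words J m"
      have "word_act J (\<lambda>i j. cnj (D k j i)) s w = word_act J (\<lambda>i j. \<Sum>l\<in>K. U k l * D l i j) s w"
        by (rule word_act_matrix_cong) (use w adj [OF k] in \<open>auto simp: words_def\<close>)
      then show "t' w * cnj (word_act J (\<lambda>i j. cnj (D k j i)) s w) = t' w * cnj (s' w)"
        by (simp only: s'_def word_act_matrix_sum word_act_matrix_scale)
    qed
    also have "\<dots> = 0" unfolding t'_def by (rule perp [OF \<open>s' \<in> N\<close>])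
    finally have "complex_of_real (\<Sum>w\<in>words J m. (cmod (s w))\<^sup>2) = 0"
      by (simp only: of_real_sum complex_norm_square)
    then have "\<forall>w\<in>words J m. s w = 0"
      by (simp only: of_real_eq_0_iff) (simp add: sum_nonneg_eq_0_iff finite_words [OF J])
    then have "word_sum J e m s = word_sum J e m (\<lambda>_. 0)" by (intro word_sum_cong) simp
    then show ?thesis by (simp add: ws word_sum_linear)
  qed
  moreover have "r - word_sum J e m t' \<in> I" using b by (simp add: r' N_def)
  ultimately show ?thesis by blast
qed

section \<open>The action of \<open>sl(2)\<close> on the invariants\<close>

abbreviation sl2_h :: "complex^2^2" where "sl2_h \<equiv> vector [vector [1, 0], vector [0, - 1]]"
abbreviation sl2_e :: "complex^2^2" where "sl2_e \<equiv> vector [vector [0, 1], vector [0, 0]]"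
abbreviation sl2_f :: "complex^2^2" where "sl2_f \<equiv> vector [vector [0, 0], vector [1, 0]]"

lemma mat2_action_basis:
  "mat2_action sl2_h w = (fst w, - snd w)" "mat2_action sl2_e w = (snd w, 0)" "mat2_action sl2_f w = (0, fst w)"
  by (simp_all add: mat2_action_def scaleC_one)

context based_metric_lie_algebra
begin

text \<open>The cross terms of the Casimir operator on a product are sums \<open>\<Sum>\<^sub>i [y\<^sub>i, u] \<and> [y\<^sub>i, v]\<close>, which
  by the Jacobi identity are multiples of the cobracket of \<open>[v, u]\<close>.\<close>

lemma casimir_mod_relations:
  fixes \<iota> :: "'a \<Rightarrow> 'v::complex_vector" and \<pi> :: "'v \<Rightarrow> 'a" and S :: "'v exterior set"
  assumes y: "orthonormal_basis \<beta> n y" and c: "\<And>u. casimir y u = c *\<^sub>C u"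
    and \<iota>: "complex_linear \<iota>" and \<pi>: "complex_linear \<pi>" and \<pi>\<iota>: "\<And>u. \<pi> (\<iota> u) = u"
    and rel: "\<And>z. (\<Sum>i<n. ext_gen (\<iota> (lie_bracket (y i) z)) * ext_gen (\<iota> (y i))) \<in> genideal univ_ring S"
  defines "d \<equiv> \<lambda>i. ext_deriv (\<lambda>w. \<iota> (lie_bracket (y i) (\<pi> w)))"
  shows "(\<Sum>i<n. d i (d i r)) - c *\<^sub>C ext_deriv (\<lambda>w. \<iota> (\<pi> w)) r \<in> genideal univ_ring S"
proof -
  let ?I = "genideal univ_ring S"
  define P where "P u = ext_gen (\<iota> u)" for u
  have P_lin: "P (u + v) = P u + P v" "P (a *\<^sub>C u) = a *\<^sub>C P u" for u v a
    using \<iota> by (simp_all add: P_def complex_linear_iff ext_gen_add ext_gen_scale)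
  have P_sum: "P (\<Sum>i\<in>K. g i) = (\<Sum>i\<in>K. P (g i))" for g and K :: "nat set"
    using P_lin(2) [of 0 0] by (induction K rule: infinite_finite_induct) (simp_all add: P_lin(1))
  have lin: "complex_linear (\<lambda>w. \<iota> (lie_bracket (y i) (\<pi> w)))" for i
    using \<iota> \<pi> by (simp add: complex_linear_iff bracket_linear)
  have lin_e: "complex_linear (\<lambda>w. \<iota> (\<pi> w))"
    using \<iota> \<pi> by (simp add: complex_linear_iff)
  have "derivation (d i)" for i
    unfolding d_def by (rule derivation_ext_deriv [OF lin])
  note d = derivation_linear [OF this]
  note e = derivation_linear [OF derivation_ext_deriv [OF lin_e]]
  have d_gen: "d i (ext_gen v) = P (lie_bracket (y i) (\<pi> v))" for i v
    by (simp add: d_def ext_deriv_gen [OF lin] P_def)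
  have e_gen: "ext_deriv (\<lambda>w. \<iota> (\<pi> w)) (ext_gen v) = P (\<pi> v)" for v
    by (simp add: ext_deriv_gen [OF lin_e] P_def)
  have d_P: "d i (P u) = P (lie_bracket (y i) u)" for i u
    using d_gen [of i "\<iota> u"] by (simp add: \<pi>\<iota> P_def)
  \<comment> \<open>The cross terms that arise when second-order operators meet a product of two
    generators.\<close>
  define X where "X u v = (\<Sum>i<n. P (lie_bracket (y i) u) * P (lie_bracket (y i) v))" for u v
  have X: "X u v \<in> ?I" for u v
  proof -
    have tensor: "X u v + (\<Sum>i<n. P (lie_bracket (lie_bracket (y i) v) u) * P (y i)) = 0" for u v
      unfolding X_def
      by (rule invariant_tensor [OF y, of "\<lambda>a b. P (lie_bracket a u) * P b"])
        (simp_all add: complex_linear_iff bracket_linear P_lin distrib_left distrib_right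
          scaleC_mult_left scaleC_mult_right)
    have "P (lie_bracket (lie_bracket (y i) v) u) = P (lie_bracket (y i) (lie_bracket v u))
        + P (lie_bracket (lie_bracket (y i) u) v)" for i
      by (simp add: lie_derivation [of "y i" v u] lie_anticommute [of v "lie_bracket (y i) u"] flip: P_lin(1))
    then have "X u v + (\<Sum>i<n. P (lie_bracket (y i) (lie_bracket v u)) * P (y i)) - X v u = 0"
      using tensor [of u v] tensor [of v u]
      by (simp add: distrib_right sum.distrib eq_neg_iff_add_eq_0 [symmetric])
    \<comment> \<open>Anticommutation turns \<open>X u v - X v u\<close> into twice
      \<open>X u v\<close>, so the cross term itself, not only its antisymmetrisation, lies in the
      ideal.\<close>
    moreover have "X v u = - X u v"
      unfolding X_def sum_negf [symmetric]
      by (intro sum.cong refl) (simp add: P_def ext_gen_anticommute [of "\<iota> (lie_bracket _ v)"])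
    ultimately have "X u v + X u v = - (\<Sum>i<n. P (lie_bracket (y i) (lie_bracket v u)) * P (y i))"
      by (simp add: eq_neg_iff_add_eq_0 algebra_simps)
    moreover have "X u v = (1 / 2) *\<^sub>C (X u v + X u v)"
      by (simp add: scaleC_add_right scaleC_one flip: scaleC_add_left)
    ultimately have eq: "X u v = (1 / 2) *\<^sub>C (- (\<Sum>i<n. P (lie_bracket (y i) (lie_bracket v u)) * P (y i)))"
      by simp
    show ?thesis
      unfolding eq using rel by (intro univ_genideal_scaleC univ_genideal_uminus) (simp add: P_def)
  qed
  \<comment> \<open>Moving the first factor past \<open>ext_gen v\<close> costs a sign and leaves a
    term \<open>X\<close>; by induction the mixed Leibniz terms vanish modulo the ideal for products
    of any length.\<close>
  have mixed: "(\<Sum>i<n. P (lie_bracket (y i) u) * d i Z) \<in> ?I" for u Z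
  proof (induction Z rule: exterior_induct)
    case (add a b)
    then show ?case by (simp add: d distrib_left sum.distrib univ_genideal_add)
  next
    case (scale c a)
    then show ?case
      by (simp add: d scaleC_mult_right univ_genideal_scaleC flip: complex_vector.scale_sum_right)
  next
    case one
    then show ?case by (simp add: d univ_genideal_zero)
  next
    case (gen v Z)
    have "(\<Sum>i<n. P (lie_bracket (y i) u) * d i (ext_gen v * Z))
        = X u (\<pi> v) * Z + (- ext_gen v) * (\<Sum>i<n. P (lie_bracket (y i) u) * d i Z)"
    proof -
      have "P a * (ext_gen v * b) = - ext_gen v * (P a * b)" for a b
        by (simp add: P_def ext_gen_anticommute [of "\<iota> a" v] flip: mult.assoc)
      then show ?thesis
        by (simp add: d d_gen X_def distrib_left sum.distrib sum_distrib_left sum_distrib_right mult.assoc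
            sum_subtractf sum_negf)
    qed
    then show ?case by (simp only:) (intro univ_genideal_add univ_genideal_r univ_genideal_l X gen)
  qed
  show ?thesis
  proof (induction r rule: exterior_induct)
    case (add a b)
    have "(\<Sum>i<n. d i (d i (a + b))) - c *\<^sub>C ext_deriv (\<lambda>w. \<iota> (\<pi> w)) (a + b)
      = ((\<Sum>i<n. d i (d i a)) - c *\<^sub>C ext_deriv (\<lambda>w. \<iota> (\<pi> w)) a)
        + ((\<Sum>i<n. d i (d i b)) - c *\<^sub>C ext_deriv (\<lambda>w. \<iota> (\<pi> w)) b)"
      by (simp add: d e sum.distrib scaleC_add_right)
    then show ?case using add by (simp only:) (rule univ_genideal_add)
  next
    case (scale k a)
    have "(\<Sum>i<n. d i (d i (k *\<^sub>C a))) - c *\<^sub>C ext_deriv (\<lambda>w. \<iota> (\<pi> w)) (k *\<^sub>C a)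
      = k *\<^sub>C ((\<Sum>i<n. d i (d i a)) - c *\<^sub>C ext_deriv (\<lambda>w. \<iota> (\<pi> w)) a)"
      by (simp add: d e complex_vector.scale_sum_right complex_vector.scale_right_diff_distrib
          scaleC_scaleC mult.commute)
    then show ?case using scale by (simp only:) (rule univ_genideal_scaleC)
  next
    case one
    then show ?case by (simp add: d e univ_genideal_zero)
  next
    case (gen v Z)
    let ?e = "ext_deriv (\<lambda>w. \<iota> (\<pi> w))"
    let ?m = "\<Sum>i<n. P (lie_bracket (y i) (\<pi> v)) * d i Z"
    have cas: "(\<Sum>i<n. P (lie_bracket (y i) (lie_bracket (y i) (\<pi> v)))) = c *\<^sub>C P (\<pi> v)"
      using c [of "\<pi> v"] by (simp add: casimir_def P_lin flip: P_sum)
    have "(\<Sum>i<n. d i (d i (ext_gen v * Z)))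
        = (\<Sum>i<n. P (lie_bracket (y i) (lie_bracket (y i) (\<pi> v)))) * Z + (?m + ?m)
          + ext_gen v * (\<Sum>i<n. d i (d i Z))"
      by (simp add: d d_gen d_P sum.distrib sum_distrib_left sum_distrib_right add_ac)
    then have "(\<Sum>i<n. d i (d i (ext_gen v * Z))) - c *\<^sub>C ?e (ext_gen v * Z)
        = (?m + ?m) + ext_gen v * ((\<Sum>i<n. d i (d i Z)) - c *\<^sub>C ?e Z)"
      unfolding cas
      by (simp add: e e_gen scaleC_mult_left scaleC_mult_right scaleC_add_right right_diff_distrib)
    then show ?case
      by (simp only:) (intro univ_genideal_add univ_genideal_l mixed gen)
  qed
qed

section \<open>Independence of the ideal from the orthonormal basis\<close>

lemma orthonormal_trace:
  fixes B :: "'a \<Rightarrow> 'a \<Rightarrow> 'b::complex_vector"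
  assumes y: "orthonormal_basis \<beta> n y" and z: "orthonormal_basis \<beta> n z"
    and lin: "\<And>u. complex_linear (B u)" "\<And>v. complex_linear (\<lambda>u. B u v)"
  shows "(\<Sum>i<n. B (y i) (y i)) = (\<Sum>i<n. B (z i) (z i))"
proof -
  have right: "B u (\<Sum>j<n. c j *\<^sub>C z j) = (\<Sum>j<n. c j *\<^sub>C B u (z j))"
    and left: "B (\<Sum>j<n. c j *\<^sub>C z j) u = (\<Sum>j<n. c j *\<^sub>C B (z j) u)" for u c
  proof -
    interpret R: Modules.module_hom scaleC scaleC "B u"
      using lin by (simp add: Vector_Spaces.linear_def)
    interpret L: Modules.module_hom scaleC scaleC "\<lambda>v. B v u"
      using lin by (simp add: Vector_Spaces.linear_def)
    show "B u (\<Sum>j<n. c j *\<^sub>C z j) = (\<Sum>j<n. c j *\<^sub>C B u (z j))"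
      "B (\<Sum>j<n. c j *\<^sub>C z j) u = (\<Sum>j<n. c j *\<^sub>C B (z j) u)"
      by (simp_all only: R.sum R.scale L.sum L.scale)
  qed
  have "B (y i) (y i) = (\<Sum>b<n. \<Sum>a<n. (\<beta> (z a) (y i) * \<beta> (y i) (z b)) *\<^sub>C B (z a) (z b))" for i
  proof -
    have "B (y i) (y i) = B (\<Sum>a<n. \<beta> (y i) (z a) *\<^sub>C z a) (\<Sum>b<n. \<beta> (y i) (z b) *\<^sub>C z b)"
      by (simp flip: orthonormal_expand [OF form z])
    then show ?thesis
      by (simp add: left right complex_vector.scale_sum_right scaleC_scaleC mult.commute form_sym [of "y i"])
  qed
  then have "(\<Sum>i<n. B (y i) (y i)) = (\<Sum>i<n. \<Sum>b<n. \<Sum>a<n. (\<beta> (z a) (y i) * \<beta> (y i) (z b)) *\<^sub>C B (z a) (z b))"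
    by (rule sum.cong [OF refl])
  also have "\<dots> = (\<Sum>b<n. \<Sum>a<n. \<Sum>i<n. (\<beta> (z a) (y i) * \<beta> (y i) (z b)) *\<^sub>C B (z a) (z b))"
    by (rule sum_swap_triple [symmetric])
  also have "\<dots> = (\<Sum>b<n. \<Sum>a<n. if a = b then B (z b) (z b) else 0)"
    unfolding complex_vector.scale_sum_left [symmetric] parseval [OF y]
    by (intro sum.cong refl) (auto simp: orthonormal [OF z] scaleC_one)
  finally show ?thesis by simp
qed

text \<open>Cyclic symmetry makes the first index the coordinate of a bracket, so one of the two
  sums is an expansion in the basis.\<close>

lemma cobracket_sum:
  assumes y: "orthonormal_basis \<beta> n y" and f: "structure_constants n y f"
    and P: "complex_linear P" and k: "k < n"
  shows "(\<Sum>i<n. \<Sum>j<n. f i j k *\<^sub>C (P (y i) * Q (y j))) = (\<Sum>j<n. P (lie_bracket (y j) (y k)) * Q (y j) :: 'v::complex_vector exterior)"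
proof -
  interpret P: Modules.module_hom scaleC scaleC P
    using P by (simp add: Vector_Spaces.linear_def)
  have f_eq: "f i j k = \<beta> (lie_bracket (y j) (y k)) (y i)" if "i < n" "j < n" for i j
    using structure_constants_eq [OF form y f that k] cubic_rotate by (simp add: cubic_def)
  have "(\<Sum>i<n. \<Sum>j<n. f i j k *\<^sub>C (P (y i) * Q (y j)))
      = (\<Sum>j<n. \<Sum>i<n. \<beta> (lie_bracket (y j) (y k)) (y i) *\<^sub>C (P (y i) * Q (y j)))"
    by (subst sum.swap) (simp add: f_eq)
  also have "\<dots> = (\<Sum>j<n. P (\<Sum>i<n. \<beta> (lie_bracket (y j) (y k)) (y i) *\<^sub>C y i) * Q (y j))"
    by (simp add: P.sum P.scale sum_distrib_right scaleC_mult_left)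
  finally show ?thesis by (simp flip: orthonormal_expand [OF form y])
qed

lemma cobracket_in_A_ideal:
  assumes y: "orthonormal_basis \<beta> n y" and f: "structure_constants n y f"
    and P: "complex_linear P"
    and rel: "\<And>k. k < n \<Longrightarrow> (\<Sum>i<n. \<Sum>j<n. f i j k *\<^sub>C (P (y i) * Q (y j))) \<in> A_relations n y f"
  shows "(\<Sum>j<n. P (lie_bracket (y j) z) * Q (y j)) \<in> A_ideal n y f"
proof -
  interpret P: Modules.module_hom scaleC scaleC P
    using P by (simp add: Vector_Spaces.linear_def)
  have "(\<Sum>j<n. P (lie_bracket (y j) z) * Q (y j))
      = (\<Sum>j<n. \<Sum>k<n. \<beta> z (y k) *\<^sub>C (P (lie_bracket (y j) (y k)) * Q (y j)))"
    by (subst orthonormal_expand [OF form y, of z])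
      (simp add: bracket_linear P.sum P.scale sum_distrib_right scaleC_mult_left)
  also have "\<dots> = (\<Sum>k<n. \<beta> z (y k) *\<^sub>C (\<Sum>j<n. P (lie_bracket (y j) (y k)) * Q (y j)))"
    by (subst sum.swap) (simp add: complex_vector.scale_sum_right)
  finally show ?thesis
    unfolding A_ideal_def
    by (simp only:)
      (intro univ_genideal_sum univ_genideal_scaleC univ_genideal_incl,
        use rel cobracket_sum [OF y f P] in auto)
qed

text \<open>The relations involve the basis only through \<Sum> \<open>y i\<close> \<otimes>
  \<open>y i\<close>, which is the same for all orthonormal bases. This permits passing from the
  given \<open>x\<close> to the frame found by minimisation.\<close>

lemma A_ideal_subset_basis_change:
  assumes y: "orthonormal_basis \<beta> n y" and f: "structure_constants n y f"
    and z: "orthonormal_basis \<beta> n z" and g: "structure_constants n z g"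
  shows "A_ideal n y f \<subseteq> A_ideal n z g"
proof -
  have main: "(\<Sum>i<n. \<Sum>j<n. f i j k *\<^sub>C (P (y i) * Q (y j))) \<in> A_ideal n z g"
    if P: "complex_linear P" and Q: "complex_linear Q" and k: "k < n"
      and rel: "\<And>k. k < n \<Longrightarrow> (\<Sum>i<n. \<Sum>j<n. g i j k *\<^sub>C (P (z i) * Q (z j))) \<in> A_relations n z g"
    for P Q k
  proof -
    have "(\<Sum>j<n. P (lie_bracket (y j) (y k)) * Q (y j)) = (\<Sum>j<n. P (lie_bracket (z j) (y k)) * Q (z j))"
      by (rule orthonormal_trace [OF y z, of "\<lambda>a b. P (lie_bracket a (y k)) * Q b"])
        (use P Q in \<open>simp_all add: complex_linear_iff bracket_linear distrib_left distrib_right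
          scaleC_mult_left scaleC_mult_right\<close>)
    then show ?thesis
      unfolding cobracket_sum [OF y f P k] using cobracket_in_A_ideal [OF z g P rel] by simp
  qed
  have "A_relations n y f \<subseteq> A_ideal n z g"
    unfolding A_relations_def
    using complex_linear_copies
    by (auto intro!: main, auto simp: A_relations_def)
  moreover have "ideal (A_ideal n z g) univ_ring"
    by (auto simp: ideal_univ_ring_iff A_ideal_def univ_genideal_zero univ_genideal_add
        univ_genideal_l univ_genideal_r)
  ultimately show ?thesis
    using univ_genideal_minimal unfolding A_ideal_def [of n y f] by blast
qed

lemma structure_constants_cubic:
  assumes y: "orthonormal_basis \<beta> n y"
  shows "structure_constants n y (\<lambda>i j k. cubic (y i) (y j) (y k))"
  unfolding structure_constants_def cubic_def
  by (intro allI impI orthonormal_expand [OF form y])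

section \<open>The Cartan element, then all of sl(2)\<close>

lemma sl2_h_kills_invariants:
  assumes y: "orthonormal_basis \<beta> n y" and f: "structure_constants n y f"
    and c: "c \<noteq> 0" "\<And>u. casimir y u = c *\<^sub>C u"
    and U: "\<And>a i m. a < n \<Longrightarrow> i < n \<Longrightarrow> m < n \<Longrightarrow>
      cnj (cubic (y a) (y i) (y m)) = (\<Sum>k<n. U a k * cubic (y k) (y i) (y m))"
    and r: "\<And>z. ext_deriv (ad2 z) r \<in> A_ideal n y f"
  shows "ext_deriv (mat2_action sl2_h) r \<in> A_ideal n y f"
proof -
  let ?I = "A_ideal n y f"
  let ?h = "ext_deriv (mat2_action sl2_h) :: ('a \<times> 'a) exterior \<Rightarrow> _"
  \<comment> \<open>\<open>True\<close> marks the first copy and \<open>False\<close> the second;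
    the adjoint matrices are block diagonal.\<close>
  define J where "J = (UNIV :: bool set) \<times> {..<n}"
  define e where "e p = (if fst p then (y (snd p), 0) else (0, y (snd p)))" for p :: "bool \<times> nat"
  define D where "D k p q = (if fst p = fst q then cubic (y k) (y (snd q)) (y (snd p)) else 0)"
    for k and p q :: "bool \<times> nat"
  have sum_J: "(\<Sum>p\<in>J. g p) = (\<Sum>i<n. g (True, i)) + (\<Sum>i<n. g (False, i))" for g :: "_ \<Rightarrow> 'a \<times> 'a"
    by (simp add: J_def sum.cartesian_product' UNIV_bool add.commute)
  have span: "\<exists>s. v = (\<Sum>p\<in>J. s p *\<^sub>C e p)" for v :: "'a \<times> 'a"
  proof
    show "v = (\<Sum>p\<in>J. (if fst p then \<beta> (fst v) (y (snd p)) else \<beta> (snd v) (y (snd p))) *\<^sub>C e p)"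
      unfolding sum_J
      by (rule prod_eqI)
        (simp_all add: e_def scaleC_prod_def fst_sum snd_sum flip: orthonormal_expand [OF form y])
  qed
  have "\<exists>r'. r - r' \<in> ?I \<and> (\<forall>k\<in>{..<n}. ext_deriv (ad2 (y k)) r' = 0)"
  \<comment> \<open>\<open>U\<close> relates matrices with row and column exchanged, which by
    alternation changes the sign.\<close>
  proof (rule invariant_lift [where J = J and e = e and D = D and U = "\<lambda>k l. - U k l"])
    show "finite J" by (simp add: J_def)
    show "ad2 (y k) (e q) = (\<Sum>p\<in>J. D k p q *\<^sub>C e p)" if "k \<in> {..<n}" "q \<in> J" for k q
      unfolding sum_J
      by (rule prod_eqI; cases "fst q")
        (simp_all add: e_def D_def ad2_def bracket_linear scaleC_prod_def fst_sum snd_sum cubic_def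
          flip: orthonormal_expand [OF form y])
    show "cnj (D k q p) = (\<Sum>l<n. - U k l * D l p q)" if "k \<in> {..<n}" "p \<in> J" "q \<in> J" for k p q
    proof (cases "fst p = fst q")
      case True
      have "cnj (D k q p) = (\<Sum>l<n. U k l * cubic (y l) (y (snd p)) (y (snd q)))"
        using that True U by (simp add: D_def J_def mem_Times_iff)
      also have "\<dots> = (\<Sum>l<n. - U k l * cubic (y l) (y (snd q)) (y (snd p)))"
        by (intro sum.cong refl, subst cubic_swap') simp
      finally show ?thesis using True by (simp add: D_def)
    qed (simp add: D_def)
    show "ext_deriv (ad2 (y k)) a \<in> ?I" if "a \<in> ?I" for k a
      using A_ideal_lie_action [OF form y f that] .
  qed (use span r complex_linear_ad2 in
      \<open>auto simp: A_ideal_def univ_genideal_zero univ_genideal_add univ_genideal_scaleC\<close>)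
  then obtain r' where r': "r - r' \<in> ?I" "\<And>k. k < n \<Longrightarrow> ext_deriv (ad2 (y k)) r' = 0" by auto
  define d1 where "d1 i = ext_deriv (\<lambda>w :: 'a \<times> 'a. (lie_bracket (y i) (fst w), 0 :: 'a))" for i
  define d2 where "d2 i = ext_deriv (\<lambda>w :: 'a \<times> 'a. (0 :: 'a, lie_bracket (y i) (snd w)))" for i
  define e1 where "e1 = ext_deriv (\<lambda>w :: 'a \<times> 'a. (fst w, 0 :: 'a))"
  define e2 where "e2 = ext_deriv (\<lambda>w :: 'a \<times> 'a. (0 :: 'a, snd w))"
  have lin: "complex_linear (\<lambda>w :: 'a \<times> 'a. (lie_bracket (y i) (fst w), 0 :: 'a))"
    "complex_linear (\<lambda>w :: 'a \<times> 'a. (0 :: 'a, lie_bracket (y i) (snd w)))"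
    "complex_linear (\<lambda>w :: 'a \<times> 'a. (fst w, 0 :: 'a))" "complex_linear (\<lambda>w :: 'a \<times> 'a. (0 :: 'a, snd w))"
    "complex_linear (fst :: 'a \<times> 'a \<Rightarrow> _)" "complex_linear (snd :: 'a \<times> 'a \<Rightarrow> _)"
    "complex_linear (\<lambda>u :: 'a. (u, 0 :: 'a))" "complex_linear (\<lambda>u :: 'a. (0 :: 'a, u))"
    "complex_linear (\<lambda>w :: 'a \<times> 'a. 0 :: 'a \<times> 'a)" for i
    by (simp_all add: complex_linear_iff scaleC_prod_def bracket_linear zero_prod_def)
  \<comment> \<open>The two embeddings of \<open>'a\<close> into pairs give the Casimir operators of
    the single copies; each reduces to its degree operator by the relations within that
    copy.\<close>
  have cas1: "(\<Sum>i<n. d1 i (d1 i r')) - c *\<^sub>C e1 r' \<in> ?I"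
    using casimir_mod_relations [OF y c(2) lin(7) lin(5), of "A_relations n y f" r']
      cobracket_in_A_ideal [OF y f complex_linear_copies(1), of copy1]
    by (auto simp: A_ideal_def A_relations_def d1_def e1_def)
  have cas2: "(\<Sum>i<n. d2 i (d2 i r')) - c *\<^sub>C e2 r' \<in> ?I"
    using casimir_mod_relations [OF y c(2) lin(8) lin(6), of "A_relations n y f" r']
      cobracket_in_A_ideal [OF y f complex_linear_copies(2), of copy2]
    by (auto simp: A_ideal_def A_relations_def d2_def e2_def)
  have split: "d1 i a + d2 i a = ext_deriv (ad2 (y i)) a" for i a
    using ext_deriv_add [OF lin(1) lin(2), of i i a] by (simp add: d1_def d2_def ad2_def [abs_def])
  have comm: "d1 i (d2 i a) = d2 i (d1 i a)" for i a
    using ext_deriv_commutator [OF lin(1) lin(2) lin(9), of i i a]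
      ext_deriv_scale [OF lin(9), of 0 a]
    by (simp add: d1_def d2_def bracket_linear zero_prod_def)
  have neg: "d1 i r' = - d2 i r'" "d2 i r' = - d1 i r'" if "i < n" for i
    using split [of i r'] r'(2) [OF that] by (simp_all add: eq_neg_iff_add_eq_0 add.commute)
  \<comment> \<open>\<open>d1 i r'\<close> need not be invariant, so \<open>d1 i\<close> is commuted
    past \<open>d2 i\<close> and \<open>neg\<close> is applied to \<open>r'\<close> itself both
    times. Here \<open>r'\<close> has to be invariant in R and not just modulo the ideal, which
    \<open>d1 i\<close> need not preserve.\<close>
  have "d1 i (d1 i r') = d2 i (d2 i r')" if "i < n" for i
  proof -
    have "d1 i (d1 i r') = - d1 i (d2 i r')"
      using neg(1) [OF that] derivation_linear(5) [OF derivation_ext_deriv [OF lin(1)]]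
      by (simp add: d1_def)
    also have "\<dots> = - d2 i (d1 i r')" by (simp only: comm)
    also have "\<dots> = d2 i (d2 i r')"
      using neg(2) [OF that] derivation_linear(5) [OF derivation_ext_deriv [OF lin(2)]]
      by (simp add: d2_def)
    finally show ?thesis .
  qed
  then have "c *\<^sub>C (e1 r' - e2 r')
      = ((\<Sum>i<n. d2 i (d2 i r')) - c *\<^sub>C e2 r') - ((\<Sum>i<n. d1 i (d1 i r')) - c *\<^sub>C e1 r')"
    by (simp add: complex_vector.scale_right_diff_distrib)
  also have "\<dots> \<in> ?I"
    using cas1 cas2 unfolding A_ideal_def by (rule univ_genideal_diff [rotated])
  finally have "inverse c *\<^sub>C c *\<^sub>C (e1 r' - e2 r') \<in> ?I"
    unfolding A_ideal_def by (rule univ_genideal_scaleC)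
  then have "e1 r' - e2 r' \<in> ?I" using c(1) by (simp add: scaleC_scaleC scaleC_one)
  moreover have "?h r' = e1 r' - e2 r'"
  proof -
    have "mat2_action sl2_h = (\<lambda>w :: 'a \<times> 'a. (fst w, 0) + (- 1) *\<^sub>C (0, snd w))"
      by (simp add: fun_eq_iff mat2_action_basis scaleC_prod_def scaleC_one)
    moreover have "complex_linear (\<lambda>w :: 'a \<times> 'a. (- 1) *\<^sub>C (0 :: 'a, snd w))"
      by (simp add: complex_linear_iff scaleC_prod_def scaleC_add_right scaleC_scaleC)
    ultimately show ?thesis
      by (simp only: ext_deriv_add [OF lin(3)] ext_deriv_scale [OF lin(4)] e1_def e2_def)
        (simp add: scaleC_one)
  qed
  ultimately have "?h r' \<in> ?I" by simp
  moreover have "?h (r - r') \<in> ?I" by (rule A_ideal_mat2_action [OF form y f r'(1)])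
  ultimately have "?h r' + ?h (r - r') \<in> ?I"
    unfolding A_ideal_def by (intro univ_genideal_add)
  then show ?thesis
    by (simp add: derivation_linear [OF derivation_ext_deriv [OF complex_linear_mat2_action]])
qed

text \<open>The action of sl(2) commutes with the adjoint action, so a root vector \<open>X\<close>
  sends \<open>r\<close> to another invariant modulo the ideal. Hence \<open>h\<close> applies to
  both, and the commutator leaves a nonzero multiple of \<open>X\<close> on
  \<open>r\<close>.\<close>

lemma sl2_kills_invariants:
  assumes y: "orthonormal_basis \<beta> n y" and f: "structure_constants n y f"
    and h: "\<And>r. (\<And>z. ext_deriv (ad2 z) r \<in> A_ideal n y f) \<Longrightarrow> ext_deriv (mat2_action sl2_h) r \<in> A_ideal n y f"
    and r: "\<And>z. ext_deriv (ad2 z) r \<in> A_ideal n y f" and M: "M \<in> sl2"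
  shows "ext_deriv (mat2_action M) r \<in> A_ideal n y f"
proof -
  let ?I = "A_ideal n y f"
  let ?d = "\<lambda>M. ext_deriv (mat2_action M) :: ('a \<times> 'a) exterior \<Rightarrow> _"
  note lin = complex_linear_mat2_action [where 'a = 'a]
  have stable: "?d M a \<in> ?I" if "a \<in> ?I" for M a
    using A_ideal_mat2_action [OF form y f that] .
  have root: "?d X r \<in> ?I"
    if k: "k \<noteq> 0" and X: "\<And>w :: 'a \<times> 'a. mat2_action sl2_h (mat2_action X w)
      = mat2_action X (mat2_action sl2_h w) + k *\<^sub>C mat2_action X w" for X k
  proof -
    have "ext_deriv (ad2 z) (?d X r) \<in> ?I" for z
    proof -
      have "complex_linear (\<lambda>w :: 'a \<times> 'a. 0 :: 'a \<times> 'a)"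
        by (simp add: complex_linear_iff)
      note zero = ext_deriv_commutator [OF complex_linear_ad2 lin this]
        ext_deriv_scale [OF this, of 0]
      have "ext_deriv (ad2 z) (?d X r) = ?d X (ext_deriv (ad2 z) r)"
        using zero(1) [of z X r] zero(2) [of r]
        by (simp add: ad2_def mat2_action_def bracket_linear)
      then show ?thesis using stable r by simp
    qed
    then have "?d sl2_h (?d X r) \<in> ?I" by (rule h)
    moreover have "?d X (?d sl2_h r) \<in> ?I" using stable h r by blast
    moreover have "?d sl2_h (?d X r) = ?d X (?d sl2_h r) + k *\<^sub>C ?d X r"
    proof -
      have "complex_linear (\<lambda>w :: 'a \<times> 'a. k *\<^sub>C mat2_action X w)"
        using lin [of X] by (simp add: complex_linear_iff scaleC_add_right scaleC_scaleC mult.commute)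
      from ext_deriv_commutator [OF lin lin this X, of r] show ?thesis
        by (simp only: ext_deriv_scale [OF lin])
    qed
    ultimately have "inverse k *\<^sub>C (?d sl2_h (?d X r) - ?d X (?d sl2_h r)) \<in> ?I"
      unfolding A_ideal_def by (intro univ_genideal_scaleC univ_genideal_diff)
    moreover have "inverse k *\<^sub>C (?d sl2_h (?d X r) - ?d X (?d sl2_h r)) = ?d X r"
      using \<open>?d sl2_h (?d X r) = _\<close> k by (simp add: scaleC_scaleC scaleC_one)
    ultimately show ?thesis by simp
  qed
  have two: "(2 :: complex) *\<^sub>C u = u + u" for u :: 'a
    using scaleC_add_left [of 1 1 u] by (simp add: scaleC_one)
  have "?d sl2_e r \<in> ?I"
    by (rule root [of 2]) (simp_all add: mat2_action_basis scaleC_prod_def two)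
  moreover have "?d sl2_f r \<in> ?I"
    by (rule root [of "- 2"]) (simp_all add: mat2_action_basis scaleC_prod_def two)
  moreover have "?d sl2_h r \<in> ?I" using h r by blast
  moreover define a b c where "a = vec_nth (vec_nth M 1) 1" and "b = vec_nth (vec_nth M 1) 2"
    and "c = vec_nth (vec_nth M 2) 1"
  have "?d M r = a *\<^sub>C ?d sl2_h r + (b *\<^sub>C ?d sl2_e r + c *\<^sub>C ?d sl2_f r)"
  proof -
    have "vec_nth (vec_nth M 2) 2 = - a"
      using M by (simp add: sl2_def trace_def UNIV_2 a_def eq_neg_iff_add_eq_0 add.commute)
    then have eq: "mat2_action M = (\<lambda>w :: 'a \<times> 'a. a *\<^sub>C mat2_action sl2_h w
        + (b *\<^sub>C mat2_action sl2_e w + c *\<^sub>C mat2_action sl2_f w))"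
      by (simp add: fun_eq_iff mat2_action_basis mat2_action_def [of M] scaleC_prod_def a_def b_def c_def)
    have l: "complex_linear (\<lambda>w :: 'a \<times> 'a. k *\<^sub>C mat2_action X w)" for k X
      using lin [of X] by (simp add: complex_linear_iff scaleC_add_right scaleC_scaleC mult.commute)
    have l2: "complex_linear (\<lambda>w :: 'a \<times> 'a. b *\<^sub>C mat2_action sl2_e w + c *\<^sub>C mat2_action sl2_f w)"
      using l [of b sl2_e] l [of c sl2_f] by (simp add: complex_linear_iff scaleC_add_right)
    show ?thesis
      unfolding eq by (simp only: ext_deriv_add [OF l l2] ext_deriv_add [OF l l] ext_deriv_scale [OF lin])
  qed
  ultimately show ?thesis
    unfolding A_ideal_def by (simp only:) (intro univ_genideal_add univ_genideal_scaleC)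
qed

end

section \<open>Weight decomposition\<close>

text \<open>Coarser than the bigrading: only the difference of the degrees is kept, which is what
  \<open>sl2_h\<close> detects.\<close>

definition weight_space :: "int \<Rightarrow> ('g::complex_vector \<times> 'g) exterior set"
  where "weight_space j = complex_vector.span (\<Union>{R_component p q | p q. int p - int q = j})"

lemma R_component_weight: "R_component p q \<subseteq> weight_space (int p - int q)"
  unfolding weight_space_def by (rule order_trans [OF _ complex_vector.span_superset]) blast

lemma derivation_prod_list_eigen:
  assumes D: "derivation D" and g: "\<And>u. D (g u) = k *\<^sub>C g u"
  shows "D (prod_list (map g us)) = (of_nat (length us) * k) *\<^sub>C prod_list (map g us :: 'v::complex_vector exterior list)"
  by (induction us)
    (simp_all add: derivation_linear [OF D] g scaleC_mult_left scaleC_mult_right distrib_right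
      flip: scaleC_add_left)

lemma weight_space_eigen:
  assumes "r \<in> weight_space j"
  shows "ext_deriv (mat2_action sl2_h) r = of_int j *\<^sub>C r"
proof -
  let ?h = "ext_deriv (mat2_action sl2_h) :: ('a \<times> 'a) exterior \<Rightarrow> _"
  have D: "derivation ?h" by (rule derivation_ext_deriv [OF complex_linear_mat2_action])
  note d = derivation_linear [OF D]
  have h1: "?h (copy1 u) = 1 *\<^sub>C copy1 u" for u
    by (simp add: ext_deriv_gen [OF complex_linear_mat2_action] mat2_action_basis scaleC_one)
  have h2: "?h (copy2 u) = (- 1) *\<^sub>C copy2 u" for u
    unfolding ext_gen_scale [symmetric]
    by (simp add: ext_deriv_gen [OF complex_linear_mat2_action] mat2_action_basis scaleC_prod_def scaleC_one)
  have closed: "complex_vector.subspace {r. ?h r = of_int j *\<^sub>C r}"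
    by (auto simp: complex_vector.subspace_def d scaleC_add_right scaleC_scaleC mult.commute)
  have "R_component p q \<subseteq> {r. ?h r = of_int j *\<^sub>C r}" if "int p - int q = j" for p q
    unfolding R_component_def
  proof (rule complex_vector.span_minimal [OF _ closed], safe)
    fix us vs :: "'a list"
    assume "p = length us" "q = length vs"
    then have "(of_int j :: complex) = of_nat (length us) * 1 + of_nat (length vs) * (- 1)"
      using that by (auto simp flip: that)
    then show "?h (prod_list (map copy1 us) * prod_list (map copy2 vs))
        = of_int j *\<^sub>C (prod_list (map copy1 us) * prod_list (map copy2 vs))"
      by (simp only: d derivation_prod_list_eigen [OF D h1] derivation_prod_list_eigen [OF D h2]
          scaleC_mult_left scaleC_mult_right scaleC_add_left)
  qed
  then have "weight_space j \<subseteq> {r. ?h r = of_int j *\<^sub>C r}"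
    unfolding weight_space_def by (intro complex_vector.span_minimal closed) blast
  then show ?thesis using assms by blast
qed

lemma copy1_weight_space:
  assumes "r \<in> weight_space j"
  shows "copy1 u * r \<in> weight_space (j + 1)"
proof -
  have closed: "complex_vector.subspace {r. copy1 u * r \<in> weight_space (j + 1)}"
    by (auto simp: complex_vector.subspace_def weight_space_def distrib_left scaleC_mult_right
        complex_vector.span_zero complex_vector.span_add complex_vector.span_scale)
  have "R_component p q \<subseteq> {r. copy1 u * r \<in> weight_space (j + 1)}" if j: "int p - int q = j" for p q
    unfolding R_component_def
  proof (rule complex_vector.span_minimal [OF _ closed], safe)
    fix us vs :: "'a list" assume pq: "p = length us" "q = length vs"
    have "copy1 u * (prod_list (map copy1 us) * prod_list (map copy2 vs)) \<in> R_component (Suc p) q"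
      unfolding R_component_def using pq
      by (intro complex_vector.span_base CollectI exI [of _ "u # us"] exI [of _ vs]) (simp add: mult.assoc)
    moreover have "int (Suc p) - int q = j + 1" using j by simp
    with R_component_weight [of "Suc p" q] have "R_component (Suc p) q \<subseteq> weight_space (j + 1)"
      by (simp only:)
    ultimately show "copy1 u * (prod_list (map copy1 us) * prod_list (map copy2 vs)) \<in> weight_space (j + 1)"
      by blast
  qed
  then have "weight_space j \<subseteq> {r. copy1 u * r \<in> weight_space (j + 1)}"
    unfolding weight_space_def [of j] by (intro complex_vector.span_minimal closed) blast
  then show ?thesis using assms by blast
qed

lemma copy2_commute_copies1:
  "copy2 u * prod_list (map copy1 us) = ((- 1) ^ length us) *\<^sub>C (prod_list (map copy1 us) * copy2 u)"
proof (induction us)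
  case Nil
  show ?case by (simp add: scaleC_one)
next
  case (Cons v us)
  have "copy2 u * prod_list (map copy1 (v # us)) = - (copy1 v * (copy2 u * prod_list (map copy1 us)))"
    using ext_gen_anticommute [of "(0, u)" "(v, 0)"] by (simp flip: mult.assoc)
  then show ?case by (simp add: Cons scaleC_mult_right mult.assoc)
qed

lemma copy2_weight_space:
  assumes "r \<in> weight_space j"
  shows "copy2 u * r \<in> weight_space (j - 1)"
proof -
  have closed: "complex_vector.subspace {r. copy2 u * r \<in> weight_space (j - 1)}"
    by (auto simp: complex_vector.subspace_def weight_space_def distrib_left scaleC_mult_right
        complex_vector.span_zero complex_vector.span_add complex_vector.span_scale)
  have "R_component p q \<subseteq> {r. copy2 u * r \<in> weight_space (j - 1)}" if j: "int p - int q = j" for p q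
    unfolding R_component_def
  proof (rule complex_vector.span_minimal [OF _ closed], safe)
    fix us vs :: "'a list" assume pq: "p = length us" "q = length vs"
    have "prod_list (map copy1 us) * prod_list (map copy2 (u # vs)) \<in> R_component p (Suc q)"
      unfolding R_component_def using pq
      by (intro complex_vector.span_base CollectI exI [of _ us] exI [of _ "u # vs"]) simp
    then have "((- 1) ^ length us) *\<^sub>C (prod_list (map copy1 us) * prod_list (map copy2 (u # vs))) \<in> R_component p (Suc q)"
      unfolding R_component_def by (rule complex_vector.span_scale)
    also have "((- 1) ^ length us) *\<^sub>C (prod_list (map copy1 us) * prod_list (map copy2 (u # vs)))
        = copy2 u * (prod_list (map copy1 us) * prod_list (map copy2 vs))"
      using copy2_commute_copies1 [of u us] by (simp add: scaleC_mult_left flip: mult.assoc)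
    finally have "copy2 u * (prod_list (map copy1 us) * prod_list (map copy2 vs)) \<in> R_component p (Suc q)" .
    moreover have "int p - int (Suc q) = j - 1" using j by simp
    with R_component_weight [of p "Suc q"] have "R_component p (Suc q) \<subseteq> weight_space (j - 1)"
      by (simp only:)
    ultimately show "copy2 u * (prod_list (map copy1 us) * prod_list (map copy2 vs)) \<in> weight_space (j - 1)"
      by blast
  qed
  then have "weight_space j \<subseteq> {r. copy2 u * r \<in> weight_space (j - 1)}"
    unfolding weight_space_def [of j] by (intro complex_vector.span_minimal closed) blast
  then show ?thesis using assms by blast
qed

text \<open>Serves invariants that are not homogeneous; generators shift weights by one. Components
  outside \<open>S\<close> are 0, so that \<open>g 0\<close> is meaningful even when 0 is not in
  \<open>S\<close>. Directness of the sum is replaced by \<open>eigenvector_sum_mem\<close>.\<close>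

lemma weight_decomposition:
  fixes r :: "('g::complex_vector \<times> 'g) exterior"
  shows "\<exists>S g. finite S \<and> (\<forall>j. g j \<in> weight_space j) \<and> (\<forall>j. j \<notin> S \<longrightarrow> g j = 0) \<and> r = (\<Sum>j\<in>S. g j)"
    (is "?dec r")
proof -
  have zero: "0 \<in> weight_space j" for j :: int
    by (simp add: weight_space_def complex_vector.span_zero)
  have dec_add: "?dec (a + b)" if "?dec a" "?dec b" for a b :: "('g \<times> 'g) exterior"
  proof -
    from that obtain S g T h where S: "finite S" "\<forall>j. g j \<in> weight_space j" "\<forall>j. j \<notin> S \<longrightarrow> g j = 0" "a = (\<Sum>j\<in>S. g j)"
      and T: "finite T" "\<forall>j. h j \<in> weight_space j" "\<forall>j. j \<notin> T \<longrightarrow> h j = 0" "b = (\<Sum>j\<in>T. h j)" by blast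
    have "a = (\<Sum>j\<in>S \<union> T. g j)" unfolding S(4) by (rule sum.mono_neutral_left) (use S T in auto)
    moreover have "b = (\<Sum>j\<in>S \<union> T. h j)" unfolding T(4) by (rule sum.mono_neutral_left) (use S T in auto)
    ultimately have "a + b = (\<Sum>j\<in>S \<union> T. g j + h j)" by (simp add: sum.distrib)
    moreover have "g j + h j \<in> weight_space j" for j
      using S T by (simp add: weight_space_def complex_vector.span_add)
    ultimately show ?thesis
      using S T by (intro exI [of _ "S \<union> T"] exI [of _ "\<lambda>j. g j + h j"]) auto
  qed
  show ?thesis
  proof (induction r rule: exterior_induct)
    case (add a b)
    then show ?case by (rule dec_add)
  next
    case (scale c a)
    then obtain S g where S: "finite S" "\<forall>j. g j \<in> weight_space j" "\<forall>j. j \<notin> S \<longrightarrow> g j = 0" "a = (\<Sum>j\<in>S. g j)"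
      by blast
    moreover have "c *\<^sub>C g j \<in> weight_space j" for j
      using S by (simp add: weight_space_def complex_vector.span_scale)
    ultimately show ?case
      by (intro exI [of _ S] exI [of _ "\<lambda>j. c *\<^sub>C g j"]) (auto simp: complex_vector.scale_sum_right)
  next
    case one
    have "1 \<in> R_component 0 0"
      unfolding R_component_def by (intro complex_vector.span_base) simp
    then have "1 \<in> weight_space 0" using R_component_weight [of 0 0] by auto
    then show ?case
      by (intro exI [of _ "{0}"] exI [of _ "\<lambda>j. if j = 0 then 1 else 0"]) (auto simp: zero)
  next
    case (gen v a)
    then obtain S g where S: "finite S" "\<forall>j. g j \<in> weight_space j" "\<forall>j. j \<notin> S \<longrightarrow> g j = 0" "a = (\<Sum>j\<in>S. g j)"
      by blast
    have "?dec (copy1 (fst v) * a)"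
    proof (intro exI conjI allI impI)
      show "finite ((\<lambda>j. j + 1) ` S)" using S by simp
      show "copy1 (fst v) * g (j - 1) \<in> weight_space j" for j
        using copy1_weight_space [of "g (j - 1)" "j - 1"] S by simp
      show "copy1 (fst v) * g (j - 1) = 0" if "j \<notin> (\<lambda>j. j + 1) ` S" for j
      proof -
        have "j - 1 \<notin> S" using that by (metis diff_add_cancel image_eqI)
        then show ?thesis using S by simp
      qed
      show "copy1 (fst v) * a = (\<Sum>j\<in>(\<lambda>j. j + 1) ` S. copy1 (fst v) * g (j - 1))"
        by (simp add: sum.reindex S(4) sum_distrib_left)
    qed
    moreover have "?dec (copy2 (snd v) * a)"
    proof (intro exI conjI allI impI)
      show "finite ((\<lambda>j. j - 1) ` S)" using S by simp
      show "copy2 (snd v) * g (j + 1) \<in> weight_space j" for j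
        using copy2_weight_space [of "g (j + 1)" "j + 1"] S by simp
      show "copy2 (snd v) * g (j + 1) = 0" if "j \<notin> (\<lambda>j. j - 1) ` S" for j
      proof -
        have "j + 1 \<notin> S" using that by (metis add_diff_cancel_right' image_eqI)
        then show ?thesis using S by simp
      qed
      show "copy2 (snd v) * a = (\<Sum>j\<in>(\<lambda>j. j - 1) ` S. copy2 (snd v) * g (j + 1))"
        by (simp add: sum.reindex inj_on_def S(4) sum_distrib_left)
    qed
    ultimately have "?dec (copy1 (fst v) * a + copy2 (snd v) * a)" by (rule dec_add)
    moreover have "ext_gen v = copy1 (fst v) + copy2 (snd v)"
      by (simp flip: ext_gen_add)
    ultimately show ?case by (simp only: distrib_right)
  qed
qed

text \<open>Subtracting \<open>a\<close> times the sum from its image under \<open>D\<close> removes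
  the component of eigenvalue \<open>a\<close> and rescales the others by nonzero factors, which
  drives the induction.\<close>

lemma eigenvector_sum_mem:
  fixes D :: "'v::complex_vector exterior \<Rightarrow> 'v exterior" and g :: "int \<Rightarrow> 'v exterior"
  assumes D: "derivation D" and stable: "\<And>a. a \<in> genideal univ_ring R \<Longrightarrow> D a \<in> genideal univ_ring R"
    and "finite S" "\<And>j. j \<in> S \<Longrightarrow> D (g j) = of_int j *\<^sub>C g j" "(\<Sum>j\<in>S. g j) \<in> genideal univ_ring R" "i \<in> S"
  shows "g i \<in> genideal univ_ring R"
  using assms(3-)
proof (induction S arbitrary: g i rule: finite_induct)
  case (insert a S)
  let ?I = "genideal univ_ring R"
  let ?s = "\<Sum>j\<in>insert a S. g j"
  have "D ?s = (\<Sum>j\<in>insert a S. of_int j *\<^sub>C g j)"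
    using insert.prems(1) by (simp add: derivation_linear [OF D])
  then have "D ?s - of_int a *\<^sub>C ?s = (\<Sum>j\<in>S. (of_int j - of_int a) *\<^sub>C g j)"
    using insert.hyps
    by (simp add: scaleC_add_right complex_vector.scale_sum_right complex_vector.scale_left_diff_distrib
        sum_subtractf)
  moreover have "D ?s - of_int a *\<^sub>C ?s \<in> ?I"
    using insert.prems(2) by (intro univ_genideal_diff univ_genideal_scaleC stable)
  ultimately have sum: "(\<Sum>j\<in>S. (of_int j - of_int a) *\<^sub>C g j) \<in> ?I" by simp
  have mem: "g j \<in> ?I" if j: "j \<in> S" for j
  proof -
    have "(of_int j - of_int a) *\<^sub>C g j \<in> ?I"
    proof (rule insert.IH [OF _ sum j])
      show "D ((of_int l - of_int a) *\<^sub>C g l) = of_int l *\<^sub>C (of_int l - of_int a) *\<^sub>C g l" if "l \<in> S" for l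
        using that insert.prems(1) [of l] by (simp add: derivation_linear [OF D] scaleC_scaleC mult.commute)
    qed
    then have "inverse (of_int j - of_int a) *\<^sub>C (of_int j - of_int a) *\<^sub>C g j \<in> ?I"
      by (rule univ_genideal_scaleC)
    moreover have "(of_int j - of_int a :: complex) \<noteq> 0" using j insert.hyps by auto
    ultimately show ?thesis by (simp add: scaleC_scaleC scaleC_one)
  qed
  have "g a = ?s - (\<Sum>j\<in>S. g j)" using insert.hyps by simp
  also have "\<dots> \<in> ?I" by (rule univ_genideal_diff [OF insert.prems(2) univ_genideal_sum [OF mem]])
  finally have "g a \<in> ?I" .
  then show ?case using insert.prems(3) mem by blast
qed simp

lemma A_proj_zero: "A_proj n x f r = \<zero>\<^bsub>A_algebra n x f\<^esub> \<longleftrightarrow> r \<in> A_ideal n x f"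
proof -
  have "A_proj n x f 0 = \<zero>\<^bsub>A_algebra n x f\<^esub>"
    by (auto simp: A_proj_def A_algebra_def FactRing_def a_r_coset_def r_coset_def)
  then show ?thesis using A_proj_eq_iff [of n x f r 0] by simp
qed

theorem proposition1p2:
  fixes \<beta> :: "'g::complex_lie_algebra \<Rightarrow> 'g \<Rightarrow> complex"
    and n :: nat
    and x :: "nat \<Rightarrow> 'g"
    and f :: "nat \<Rightarrow> nat \<Rightarrow> nat \<Rightarrow> complex"
  assumes "finite_dimensional TYPE('g)"
    and "simple_lie_algebra TYPE('g)"
    and "invariant_form \<beta>"
    and "nondegenerate_form \<beta>"
    and "orthonormal_basis \<beta> n x"
    and "structure_constants n x f"
  shows "(\<forall>p q a. a \<in> A_invariants n x f \<and> a \<in> A_component n x f p q \<and>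
            a \<noteq> \<zero>\<^bsub>A_algebra n x f\<^esub> \<longrightarrow> (\<exists>d. (p, q) = (d, d)))
    \<and> A_invariants n x f \<subseteq> A_even n x f
    \<and> (\<forall>M\<in>sl2. \<forall>a\<in>A_invariants n x f.
          A_sl2_action n x f M a = \<zero>\<^bsub>A_algebra n x f\<^esub>)"
proof -
  note form = assms(3) and basis = assms(5) and f = assms(6)
  interpret based_metric_lie_algebra \<beta> n x
    using form basis by unfold_locales
  let ?I = "A_ideal n x f"
  let ?h = "ext_deriv (mat2_action sl2_h) :: ('g \<times> 'g) exterior \<Rightarrow> _"
  obtain y c U where y: "orthonormal_basis \<beta> n y" and c: "c \<noteq> 0" "\<And>u. casimir y u = c *\<^sub>C u"
    and U: "\<And>a i m. a < n \<Longrightarrow> i < n \<Longrightarrow> m < n \<Longrightarrow>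
      cnj (cubic (y a) (y i) (y m)) = (\<Sum>k<n. U a k * cubic (y k) (y i) (y m))"
    using self_adjoint_frame_exists [OF assms(2)] by blast
  let ?g = "\<lambda>i j k. cubic (y i) (y j) (y k)"
  have g: "structure_constants n y ?g" by (rule structure_constants_cubic [OF y])
  have I: "?I = A_ideal n y ?g"
    using A_ideal_subset_basis_change [OF basis f y g] A_ideal_subset_basis_change [OF y g basis f] by blast
  have h: "?h r \<in> ?I" if "\<And>z. ext_deriv (ad2 z) r \<in> ?I" for r
    using sl2_h_kills_invariants [OF y g c U] that unfolding I by blast
  have kill: "ext_deriv (mat2_action M) r \<in> ?I" if "\<And>z. ext_deriv (ad2 z) r \<in> ?I" "M \<in> sl2" for r M
    by (rule sl2_kills_invariants [OF basis f h that])
  have inv: "ext_deriv (ad2 z) r \<in> ?I" if "A_proj n x f r \<in> A_invariants n x f" for r z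
  proof -
    have "A_lie_action n x f z (A_proj n x f r) = A_proj n x f (ext_deriv (ad2 z) r)"
      unfolding A_lie_action_def
      by (rule A_induced_proj [OF derivation_ext_deriv [OF complex_linear_ad2]])
        (rule A_ideal_lie_action [OF form basis f])
    then show ?thesis using that by (simp add: A_invariants_def flip: A_proj_zero)
  qed
  have rep: "\<exists>r. a = A_proj n x f r" if "a \<in> A_invariants n x f" for a
    using that
    by (auto simp: A_invariants_def A_algebra_def A_proj_def FactRing_def A_RCOSETS_def RCOSETS_def
        a_r_coset_def)
  have diagonal: "p = q" if a: "a \<in> A_invariants n x f" "a \<in> A_component n x f p q" "a \<noteq> \<zero>\<^bsub>A_algebra n x f\<^esub>"
    for p q a
  proof (rule ccontr)
    assume "p \<noteq> q"
    obtain r where r: "a = A_proj n x f r" "r \<in> R_component p q"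
      using a(2) by (auto simp: A_component_def)
    have "?h r = (of_int (int p - int q)) *\<^sub>C r"
      using r(2) R_component_weight by (intro weight_space_eigen) blast
    moreover have "?h r \<in> ?I" using h inv a(1) r(1) by blast
    ultimately have "(of_int (int p - int q)) *\<^sub>C r \<in> ?I" by (simp only:)
    then have "inverse (of_int (int p - int q)) *\<^sub>C of_int (int p - int q) *\<^sub>C r \<in> ?I"
      unfolding A_ideal_def by (rule univ_genideal_scaleC)
    moreover have "(of_int (int p - int q) :: complex) \<noteq> 0" using \<open>p \<noteq> q\<close> by (simp only: of_int_eq_0_iff)
    ultimately have "r \<in> ?I" by (simp add: scaleC_scaleC scaleC_one del: of_int_diff)
    then show False using a(3) r(1) by (simp add: A_proj_zero)
  qed
  have even: "a \<in> A_even n x f" if a: "a \<in> A_invariants n x f" for a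
  proof -
    obtain r where r: "a = A_proj n x f r" using rep a by blast
    obtain S g where S: "finite S" "\<forall>j. g j \<in> weight_space j" "\<forall>j. j \<notin> S \<longrightarrow> g j = 0" "r = (\<Sum>j\<in>S. g j)"
      using weight_decomposition by blast
    have D: "derivation ?h" by (rule derivation_ext_deriv [OF complex_linear_mat2_action])
    note d = derivation_linear [OF D]
    have eig: "?h (g j) = of_int j *\<^sub>C g j" for j
      using S(2) by (intro weight_space_eigen) blast
    \<comment> \<open>The components of \<open>?h r\<close> are the multiples j \<open>g j\<close>,
      so membership in the ideal forces \<open>g j\<close> into it for every j other than 0, and
      \<open>r\<close> reduces to \<open>g 0\<close>.\<close>
    have hr: "(\<Sum>j\<in>S. of_int j *\<^sub>C g j) \<in> ?I"
      using h [of r] inv a r by (simp add: S(4) d eig)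
    have mem: "g j \<in> ?I" if j: "j \<in> S" "j \<noteq> 0" for j
    proof -
      have "of_int j *\<^sub>C g j \<in> genideal univ_ring (A_relations n x f)"
      proof (rule eigenvector_sum_mem [OF D _ S(1) _ _ j(1)])
        show "?h b \<in> genideal univ_ring (A_relations n x f)" if "b \<in> genideal univ_ring (A_relations n x f)" for b
          using A_ideal_mat2_action [OF form basis f] that by (simp add: A_ideal_def)
      qed (use hr in \<open>simp_all add: A_ideal_def d eig scaleC_scaleC\<close>)
      then have "inverse (of_int j) *\<^sub>C of_int j *\<^sub>C g j \<in> ?I"
        unfolding A_ideal_def by (rule univ_genideal_scaleC)
      then show ?thesis using j by (simp add: scaleC_scaleC scaleC_one)
    qed
    have "r - g 0 = (\<Sum>j\<in>S - {0}. g j)"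
      using S by (cases "0 \<in> S") (auto simp: sum_diff1)
    also have "\<dots> \<in> ?I"
      using mem unfolding A_ideal_def by (intro univ_genideal_sum) auto
    finally have "a = A_proj n x f (g 0)" by (simp add: r A_proj_eq_iff)
    moreover have "g 0 \<in> complex_vector.span (\<Union>{R_component p q | p q. even (p + q)})"
    proof -
      have "weight_space 0 \<subseteq> complex_vector.span (\<Union>{R_component p q | p q. even (p + q)})"
        unfolding weight_space_def by (intro complex_vector.span_mono Union_mono) force
      then show ?thesis using S(2) by blast
    qed
    ultimately show ?thesis by (auto simp: A_even_def)
  qed
  have trivial: "A_sl2_action n x f M a = \<zero>\<^bsub>A_algebra n x f\<^esub>" if M: "M \<in> sl2" and a: "a \<in> A_invariants n x f" for M a
  proof -
    obtain r where r: "a = A_proj n x f r" using rep a by blast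
    have "A_sl2_action n x f M a = A_proj n x f (ext_deriv (mat2_action M) r)"
      unfolding A_sl2_action_def r
      by (rule A_induced_proj [OF derivation_ext_deriv [OF complex_linear_mat2_action]])
        (rule A_ideal_mat2_action [OF form basis f])
    then show ?thesis using kill [OF inv M] a r by (simp add: A_proj_zero)
  qed
  show ?thesis
  proof (intro conjI allI impI ballI subsetI)
    fix p q a
    assume "a \<in> A_invariants n x f \<and> a \<in> A_component n x f p q \<and> a \<noteq> \<zero>\<^bsub>A_algebra n x f\<^esub>"
    then have "p = q" using diagonal by metis
    then show "\<exists>d. (p, q) = (d, d)" by simp
  qed (rule even trivial; assumption)+
qed

end
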